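(* Let $0<\alpha,\beta<1$, let $0<t<1/2$, and let $N$ be a positive integer with $tN\in\mathbb Z$. Let $-N\le \xi,\xi'\le -1$ and $0<m,m'<N$ be integers. The $t$-split two-periodic Aztec diamond of size $2N$ has a correlation kernel $\mathbb K_N$ given as follows, where $\left[\mathbb K_N(4m',2\xi'+j;4m,2\xi+i)\right]_{i,j=0,1}$ denotes the $2\times2$ matrix whose rows are indexed by $j\in\{0,1\}$ (attached to the primed point) and whose columns are indexed by $i\in\{0,1\}$. For $0<m'\le tN$: $$\begin{aligned} &\left[\mathbb K_N(4m',2\xi'+j;4m,2\xi+i)\right]_{i,j=0,1} = -\frac{\mathbf 1_{m>m'}}{2\pi \mathrm i} \oint_{\gamma_{0,1}}\frac{dz}{z} z^{\xi'-\xi}\phi_{m'\to m,N}(z)\\ &+\frac{1}{(2\pi \mathrm i)^2}\oint_{\gamma_1} dw \oint_{\gamma_{0,1}} \frac{dz}{z(z-w)}\frac{w^{\xi'+N}(z-1)^N}{z^{\xi+N}(w-1)^N}\,r_{\alpha,1}(w)^{tN-m'}F_{\alpha,1}(w)\, \Phi_{\beta}(w)^{(1/2-t)N} \Phi_{\beta}(z)^{(t-1/2)N}\Phi_{\alpha}(z)^{-tN}\phi_{0\to m,N}(z) \\ &+ \frac{1}{(2\pi \mathrm i)^2}\oint_{\gamma_1}dw\oint_{\gamma_{0,1}} \frac{dz}{z(z-w)}\frac{w^{\xi'+N}(z-1)^N}{z^{\xi+N}(w-1)^N}\,r_{\alpha,2}(w)^{tN-m'} c(w) F_{\alpha,2}(w)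 F_{\beta,1}(w)F_{\alpha,1}(w)\\ &\qquad\times \Phi_{\beta}(w)^{(1/2-t)N} \Phi_{\beta}(z)^{(t-1/2)N} \Phi_{\alpha}(z)^{-tN}\phi_{0\to m,N}(z). \end{aligned}$$ For $tN<m'<N$: $$\begin{aligned} &\left[\mathbb K_N(4m',2\xi'+j;4m,2\xi+i)\right]_{i,j=0,1} = - \frac{\mathbf 1_{m>m'}}{2\pi \mathrm i} \oint_{\gamma_{0,1}}\frac{dz}{z} z^{\xi'-\xi} \phi_{m' \to m,N}(z) \\ &+ \frac{1}{(2\pi \mathrm i)^2}\oint_{\gamma_1} dw \oint_{\gamma_{0,1}} \frac{dz}{z(z-w)}\frac{w^{\xi'+N}(z-1)^N}{z^{\xi+N}(w-1)^N}\,r_{\beta,1}(w)^{N/2-m'} F_{\beta,1}(w)\,\Phi_{\beta}(z)^{(t-1/2)N}\Phi_{\alpha}(z)^{-tN}\phi_{0\to m,N}(z) \\ &+ \frac{1}{(2\pi \mathrm i)^2}\oint_{\gamma_1}dw\oint_{\gamma_{0,1}} \frac{dz}{z(z-w)}\frac{w^{\xi'+N}(z-1)^N}{z^{\xi+N}(w-1)^N}\,r_{\beta,1}(w)^{(2t - 1/2)N - m'}c(w)F_{\beta,1}(w)F_{\alpha,1}(w)F_{\beta,2}(w)\\ &\qquad\times \Phi_{\beta}(z)^{(t-1/2)N}\Phi_{\alpha}(z)^{-tN}\phi_{0\to m,N}(z). \end{aligned}$$ In both cases $\gamma_1$ is a simple, positively oriented contour surrounding $1$ but not $0$ (and not meeting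 the branch cuts of the integrand), and $\gamma_{0,1}$ is a simple, positively oriented contour surrounding both $0$ and $1$ with $\gamma_1$ in its interior.
   Context: **Model.** Let $n=2N$. The Aztec diamond graph of size $n$ has white vertices $\{(2j+1,2k):0\le j\le n-1,\,0\le k\le n\}$ and black vertices $\{(2j,2k+1):0\le j\le n,\,0\le k\le n-1\}$; a white vertex $w=(w_x,w_y)$ and a black vertex $b$ are joined by an edge iff $w-b\in\{(\pm1,\pm1)\}$ (all four sign choices). Fix $0<\alpha,\beta<1$ and $t$ with $tN\in\mathbb Z$. The edge weights of the $t$-split two-periodic Aztec diamond are: if $w_x\equiv 1 \bmod 4$ and $w-b=(\pm1,-1)$, the weight is $\epsilon^2$ when $w_y\equiv0\bmod 4$ and $\epsilon^{-2}$ when $w_y\equiv 2\bmod 4$, where $\epsilon=\alpha$ if $w_x<4tN$ and $\epsilon=\beta$ if $w_x>4tN$; all other edges have weight $1$. A dimer covering (perfect matching) is chosen with probability proportional to the product of its edge weights. **Coordinates and point process.** Relabel the black vertex $(2j,2k+1)$ as $(2j,k-2N)$, so its second coordinate lies in $\{-2N,\dots,-1\}$. The black vertex with new coordinate $(4m,u)$, $0<m<N$, $-2N\le u\le -1$, is *occupied* if it is matched to a white vertex with $x$-coordinate $4m+1$ (i.e. to its right). Every $u$ is written as $u=2\xi+i$ with $-N\le\xi\le-1$, $i\in\{0,1\}$. A function $\mathbb K_N$ is a correlation kernel of the model if for all distinct points $p_1,\dots,p_k$ of the form $(4m,u)$, the probability that all $p_1,\dots,p_k$ are occupied is $\det[\mathbb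 K_N(p_a;p_b)]_{a,b=1}^k$. **Functions.** For $\epsilon\in\{\alpha,\beta\}$, $$\Phi_\epsilon(z)=\frac1{(1-z^{-1})^2}\begin{pmatrix}1&\epsilon^2z^{-1}\\ \epsilon^{-2}&1\end{pmatrix}^2\begin{pmatrix}1&z^{-1}\\1&1\end{pmatrix}^2 .$$ For $m'\le m$, $\phi_{m'\to m,N}(z)=\Phi_\alpha(z)^{m-m'}$ if $m\le tN$; $=\Phi_\alpha(z)^{tN-m'}\Phi_\beta(z)^{m-tN}$ if $m'\le tN\le m$; $=\Phi_\beta(z)^{m-m'}$ if $m'\ge tN$. The eigenvalues of $\Phi_\epsilon$ are, with $+$ for index $1$ and $-$ for index $2$, $$r_{\epsilon,1},\,r_{\epsilon,2}(z)=\frac{1}{(z-1)^2}\Big((z+1)^2+2z(\epsilon^2+\epsilon^{-2})\pm2(\epsilon+\epsilon^{-1})\sqrt{z^3+(\epsilon^2+\epsilon^{-2})z^2+z}\Big),$$ the square root having cuts $(-\infty,-\epsilon^{-2}]\cup[-\epsilon^2,0]$ and being positive for $z>0$. $F_{\epsilon,1}(z),F_{\epsilon,2}(z)$ are the corresponding spectral projections, so $\Phi_\epsilon^k=r_{\epsilon,1}^kF_{\epsilon,1}+r_{\epsilon,2}^kF_{\epsilon,2}$; explicitly, with $S_\epsilon(z)=\sqrt{z(z+\epsilon^2)(1+\epsilon^2z)}$ (same cuts, positive for $z>0$), $$F_{\epsilon,1}(z)=\tfrac12 I+\frac1{2S_\epsilon(z)}\begin{pmatrix}z(\epsilon^2-1)&\epsilon^2(z+1)\\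 z(z+1)&-z(\epsilon^2-1)\end{pmatrix},\qquad F_{\epsilon,2}(z)=I-F_{\epsilon,1}(z).$$ Finally $$g_{\alpha,\beta}(z)=\frac{2z(1+\alpha^2\beta^2)+(\alpha^2+\beta^2)(z^2+1)}{4\sqrt{(z+\alpha^2)(1+\alpha^2z)(z+\beta^2)(1+\beta^2z)}},\qquad c(z)=\frac{2}{1+2g_{\alpha,\beta}(z)},$$ where for $\beta>\alpha$ the square root is positive for $z>0$ with cuts $[-\alpha^{-2},-\beta^{-2}]\cup[-\beta^2,-\alpha^2]$ (roles exchanged if $\alpha>\beta$), and $g_{\alpha,\alpha}\equiv1/2$. $\mathbf 1_{A}$ is $1$ if $A$ holds and $0$ otherwise.
   Formalization: The formal theorem assumes that N is even; for odd N the powers Φ_β^{(1/2-t)N} and r_{β,1}^{N/2-m'} have half-integer exponents, for which no branch is specified and r_{β,1} has no analytic square root off its cuts. *)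

theory Defs
  imports
    "HOL-Complex_Analysis.Complex_Analysis"
    "HOL-Probability.Probability"
    "Jordan_Normal_Form.Determinant"
    "Jordan_Normal_Form.Gauss_Jordan_Elimination"
begin

hide_const (open) Determinants.det Finite_Cartesian_Product.mat

text \<open>
  Conventions. All coordinates and sizes are integers. The integer \<open>T\<close> stands for the product
  \<open>t N\<close>, and \<open>N\<close> is even, so that \<open>(1/2 - t) N\<close> is the integer \<open>N div 2 - T\<close>. Matrices are those
  of \<open>Jordan_Normal_Form\<close>, whose indices start from 0.
\<close>

section \<open>The \<open>t\<close>-split two-periodic Aztec diamond\<close>

type_synonym vertex = "int \<times> int"
type_synonym edge = "vertex \<times> vertex"

definition white_vertices :: "int \<Rightarrow> vertex set" where
  "white_vertices N = (\<lambda>(j, k). (2 * j + 1, 2 * k)) ` ({0..2 * N - 1} \<times> {0..2 * N})"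

definition black_vertices :: "int \<Rightarrow> vertex set" where
  "black_vertices N = (\<lambda>(j, k). (2 * j, 2 * k + 1)) ` ({0..2 * N} \<times> {0..2 * N - 1})"

text \<open>An edge is a pair of a white vertex and a black vertex, in this order.\<close>

definition edges :: "int \<Rightarrow> edge set" where
  "edges N = {(w, b). w \<in> white_vertices N \<and> b \<in> black_vertices N \<and>
     w - b \<in> {(1, 1), (1, -1), (-1, 1), (-1, -1)}}"

definition edge_weight :: "int \<Rightarrow> real \<Rightarrow> real \<Rightarrow> edge \<Rightarrow> real" where
  "edge_weight T \<alpha> \<beta> = (\<lambda>(w, b).
     let \<epsilon> = (if fst w < 4 * T then \<alpha> else \<beta>) in
     if fst w mod 4 = 1 \<and> w - b \<in> {(1, -1), (-1, -1)}
     then (if snd w mod 4 = 0 then \<epsilon> ^ 2 else 1 / \<epsilon> ^ 2)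
     else 1)"

definition dimer_coverings :: "int \<Rightarrow> edge set set" where
  "dimer_coverings N = {M. M \<subseteq> edges N \<and>
     (\<forall>w\<in>white_vertices N. \<exists>!b. (w, b) \<in> M) \<and>
     (\<forall>b\<in>black_vertices N. \<exists>!w. (w, b) \<in> M)}"

definition covering_weight :: "int \<Rightarrow> real \<Rightarrow> real \<Rightarrow> edge set \<Rightarrow> real" where
  "covering_weight T \<alpha> \<beta> M = (\<Prod>e\<in>M. edge_weight T \<alpha> \<beta> e)"

definition partition_function :: "int \<Rightarrow> int \<Rightarrow> real \<Rightarrow> real \<Rightarrow> real" where
  "partition_function N T \<alpha> \<beta> = (\<Sum>M\<in>dimer_coverings N. covering_weight T \<alpha> \<beta> M)"

definition dimer_pmf :: "int \<Rightarrow> int \<Rightarrow> real \<Rightarrow> real \<Rightarrow> edge set pmf" where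
  "dimer_pmf N T \<alpha> \<beta> = embed_pmf (\<lambda>M.
     if M \<in> dimer_coverings N then covering_weight T \<alpha> \<beta> M / partition_function N T \<alpha> \<beta> else 0)"

lemma finite_dimer_coverings: "finite (dimer_coverings N)"
proof -
  have "edges N \<subseteq> white_vertices N \<times> black_vertices N"
    by (auto simp: edges_def)
  then have "finite (edges N)"
    by (rule finite_subset) (auto simp: white_vertices_def black_vertices_def)
  then show ?thesis
    by (rule finite_subset[rotated, OF finite_Pow_iff[THEN iffD2]]) (auto simp: dimer_coverings_def)
qed

lemma covering_weight_pos:
  assumes "0 < \<alpha>" "0 < \<beta>"
  shows "0 < covering_weight T \<alpha> \<beta> M"
  unfolding covering_weight_def using assms
  by (intro prod_pos) (auto simp: edge_weight_def Let_def)

lemma dimer_coverings_nonempty: "dimer_coverings N \<noteq> {}"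
proof -
  define f :: "int \<times> int \<Rightarrow> edge" where
    "f = (\<lambda>(j, k). ((2 * j + 1, 2 * k),
       if k \<le> j then (2 * j + 2, 2 * k + 1) else (2 * j, 2 * k - 1)))"
  define M where "M = f ` ({0..2 * N - 1} \<times> {0..2 * N})"
  have mem: "(w, b) \<in> M \<longleftrightarrow> (\<exists>j k. 0 \<le> j \<and> j \<le> 2 * N - 1 \<and> 0 \<le> k \<and> k \<le> 2 * N \<and>
      w = (2 * j + 1, 2 * k) \<and>
      b = (if k \<le> j then (2 * j + 2, 2 * k + 1) else (2 * j, 2 * k - 1)))" for w b
    unfolding M_def f_def
    by (auto simp only: image_iff Bex_def mem_Sigma_iff split_paired_Ex case_prod_conv
        atLeastAtMost_iff prod.inject)
  have black: "(x, y) \<in> black_vertices N \<longleftrightarrow>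
      (\<exists>j k. 0 \<le> j \<and> j \<le> 2 * N \<and> 0 \<le> k \<and> k \<le> 2 * N - 1 \<and> x = 2 * j \<and> y = 2 * k + 1)" for x y
    unfolding black_vertices_def by force
  have white: "(x, y) \<in> white_vertices N \<longleftrightarrow>
      (\<exists>j k. 0 \<le> j \<and> j \<le> 2 * N - 1 \<and> 0 \<le> k \<and> k \<le> 2 * N \<and> x = 2 * j + 1 \<and> y = 2 * k)" for x y
    unfolding white_vertices_def by force
  have "M \<subseteq> edges N"
  proof
    fix e assume "e \<in> M"
    then obtain j k where jk: "0 \<le> j" "j \<le> 2 * N - 1" "0 \<le> k" "k \<le> 2 * N"
      and e: "e = ((2 * j + 1, 2 * k),
        if k \<le> j then (2 * j + 2, 2 * k + 1) else (2 * j, 2 * k - 1))"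
      unfolding M_def f_def by auto
    have "(2 * j + 1, 2 * k) \<in> white_vertices N"
      using jk by (auto simp: white)
    moreover have "(2 * j + 2, 2 * k + 1) \<in> black_vertices N" if "k \<le> j"
      unfolding black
      by (rule exI[of _ "j + 1"], rule exI[of _ k]) (use jk that in auto)
    moreover have "(2 * j, 2 * k - 1) \<in> black_vertices N" if "\<not> k \<le> j"
      unfolding black
      by (rule exI[of _ j], rule exI[of _ "k - 1"]) (use jk that in auto)
    moreover have "(2 * j + 1, 2 * k) - (2 * j + 2, 2 * k + 1) = (- 1 :: int, - 1 :: int)"
      and "(2 * j + 1, 2 * k) - (2 * j, 2 * k - 1) = (1 :: int, 1 :: int)"
      by (auto simp: minus_prod_def)
    ultimately show "e \<in> edges N"
      unfolding e edges_def mem_Collect_eq case_prod_conv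
      by (cases "k \<le> j") (simp_all only: if_True if_False insert_iff simp_thms)
  qed
  moreover have "\<exists>!b. (w, b) \<in> M" if w_in: "w \<in> white_vertices N" for w
  proof -
    obtain j k where w: "0 \<le> j" "j \<le> 2 * N - 1" "0 \<le> k" "k \<le> 2 * N" "w = (2 * j + 1, 2 * k)"
      using w_in unfolding white_vertices_def by auto
    show ?thesis
      by (rule ex1I[of _ "if k \<le> j then (2 * j + 2, 2 * k + 1) else (2 * j, 2 * k - 1)"])
        (use w in \<open>auto simp: mem\<close>)
  qed
  moreover have "\<exists>!w. (w, b) \<in> M" if b_in: "b \<in> black_vertices N" for b
  proof -
    obtain j k where b: "0 \<le> j" "j \<le> 2 * N" "0 \<le> k" "k \<le> 2 * N - 1" "b = (2 * j, 2 * k + 1)"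
      using b_in unfolding black_vertices_def by auto
    define j' k' where "j' = (if k < j then j - 1 else j)" and "k' = (if k < j then k else k + 1)"
    show ?thesis
    proof (rule ex1I[of _ "(2 * j' + 1, 2 * k')"])
      show "((2 * j' + 1, 2 * k'), b) \<in> M"
        unfolding mem by (rule exI[of _ j'], rule exI[of _ k']) (use b in \<open>auto simp: j'_def k'_def\<close>)
    next
      fix w assume "(w, b) \<in> M"
      then obtain i l where il: "w = (2 * i + 1, 2 * l)"
        "(2 * j, 2 * k + 1) = (if l \<le> i then (2 * i + 2, 2 * l + 1) else (2 * i, 2 * l - 1))"
        unfolding mem b(5) by blast
      then have "i = j' \<and> l = k'"
        unfolding j'_def k'_def by (cases "l \<le> i") auto
      then show "w = (2 * j' + 1, 2 * k')"
        using il by simp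
    qed
  qed
  ultimately have "M \<in> dimer_coverings N"
    by (auto simp: dimer_coverings_def)
  then show ?thesis by auto
qed

lemma partition_function_pos:
  assumes "0 < \<alpha>" "0 < \<beta>"
  shows "0 < partition_function N T \<alpha> \<beta>"
  unfolding partition_function_def
  by (intro sum_pos finite_dimer_coverings dimer_coverings_nonempty covering_weight_pos assms)

lemma pmf_dimer_pmf:
  assumes "0 < \<alpha>" "0 < \<beta>"
  shows "pmf (dimer_pmf N T \<alpha> \<beta>) M =
    (if M \<in> dimer_coverings N then covering_weight T \<alpha> \<beta> M / partition_function N T \<alpha> \<beta> else 0)"
proof -
  let ?f = "\<lambda>M. if M \<in> dimer_coverings N
    then covering_weight T \<alpha> \<beta> M / partition_function N T \<alpha> \<beta> else 0"
  have nonneg: "0 \<le> ?f M" for M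
    using covering_weight_pos[OF assms, of T M] partition_function_pos[OF assms, of N T] by auto
  have "(\<integral>\<^sup>+M. ennreal (?f M) \<partial>count_space UNIV) = (\<Sum>M\<in>dimer_coverings N. ennreal (?f M))"
    by (rule nn_integral_count_space'[OF finite_dimer_coverings]) auto
  also have "\<dots> = ennreal (\<Sum>M\<in>dimer_coverings N. ?f M)"
    by (intro sum_ennreal nonneg)
  also have "(\<Sum>M\<in>dimer_coverings N. ?f M) = 1"
    using partition_function_pos[OF assms, of N T]
    by (simp add: sum_divide_distrib[symmetric] partition_function_def)
  finally show ?thesis
    unfolding dimer_pmf_def by (subst pmf_embed_pmf) (use nonneg in auto)
qed

section \<open>The point process\<close>

text \<open>
  In the new coordinates the black vertex \<open>(2j, 2k + 1)\<close> is \<open>(2j, k - 2N)\<close>;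
  \<open>black_vertex\<close> converts back to the original ones.
\<close>

definition black_vertex :: "int \<Rightarrow> int \<times> int \<Rightarrow> vertex" where
  "black_vertex N = (\<lambda>(x, u). (x, 2 * (u + 2 * N) + 1))"

definition points :: "int \<Rightarrow> (int \<times> int) set" where
  "points N = {(4 * m, u) | m u. 0 < m \<and> m < N \<and> - 2 * N \<le> u \<and> u \<le> - 1}"

definition occupied :: "int \<Rightarrow> edge set \<Rightarrow> int \<times> int \<Rightarrow> bool" where
  "occupied N M p \<longleftrightarrow> (\<exists>w. (w, black_vertex N p) \<in> M \<and> fst w = fst p + 1)"

definition correlation_kernel ::
  "int \<Rightarrow> int \<Rightarrow> real \<Rightarrow> real \<Rightarrow> (int \<times> int \<Rightarrow> int \<times> int \<Rightarrow> complex) \<Rightarrow> bool" where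
  "correlation_kernel N T \<alpha> \<beta> K \<longleftrightarrow>
     (\<forall>ps. distinct ps \<and> set ps \<subseteq> points N \<longrightarrow>
       of_real (measure_pmf.prob (dimer_pmf N T \<alpha> \<beta>) {M. \<forall>p\<in>set ps. occupied N M p})
       = det (mat (length ps) (length ps) (\<lambda>(a, b). K (ps ! a) (ps ! b))))"

section \<open>Matrix functions\<close>

definition mat_powi :: "complex mat \<Rightarrow> int \<Rightarrow> complex mat" (infixr \<open>^\<^sub>m\<^sub>i\<close> 75) where
  "A ^\<^sub>m\<^sub>i k = (if 0 \<le> k then A ^\<^sub>m nat k else the (mat_inverse A) ^\<^sub>m nat (- k))"

definition Phi :: "real \<Rightarrow> complex \<Rightarrow> complex mat" where
  "Phi \<epsilon> z = (1 / (1 - 1 / z) ^ 2) \<cdot>\<^sub>m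
     (mat_of_rows_list 2 [[1, of_real (\<epsilon> ^ 2) / z], [of_real (1 / \<epsilon> ^ 2), 1]] ^\<^sub>m 2 *
      mat_of_rows_list 2 [[1, 1 / z], [1, 1]] ^\<^sub>m 2)"

definition transition :: "int \<Rightarrow> real \<Rightarrow> real \<Rightarrow> int \<Rightarrow> int \<Rightarrow> complex \<Rightarrow> complex mat" where
  "transition T \<alpha> \<beta> m' m z =
     (if m \<le> T then Phi \<alpha> z ^\<^sub>m\<^sub>i (m - m')
      else if m' \<le> T then Phi \<alpha> z ^\<^sub>m\<^sub>i (T - m') * Phi \<beta> z ^\<^sub>m\<^sub>i (m - T)
      else Phi \<beta> z ^\<^sub>m\<^sub>i (m - m'))"

text \<open>
  The square roots below are products of principal square roots of linear factors. A product of an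
  even number of these is continuous across a stretch of the negative axis on which all of them
  change sign, so only the following cuts remain: \<open>(-\<infinity>, -\<epsilon>\<^sup>-\<^sup>2] \<union> [-\<epsilon>\<^sup>2, 0]\<close> for the square root of
  \<open>z\<^sup>3 + (\<epsilon>\<^sup>2 + \<epsilon>\<^sup>-\<^sup>2) z\<^sup>2 + z = z (z + \<epsilon>\<^sup>2) (z + \<epsilon>\<^sup>-\<^sup>2)\<close> and for \<open>S_sqrt\<close>, and
  \<open>[-\<alpha>\<^sup>-\<^sup>2, -\<beta>\<^sup>-\<^sup>2] \<union> [-\<beta>\<^sup>2, -\<alpha>\<^sup>2]\<close> (with \<open>\<alpha>\<close>, \<open>\<beta>\<close> exchanged if \<open>\<alpha> > \<beta>\<close>) for the square root in \<open>g_fun\<close>.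
  All of them are positive for \<open>z > 0\<close>. For \<open>\<alpha> = \<beta>\<close> the function \<open>g_fun\<close> is \<open>1/2\<close> away from its
  two removable singularities \<open>-\<alpha>\<^sup>2\<close> and \<open>-\<alpha>\<^sup>-\<^sup>2\<close>, which lie on the branch cuts excluded below.
\<close>

definition discriminant_sqrt :: "real \<Rightarrow> complex \<Rightarrow> complex" where
  "discriminant_sqrt \<epsilon> z = csqrt z * csqrt (z + of_real (\<epsilon> ^ 2)) * csqrt (z + of_real (1 / \<epsilon> ^ 2))"

definition S_sqrt :: "real \<Rightarrow> complex \<Rightarrow> complex" where
  "S_sqrt \<epsilon> z = csqrt z * csqrt (z + of_real (\<epsilon> ^ 2)) * csqrt (1 + of_real (\<epsilon> ^ 2) * z)"

definition eig_r1 :: "real \<Rightarrow> complex \<Rightarrow> complex" where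
  "eig_r1 \<epsilon> z = ((z + 1) ^ 2 + 2 * z * of_real (\<epsilon> ^ 2 + 1 / \<epsilon> ^ 2)
     + 2 * of_real (\<epsilon> + 1 / \<epsilon>) * discriminant_sqrt \<epsilon> z) / (z - 1) ^ 2"

definition eig_r2 :: "real \<Rightarrow> complex \<Rightarrow> complex" where
  "eig_r2 \<epsilon> z = ((z + 1) ^ 2 + 2 * z * of_real (\<epsilon> ^ 2 + 1 / \<epsilon> ^ 2)
     - 2 * of_real (\<epsilon> + 1 / \<epsilon>) * discriminant_sqrt \<epsilon> z) / (z - 1) ^ 2"

definition proj_F1 :: "real \<Rightarrow> complex \<Rightarrow> complex mat" where
  "proj_F1 \<epsilon> z = (1 / 2) \<cdot>\<^sub>m 1\<^sub>m 2 + (1 / (2 * S_sqrt \<epsilon> z)) \<cdot>\<^sub>m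
     mat_of_rows_list 2
       [[z * of_real (\<epsilon> ^ 2 - 1), of_real (\<epsilon> ^ 2) * (z + 1)],
        [z * (z + 1), - z * of_real (\<epsilon> ^ 2 - 1)]]"

definition proj_F2 :: "real \<Rightarrow> complex \<Rightarrow> complex mat" where
  "proj_F2 \<epsilon> z = 1\<^sub>m 2 - proj_F1 \<epsilon> z"

definition g_fun :: "real \<Rightarrow> real \<Rightarrow> complex \<Rightarrow> complex" where
  "g_fun \<alpha> \<beta> z =
     (2 * z * of_real (1 + \<alpha> ^ 2 * \<beta> ^ 2) + of_real (\<alpha> ^ 2 + \<beta> ^ 2) * (z ^ 2 + 1)) /
     (4 * (csqrt (z + of_real (\<alpha> ^ 2)) * csqrt (1 + of_real (\<alpha> ^ 2) * z) *
           csqrt (z + of_real (\<beta> ^ 2)) * csqrt (1 + of_real (\<beta> ^ 2) * z)))"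

definition c_fun :: "real \<Rightarrow> real \<Rightarrow> complex \<Rightarrow> complex" where
  "c_fun \<alpha> \<beta> z = 2 / (1 + 2 * g_fun \<alpha> \<beta> z)"

section \<open>Contours and the double contour integrals\<close>

definition branch_cuts :: "real \<Rightarrow> complex set" where
  "branch_cuts \<epsilon> = of_real ` ({.. - (1 / \<epsilon> ^ 2)} \<union> {- (\<epsilon> ^ 2)..0})"

definition positively_oriented_contour :: "(real \<Rightarrow> complex) \<Rightarrow> bool" where
  "positively_oriented_contour \<gamma> \<longleftrightarrow>
     valid_path \<gamma> \<and> simple_path \<gamma> \<and> pathfinish \<gamma> = pathstart \<gamma> \<and>
     (\<forall>z\<in>inside (path_image \<gamma>). winding_number \<gamma> z = 1)"

definition admissible_contours ::
  "real \<Rightarrow> real \<Rightarrow> (real \<Rightarrow> complex) \<Rightarrow> (real \<Rightarrow> complex) \<Rightarrow> bool" where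
  "admissible_contours \<alpha> \<beta> \<gamma>1 \<gamma>01 \<longleftrightarrow>
     positively_oriented_contour \<gamma>1 \<and> 1 \<in> inside (path_image \<gamma>1) \<and> 0 \<notin> inside (path_image \<gamma>1) \<and>
     path_image \<gamma>1 \<inter> (branch_cuts \<alpha> \<union> branch_cuts \<beta>) = {} \<and>
     positively_oriented_contour \<gamma>01 \<and> {0, 1} \<subseteq> inside (path_image \<gamma>01) \<and>
     path_image \<gamma>1 \<subseteq> inside (path_image \<gamma>01)"

definition mat_contour_integral ::
  "(real \<Rightarrow> complex) \<Rightarrow> (complex \<Rightarrow> complex mat) \<Rightarrow> complex mat" where
  "mat_contour_integral \<gamma> A = mat 2 2 (\<lambda>(i, j). contour_integral \<gamma> (\<lambda>z. A z $$ (i, j)))"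

definition single_integral ::
  "int \<Rightarrow> real \<Rightarrow> real \<Rightarrow> (real \<Rightarrow> complex) \<Rightarrow> int \<Rightarrow> int \<Rightarrow> int \<Rightarrow> int \<Rightarrow> complex mat" where
  "single_integral T \<alpha> \<beta> \<gamma>01 m' \<xi>' m \<xi> =
     (1 / (2 * of_real pi * \<i>)) \<cdot>\<^sub>m mat_contour_integral \<gamma>01
       (\<lambda>z. (1 / z * z powi (\<xi>' - \<xi>)) \<cdot>\<^sub>m transition T \<alpha> \<beta> m' m z)"

text \<open>
  The common shape of all double integrals; \<open>A\<close> is the part of the integrand that depends
  on the term and on the region of \<open>m'\<close>.
\<close>

definition double_integral ::
  "int \<Rightarrow> int \<Rightarrow> real \<Rightarrow> real \<Rightarrow> (real \<Rightarrow> complex) \<Rightarrow> (real \<Rightarrow> complex) \<Rightarrow>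
   int \<Rightarrow> int \<Rightarrow> int \<Rightarrow> (complex \<Rightarrow> complex mat) \<Rightarrow> complex mat" where
  "double_integral N T \<alpha> \<beta> \<gamma>1 \<gamma>01 \<xi>' m \<xi> A =
     (1 / (2 * of_real pi * \<i>) ^ 2) \<cdot>\<^sub>m
     mat_contour_integral \<gamma>1 (\<lambda>w. mat_contour_integral \<gamma>01 (\<lambda>z.
       (1 / (z * (z - w)) *
        ((w powi (\<xi>' + N) * (z - 1) powi N) / (z powi (\<xi> + N) * (w - 1) powi N))) \<cdot>\<^sub>m
       (A w * Phi \<beta> z ^\<^sub>m\<^sub>i (T - N div 2) * Phi \<alpha> z ^\<^sub>m\<^sub>i (- T) * transition T \<alpha> \<beta> 0 m z)))"

definition kernel_block ::
  "int \<Rightarrow> int \<Rightarrow> real \<Rightarrow> real \<Rightarrow> (real \<Rightarrow> complex) \<Rightarrow> (real \<Rightarrow> complex) \<Rightarrow>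
   int \<Rightarrow> int \<Rightarrow> int \<Rightarrow> int \<Rightarrow> complex mat" where
  "kernel_block N T \<alpha> \<beta> \<gamma>1 \<gamma>01 m' \<xi>' m \<xi> =
     (if m > m' then - single_integral T \<alpha> \<beta> \<gamma>01 m' \<xi>' m \<xi> else 0\<^sub>m 2 2)
     + (if m' \<le> T then
          double_integral N T \<alpha> \<beta> \<gamma>1 \<gamma>01 \<xi>' m \<xi>
            (\<lambda>w. eig_r1 \<alpha> w powi (T - m') \<cdot>\<^sub>m proj_F1 \<alpha> w * Phi \<beta> w ^\<^sub>m\<^sub>i (N div 2 - T))
          + double_integral N T \<alpha> \<beta> \<gamma>1 \<gamma>01 \<xi>' m \<xi>
            (\<lambda>w. (eig_r2 \<alpha> w powi (T - m') * c_fun \<alpha> \<beta> w) \<cdot>\<^sub>m (proj_F2 \<alpha> w * proj_F1 \<beta> w * proj_F1 \<alpha> w) *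
                 Phi \<beta> w ^\<^sub>m\<^sub>i (N div 2 - T))
        else
          double_integral N T \<alpha> \<beta> \<gamma>1 \<gamma>01 \<xi>' m \<xi>
            (\<lambda>w. eig_r1 \<beta> w powi (N div 2 - m') \<cdot>\<^sub>m proj_F1 \<beta> w)
          + double_integral N T \<alpha> \<beta> \<gamma>1 \<gamma>01 \<xi>' m \<xi>
            (\<lambda>w. (eig_r1 \<beta> w powi (2 * T - N div 2 - m') * c_fun \<alpha> \<beta> w) \<cdot>\<^sub>m
                 (proj_F1 \<beta> w * proj_F1 \<alpha> w * proj_F2 \<beta> w)))"

end

theory Submission
  imports Defs
begin

text \<open>
  Give the sign \<open>-1\<close> to the edges that lead from a black vertex to the white vertex on its upper left.
  With these signs every dimer covering contributes to the determinant of the weighted adjacency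
  matrix \<open>A\<close> with the sign \<open>+1\<close> (\<open>sign_mult_prod_edge_sign\<close>), so \<open>det A\<close> is the partition function.
  That the points of a set are occupied means that their columns of \<open>A\<close> are replaced by the halves
  that belong to the edges to the right. The quotient of the two determinants reduces to a
  determinant of the size of the set, whose entries are values at one point of the solution \<open>g\<close> of
  \<open>A g = s\<close>, where the source \<open>s\<close> is the right half of the column of another point. Hence
  \<open>K q p = g_q p\<close> is a correlation kernel. Since \<open>A\<close> is invertible, it remains to show that the
  contour integrals, as functions of the unprimed point, solve this linear system for the source at
  the primed point (\<open>correlation_kernel_from_solutions\<close>).

  In the generating variable \<open>z\<close> of the vertical coordinate, the equations at the white vertices of
  one column say that the values in the black column on its right are those in the column on its
  left times a matrix \<open>step \<epsilon> z\<close> (\<open>step_relations\<close>), and \<open>Phi \<epsilon> z\<close> is the product of the two half steps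
  with the parameters \<open>\<epsilon>\<close> and \<open>1\<close>. Integrals whose integrands depend on the column through a
  product of half steps therefore satisfy the equations at all inner vertices. The single
  integral is present only to the right of the primed point; this jump produces the source. At the
  top and bottom rows the equations lack two neighbours, so what remains is that the formula
  vanishes on one fictitious row above and one below the diamond.

  Above, it vanishes because \<open>(z - 1)^N\<close> times the product of half steps from the column \<open>N\<close>
  to any other column is a polynomial of degree at most \<open>N\<close> (\<open>poly_cleared_walk\<close>), and because the single
  integral has an integrand that decays quadratically. Below, Cauchy's formula evaluates the inner integral and
  leaves an integral around 1 of \<open>proj m w\<close> times half steps from the column of the primed point. To the
  left of that point, or after subtraction of the single integral on the right, the integrand is regular
  at 1 (\<open>regular_before\<close>, \<open>regular_after\<close>): an inverse half step or half step has a pole there, but \<open>proj m w\<close> projects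
  onto the directions in which the walk to the left is multiplied by the small eigenvalue, which has a double
  zero at 1, along the directions in which the walk to the right is. The rows that
  stay small to the left come from \<open>F\<^sub>\<alpha>\<^sub>,\<^sub>1\<close>, the rows that stay small to the right from
  \<open>F\<^sub>\<beta>\<^sub>,\<^sub>2\<close>. The two sets are complementary as long as the trace of
  \<open>F\<^sub>\<alpha>\<^sub>,\<^sub>1 F\<^sub>\<beta>\<^sub>,\<^sub>1\<close> does not vanish; this trace is \<open>1 / c\<close>, and
  \<open>c F\<^sub>\<beta>\<^sub>,\<^sub>1 F\<^sub>\<alpha>\<^sub>,\<^sub>1 F\<^sub>\<beta>\<^sub>,\<^sub>1 = F\<^sub>\<beta>\<^sub>,\<^sub>1\<close> (\<open>c_fun_compression\<close>).
\<close>

section \<open>Signs of permutations and a determinant identity\<close>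

definition index_pairs :: "nat \<Rightarrow> (nat \<times> nat) set" where
  "index_pairs n = {(i, j). i < j \<and> j < n}"

definition order_sign :: "nat \<Rightarrow> nat \<Rightarrow> int" where
  "order_sign a b = (if a < b then 1 else - 1)"

lemma finite_index_pairs [simp]: "finite (index_pairs n)"
  by (rule finite_subset[of _ "{0..<n} \<times> {0..<n}"]) (auto simp: index_pairs_def)

text \<open>
  The pairs inverted by the transposition of \<open>a\<close> and \<open>b\<close> are \<open>(a, b)\<close> and, for each \<open>c\<close> strictly between,
  \<open>(a, c)\<close> and \<open>(c, b)\<close>: an odd number.
\<close>

lemma prod_order_sign_transpose:
  assumes "a < b" "b < n"
  shows "(\<Prod>(i, j)\<in>index_pairs n.
    order_sign (Transposition.transpose a b i) (Transposition.transpose a b j)) = - 1"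
proof -
  let ?f = "\<lambda>(i, j). order_sign (Transposition.transpose a b i) (Transposition.transpose a b j)"
  define I where "I = insert (a, b) (Pair a ` {a<..<b} \<union> (\<lambda>c. (c, b)) ` {a<..<b})"
  have sub: "I \<subseteq> index_pairs n"
    using assms by (auto simp: I_def index_pairs_def)
  have "prod ?f (index_pairs n) = prod ?f I"
  proof (rule prod.mono_neutral_right)
    show "\<forall>x\<in>index_pairs n - I. ?f x = 1"
      using assms
      by (auto simp: I_def index_pairs_def order_sign_def Transposition.transpose_def image_iff
        split: if_splits)
  qed (use sub in auto)
  also have "\<dots> = (\<Prod>x\<in>I. - 1)"
    using assms
    by (intro prod.cong) (auto simp: I_def order_sign_def Transposition.transpose_def)
  also have "\<dots> = (- 1) ^ card I"
    by simp
  also have "card I = Suc (card {a<..<b} + card {a<..<b})"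
  proof -
    have "card (Pair a ` {a<..<b} \<union> (\<lambda>c. (c, b)) ` {a<..<b}) = card {a<..<b} + card {a<..<b}"
      by (subst card_Un_disjoint) (auto simp: card_image inj_on_def)
    then show ?thesis
      unfolding I_def by (subst card_insert_disjoint) auto
  qed
  finally show ?thesis
    by simp
qed

text \<open>
  A permutation acts on unordered pairs, and a symmetric \<open>t\<close> is a function of unordered pairs.
\<close>

lemma prod_index_pairs_permute:
  fixes t :: "nat \<Rightarrow> nat \<Rightarrow> int"
  assumes p: "p permutes {0..<n}" and sym: "\<And>a b. a \<noteq> b \<Longrightarrow> t a b = t b a"
  shows "(\<Prod>(i, j)\<in>index_pairs n. t (p i) (p j)) = (\<Prod>(i, j)\<in>index_pairs n. t i j)"
proof -
  let ?q = "Hilbert_Choice.inv p"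
  have ran: "p i < n" "?q i < n" if "i < n" for i
    using permutes_in_image[OF p] permutes_in_image[OF permutes_inv[OF p]] that by auto
  have inj: "p i = p j \<longleftrightarrow> i = j" "?q i = ?q j \<longleftrightarrow> i = j" for i j
    using permutes_inj[OF p] permutes_inj[OF permutes_inv[OF p]] by (auto dest: injD)
  have cancel: "p (?q i) = i" "?q (p i) = i" for i
    using permutes_inverses[OF p] by auto
  have sort_map: "min (f (min a b)) (f (max a b)) = min (f a) (f b)"
    "max (f (min a b)) (f (max a b)) = max (f a) (f b)" for f :: "nat \<Rightarrow> nat" and a b
    by (auto simp: min_def max_def)
  let ?g = "\<lambda>(i, j). (min (p i) (p j), max (p i) (p j))"
  let ?h = "\<lambda>(i, j). (min (?q i) (?q j), max (?q i) (?q j))"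
  have mem: "(min (f i) (f j), max (f i) (f j)) \<in> index_pairs n"
    if "(i, j) \<in> index_pairs n" "f i \<noteq> f j" "f i < n" "f j < n" for f i j
    using that by (auto simp: index_pairs_def min_def max_def)
  have id: "(min i j, max i j) = (i, j)" if "(i, j) \<in> index_pairs n" for i j
    using that by (auto simp: index_pairs_def)
  have gh: "?h (?g x) = x" if "x \<in> index_pairs n" for x
    using that id by (cases x) (simp add: sort_map[of ?q] cancel)
  have hg: "?g (?h x) = x" if "x \<in> index_pairs n" for x
    using that id by (cases x) (simp add: sort_map[of p] cancel)
  have g: "?g x \<in> index_pairs n" if "x \<in> index_pairs n" for x
  proof -
    obtain i j where "x = (i, j)" by (cases x)
    moreover have "i \<noteq> j" "i < n" "j < n" using that calculation by (auto simp: index_pairs_def)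
    ultimately show ?thesis using mem[of i j p] inj(1)[of i j] ran that by simp
  qed
  have h: "?h x \<in> index_pairs n" if "x \<in> index_pairs n" for x
  proof -
    obtain i j where "x = (i, j)" by (cases x)
    moreover have "i \<noteq> j" "i < n" "j < n" using that calculation by (auto simp: index_pairs_def)
    ultimately show ?thesis using mem[of i j ?q] inj(2)[of i j] ran that by simp
  qed
  have eq: "(case ?g x of (i, j) \<Rightarrow> t i j) = (case x of (i, j) \<Rightarrow> t (p i) (p j))"
    if "x \<in> index_pairs n" for x
  proof -
    obtain i j where ij: "x = (i, j)" by (cases x)
    then have "p i \<noteq> p j" using that inj(1)[of i j] by (auto simp: index_pairs_def)
    then show ?thesis using sym[of "p i" "p j"] ij by (cases "p i < p j") (auto simp: min_def max_def)
  qed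
  show ?thesis
    by (rule prod.reindex_bij_witness[of _ ?h ?g]) (fact gh g hg h eq)+
qed

text \<open>
  Composition with a transposition changes the product by the product of a symmetric function over all
  pairs, which the permutation does not affect; so the claim reduces to a single transposition.
\<close>

lemma sign_eq_prod_order_sign:
  assumes "p permutes {0..<n}"
  shows "sign p = (\<Prod>(i, j)\<in>index_pairs n. order_sign (p i) (p j))"
  using assms finite_atLeastLessThan
proof (induction rule: permutes_induct)
  case id
  show ?case
    by (simp add: order_sign_def index_pairs_def prod.neutral)
next
  case (swap a b p)
  let ?\<tau> = "Transposition.transpose a b"
  let ?t = "\<lambda>x y. order_sign x y * order_sign (?\<tau> x) (?\<tau> y)"
  have sq: "order_sign x y * order_sign x y = 1" for x y
    by (simp add: order_sign_def)
  have flip: "order_sign y x = - order_sign x y" if "x \<noteq> y" for x y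
    using that by (auto simp: order_sign_def)
  have inj\<tau>: "?\<tau> x \<noteq> ?\<tau> y" if "x \<noteq> y" for x y
    using that by (metis transpose_involutory)
  have "(\<Prod>(i, j)\<in>index_pairs n. order_sign ((?\<tau> \<circ> p) i) ((?\<tau> \<circ> p) j))
    = (\<Prod>(i, j)\<in>index_pairs n. ?t (p i) (p j) * order_sign (p i) (p j))"
    using sq by (intro prod.cong) (auto simp: algebra_simps)
  also have "\<dots> = (\<Prod>(i, j)\<in>index_pairs n. ?t (p i) (p j))
      * (\<Prod>(i, j)\<in>index_pairs n. order_sign (p i) (p j))"
    by (simp add: prod.distrib case_prod_unfold)
  also have "(\<Prod>(i, j)\<in>index_pairs n. ?t (p i) (p j)) = (\<Prod>(i, j)\<in>index_pairs n. ?t i j)"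
  proof (rule prod_index_pairs_permute)
    show "p permutes {0..<n}" by (rule swap)
    show "?t x y = ?t y x" if "x \<noteq> y" for x y
      using flip[OF that] flip[OF inj\<tau>[OF that]] by simp
  qed
  also have "\<dots> = (\<Prod>(i, j)\<in>index_pairs n. order_sign (?\<tau> i) (?\<tau> j))"
    by (intro prod.cong) (auto simp: index_pairs_def order_sign_def)
  also have "\<dots> = - 1"
  proof (cases "a < b")
    case True
    then show ?thesis
      using prod_order_sign_transpose[of a b n] swap by auto
  next
    case False
    then have "b < a" using swap by auto
    then show ?thesis
      using prod_order_sign_transpose[of b a n] swap by (auto simp: transpose_commute)
  qed
  finally have *: "(\<Prod>(i, j)\<in>index_pairs n. order_sign ((?\<tau> \<circ> p) i) ((?\<tau> \<circ> p) j))
    = - (\<Prod>(i, j)\<in>index_pairs n. order_sign (p i) (p j))" by simp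
  have "permutation p" and "permutation ?\<tau>"
    using swap permutation_swap_id by (auto simp only: permutation_permutes)
  then have "sign (?\<tau> \<circ> p) = - sign p"
    using swap by (simp add: sign_compose sign_swap_id)
  then show ?case
    by (simp only: * swap.IH)
qed

text \<open>
  All inversions have their left index outside \<open>L\<close> and their right index in \<open>L\<close>. For \<open>i\<close> outside \<open>L\<close>, the
  values below \<open>p i\<close> are taken at the indices before \<open>i\<close> and at the later indices inverted with \<open>i\<close>, so
  there are \<open>p i - i\<close> inversions with left index \<open>i\<close>.
\<close>

lemma sign_eq_prod_of_split:
  assumes p: "p permutes {0..<n}"
    and inv: "\<And>i i'. i < i' \<Longrightarrow> i' < n \<Longrightarrow> p i' < p i \<Longrightarrow> i \<notin> L \<and> i' \<in> L"
  shows "sign p = (\<Prod>i\<in>{0..<n} - L. (- 1) ^ (p i + i))"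
proof -
  have ran: "p i < n" if "i < n" for i
    using permutes_in_image[OF p] that by auto
  have inj: "p i = p j \<longleftrightarrow> i = j" for i j
    using permutes_inj[OF p] by (auto dest: injD)
  \<comment> \<open>The right indices of the inversions with left index \<open>i\<close>.\<close>
  define later where "later = (\<lambda>i. {i'. i < i' \<and> i' < n \<and> p i' < p i})"
  have fin: "finite (later i)" for i
    by (rule finite_subset[of _ "{0..<n}"]) (auto simp: later_def)
  have "sign p = (\<Prod>(i, j)\<in>Sigma {0..<n} (\<lambda>i. {i<..<n}). order_sign (p i) (p j))"
    unfolding sign_eq_prod_order_sign[OF p]
    by (rule prod.cong) (auto simp: index_pairs_def)
  also have "\<dots> = (\<Prod>i=0..<n. \<Prod>j\<in>{i<..<n}. order_sign (p i) (p j))"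
    by (subst prod.Sigma) auto
  also have "\<dots> = (\<Prod>i=0..<n. (- 1) ^ card (later i))"
  proof (rule prod.cong)
    fix i
    have "(\<Prod>j\<in>{i<..<n}. order_sign (p i) (p j)) = (\<Prod>j\<in>later i. order_sign (p i) (p j))"
      by (rule prod.mono_neutral_right)
        (use inj in \<open>auto simp: later_def order_sign_def not_less le_less\<close>)
    also have "\<dots> = (\<Prod>j\<in>later i. - 1)"
      by (rule prod.cong) (auto simp: later_def order_sign_def)
    finally show "(\<Prod>j\<in>{i<..<n}. order_sign (p i) (p j)) = (- 1) ^ card (later i)"
      by simp
  qed simp
  also have "\<dots> = (\<Prod>i\<in>{0..<n} - L. (- 1) ^ card (later i))"
  proof (rule prod.mono_neutral_right)
    have "later i = {}" if "i \<in> L" for i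
      using inv that by (auto simp: later_def)
    then show "\<forall>i\<in>{0..<n} - ({0..<n} - L). (- 1 :: int) ^ card (later i) = 1" by auto
  qed auto
  also have "\<dots> = (\<Prod>i\<in>{0..<n} - L. (- 1) ^ (p i + i))"
  proof (rule prod.cong)
    fix i assume i: "i \<in> {0..<n} - L"
    have "p ` (later i \<union> {0..<i}) = {0..<p i}"
    proof (rule equalityI; rule subsetI)
      fix x assume "x \<in> p ` (later i \<union> {0..<i})"
      then obtain k where k: "x = p k" "k \<in> later i \<or> k < i" by auto
      have "p k < p i"
      proof (rule ccontr)
        assume "\<not> p k < p i"
        then have "k < i" "p i < p k"
          using k inj[of i k] by (auto simp: later_def)
        then show False
          using inv[of k i] i by auto
      qed
      then show "x \<in> {0..<p i}" using k by auto
    next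
      fix x assume "x \<in> {0..<p i}"
      then have x: "x < p i" "x < n" using ran[of i] i by auto
      obtain y where y: "x = p y" "y < n"
        using permutes_inverses(1)[OF p, of x] permutes_in_image[OF permutes_inv[OF p], of x] x
        by (metis atLeastLessThan_iff zero_le)
      have "y \<in> later i \<union> {0..<i}"
        using y x(1) by (cases "y < i") (auto simp: later_def not_less le_less)
      then show "x \<in> p ` (later i \<union> {0..<i})" using y by blast
    qed
    then have "card (p ` (later i \<union> {0..<i})) = p i" by simp
    moreover have "card (p ` (later i \<union> {0..<i})) = card (later i \<union> {0..<i})"
      by (rule card_image) (use inj in \<open>auto simp: inj_on_def\<close>)
    moreover have "card (later i \<union> {0..<i}) = card (later i) + i"
      by (subst card_Un_disjoint) (use fin in \<open>auto simp: later_def\<close>)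
    ultimately have "p i + i = card (later i) + 2 * i" by simp
    then show "(- 1 :: int) ^ card (later i) = (- 1) ^ (p i + i)"
      by (simp add: power_add power_mult)
  qed simp
  finally show ?thesis .
qed

text \<open>
  The Weinstein-Aronszajn identity: both sides are the determinant of the product, in either order, of the
  two block matrices below, one of which has determinant 1.
\<close>

lemma det_one_add_mult_commute:
  fixes U V :: "'a :: idom mat"
  assumes U: "U \<in> carrier_mat n k" and V: "V \<in> carrier_mat k n"
  shows "det (1\<^sub>m n + U * V) = det (1\<^sub>m k + V * U)"
proof -
  let ?M = "four_block_mat (1\<^sub>m n) (- U) V (1\<^sub>m k)"
  let ?L = "four_block_mat (1\<^sub>m n) U (0\<^sub>m k n) (1\<^sub>m k)"
  have M: "?M \<in> carrier_mat (n + k) (n + k)" and L: "?L \<in> carrier_mat (n + k) (n + k)"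
    using U V by auto
  have nU: "- U \<in> carrier_mat n k" using U by auto
  have UV: "U * V \<in> carrier_mat n n" and VU: "V * U \<in> carrier_mat k k" using U V by auto
  have "?L * ?M = four_block_mat (1\<^sub>m n + U * V) (- U + U) (V) (1\<^sub>m k)"
    by (subst mult_four_block_mat[OF _ U _ _ _ nU V]) (use U V in auto)
  also have "- U + U = 0\<^sub>m n k" using U by auto
  finally have a: "det (?L * ?M) = det (1\<^sub>m n + U * V) * det (1\<^sub>m k :: 'a mat)"
    using det_four_block_mat_upper_right_zero[of "1\<^sub>m n + U * V" n "0\<^sub>m n k" k V "1\<^sub>m k"] UV V by auto
  have "?M * ?L = four_block_mat (1\<^sub>m n) (U + - U) V (V * U + 1\<^sub>m k)"
    by (subst mult_four_block_mat[OF _ nU V _ _ U]) (use U V in auto)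
  also have "U + - U = 0\<^sub>m n k" using U by auto
  finally have b: "det (?M * ?L) = det (1\<^sub>m n :: 'a mat) * det (V * U + 1\<^sub>m k)"
    using det_four_block_mat_upper_right_zero[of "1\<^sub>m n" n "0\<^sub>m n k" k V "V * U + 1\<^sub>m k"] VU V by auto
  have "det (?L * ?M) = det (?M * ?L)"
    by (simp add: det_mult[OF L M] det_mult[OF M L])
  then show ?thesis
    using a b comm_add_mat[OF VU one_carrier_mat] by auto
qed

section \<open>Dimer coverings as permutations\<close>

text \<open>
  White and black vertices are numbered column by column, from left to right and from bottom to top; \<open>l\<close> is the number of
  white columns.
\<close>

definition white_at :: "nat \<Rightarrow> nat \<Rightarrow> vertex" where
  "white_at l i = (2 * int (i div (l + 1)) + 1, 2 * int (i mod (l + 1)))"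

definition black_at :: "nat \<Rightarrow> nat \<Rightarrow> vertex" where
  "black_at l i = (2 * int (i div l), 2 * int (i mod l) + 1)"

lemma bij_betw_div_mod:
  assumes "0 < b"
  shows "bij_betw (\<lambda>i. (i div b, i mod b)) {0..<a * b} ({0..<a} \<times> {0..<b::nat})"
proof (rule bij_betw_byWitness[where f' = "\<lambda>(c, h). c * b + h"])
  have "c * b + h < a * b" if "c < a" "h < b" for c h
  proof -
    have "(c + 1) * b \<le> a * b" using that by (intro mult_le_mono1) auto
    then show ?thesis using that by simp
  qed
  then show "(\<lambda>(c, h). c * b + h) ` ({0..<a} \<times> {0..<b}) \<subseteq> {0..<a * b}"
    by auto
qed (use assms in \<open>auto simp: less_mult_imp_div_less\<close>)

lemma div_eq_iff_interval:
  fixes b :: nat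
  assumes "0 < b"
  shows "i div b = k \<longleftrightarrow> k * b \<le> i \<and> i < (k + 1) * b"
  using assms div_nat_eqI[of b k i] div_times_less_eq_dividend[of i b] dividend_less_div_times[of b i]
  by (auto simp: mult.commute)

lemma bij_betw_white_at:
  assumes "int l = 2 * N"
  shows "bij_betw (white_at l) {0..<l * (l + 1)} (white_vertices N)"
proof -
  let ?f = "\<lambda>(c, h). (2 * int c + 1, 2 * int h)"
  have "bij_betw ?f ({0..<l} \<times> {0..<l + 1}) (white_vertices N)"
  proof (rule bij_betw_imageI)
    have "?f ` ({0..<l} \<times> {0..<l + 1}) = (\<lambda>(j, k). (2 * j + 1, 2 * k)) ` (int ` {0..<l} \<times> int ` {0..<l + 1})"
      by force
    also have "int ` {0..<l} = {0..2 * N - 1}"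
      unfolding image_int_atLeastLessThan using assms by auto
    also have "int ` {0..<l + 1} = {0..2 * N}"
      unfolding image_int_atLeastLessThan using assms by auto
    finally show "?f ` ({0..<l} \<times> {0..<l + 1}) = white_vertices N"
      unfolding white_vertices_def .
  qed (auto simp: inj_on_def)
  from bij_betw_trans[OF bij_betw_div_mod[of "l + 1" l] this] show ?thesis
    by (rule bij_betw_cong[THEN iffD1, rotated]) (auto simp: white_at_def)
qed

lemma bij_betw_black_at:
  assumes "int l = 2 * N" "0 < l"
  shows "bij_betw (black_at l) {0..<l * (l + 1)} (black_vertices N)"
proof -
  let ?f = "\<lambda>(c, h). (2 * int c, 2 * int h + 1)"
  have "bij_betw ?f ({0..<l + 1} \<times> {0..<l}) (black_vertices N)"
  proof (rule bij_betw_imageI)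
    have "?f ` ({0..<l + 1} \<times> {0..<l}) = (\<lambda>(j, k). (2 * j, 2 * k + 1)) ` (int ` {0..<l + 1} \<times> int ` {0..<l})"
      by force
    also have "int ` {0..<l} = {0..2 * N - 1}"
      unfolding image_int_atLeastLessThan using assms by auto
    also have "int ` {0..<l + 1} = {0..2 * N}"
      unfolding image_int_atLeastLessThan using assms by auto
    finally show "?f ` ({0..<l + 1} \<times> {0..<l}) = black_vertices N"
      unfolding black_vertices_def .
  qed (auto simp: inj_on_def)
  from bij_betw_trans[OF bij_betw_div_mod[of l "l + 1"] this] show ?thesis
    using assms(2) by (subst (asm) bij_betw_cong[of _ _ "black_at l"]) (auto simp: black_at_def mult.commute)
qed

lemma edge_white_at_black_at:
  assumes l: "int l = 2 * N" "0 < l" and ij: "i < l * (l + 1)" "j < l * (l + 1)"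
  shows "(white_at l i, black_at l j) \<in> edges N \<longleftrightarrow>
    (j div l = i div (l + 1) \<or> j div l = i div (l + 1) + 1) \<and>
    (j mod l = i mod (l + 1) \<or> j mod l + 1 = i mod (l + 1))"
proof -
  have "white_at l i \<in> white_vertices N" "black_at l j \<in> black_vertices N"
    using bij_betw_white_at[OF l(1)] bij_betw_black_at[OF l] ij by (auto simp: bij_betw_def)
  then have "(white_at l i, black_at l j) \<in> edges N \<longleftrightarrow>
     white_at l i - black_at l j \<in> {(1, 1), (1, -1), (-1, 1), (-1, -1)}"
    by (auto simp: edges_def)
  also have "\<dots> \<longleftrightarrow>
    (j div l = i div (l + 1) \<or> j div l = i div (l + 1) + 1) \<and>
    (j mod l = i mod (l + 1) \<or> j mod l + 1 = i mod (l + 1))"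
    unfolding white_at_def black_at_def minus_prod_def by (simp only: fst_conv snd_conv) auto
  finally show ?thesis .
qed

text \<open>
  Only the edge from a black vertex to the white vertex on its upper left is negative, so each inner face has an
  odd number of negative edges, as Kasteleyn's condition requires for faces with four sides.
\<close>

definition edge_sign :: "edge \<Rightarrow> int" where
  "edge_sign = (\<lambda>(w, b). if fst w = fst b + 1 \<or> snd b = snd w + 1 then 1 else - 1)"

text \<open>
  Along the numbering by columns, two edges are inverted only if the earlier white vertex is matched
  to the black column on its right and the later one to the column on its left, so the sign is a product over the
  white vertices matched to the right. Modulo 2, the exponent of such a vertex is its column plus the
  vertical offset of its edge. The offsets are the edge signs; the columns cancel because the column \<open>k\<close> contains
  exactly \<open>k + 1\<close> white vertices matched to the right, whatever the covering.
\<close>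

lemma sign_mult_prod_edge_sign:
  assumes l: "int l = 2 * N" "0 < l" and p: "p permutes {0..<l * (l + 1)}"
    and edges: "\<And>i. i < l * (l + 1) \<Longrightarrow> (white_at l i, black_at l (p i)) \<in> edges N"
  shows "sign p * (\<Prod>i=0..<l * (l + 1). edge_sign (white_at l i, black_at l (p i))) = 1"
proof -
  let ?n = "l * (l + 1)"
  define c h d g where "c = (\<lambda>i. i div (l + 1))" and "h = (\<lambda>i. i mod (l + 1))"
    and "d = (\<lambda>i. p i div l)" and "g = (\<lambda>i. p i mod l)"
  note chdg = c_def h_def d_def g_def
  define matched_left where "matched_left = {i. d i = c i}"
  have ran: "p i < ?n" if "i < ?n" for i
    using permutes_in_image[OF p, of i] that by auto
  have dc: "d i = c i \<or> d i = c i + 1" and gh: "g i = h i \<or> g i + 1 = h i" if "i < ?n" for i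
    using edge_white_at_black_at[OF l that ran[OF that]] edges[OF that] unfolding chdg by auto
  have idx: "i = c i * (l + 1) + h i" "p i = d i * l + g i" for i
    by (simp_all only: chdg div_mult_mod_eq)
  have inversion: "i \<notin> matched_left \<and> i' \<in> matched_left" if ii: "i < i'" "i' < ?n" "p i' < p i" for i i'
  proof -
    have c: "c i \<le> c i'" and d: "d i' \<le> d i"
      using ii unfolding chdg by (auto intro!: div_le_mono)
    have hh: "h i < h i'" if "c i = c i'"
      using idx(1)[of i] idx(1)[of i'] ii that by simp
    have gg: "g i' < g i" if "d i = d i'"
      using idx(2)[of i] idx(2)[of i'] ii that by simp
    show ?thesis
      using c d hh gg dc[of i] dc[of i'] gh[of i] gh[of i'] ii unfolding matched_left_def by auto
  qed
  have cl: "c i < l" if "i < ?n" for i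
    using that unfolding c_def by (simp add: less_mult_imp_div_less)
  have edge_sign_eq: "edge_sign (white_at l i, black_at l (p i))
      = (if i \<in> matched_left then 1 else (- 1) ^ (g i + h i))" if "i < ?n" for i
  proof -
    have "edge_sign (white_at l i, black_at l (p i)) = (if d i = c i \<or> g i = h i then 1 else - 1)"
      by (auto simp: edge_sign_def white_at_def black_at_def chdg)
    moreover have "(- 1 :: int) ^ (g i + h i) = (if g i = h i then 1 else - 1)"
    proof (cases "g i = h i")
      case False
      then have "g i + h i = 2 * g i + 1" using gh[OF that] by auto
      then show ?thesis using False by simp
    qed simp
    ultimately show ?thesis by (auto simp: matched_left_def)
  qed
  have parity: "(- 1 :: int) ^ (p i + i) = (- 1) ^ c i * (- 1) ^ (g i + h i)"
    if "i \<in> {0..<?n} - matched_left" for i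
  proof -
    have "d i = c i + 1" using dc[of i] that by (auto simp: matched_left_def)
    then have "p i + i = 2 * (c i * l) + l + c i + (g i + h i)"
      using idx[of i] by (simp add: algebra_simps)
    moreover have "even l" using l(1) by presburger
    ultimately show ?thesis by (simp add: power_add power_mult)
  qed
  \<comment> \<open>White vertices of the column \<open>k\<close> matched to the right and to the left. A white column has \<open>l + 1\<close> vertices and a black one \<open>l\<close>, which determines all \<open>a k\<close> from left to right.\<close>
  define a where "a = (\<lambda>k. card {i. i < ?n \<and> i \<notin> matched_left \<and> c i = k})"
  define b where "b = (\<lambda>k. card {i. i < ?n \<and> i \<in> matched_left \<and> c i = k})"
  have column_white: "a k + b k = l + 1" if "k < l" for k
  proof -
    have "a k + b k = card ({i. i < ?n \<and> i \<notin> matched_left \<and> c i = k} \<union> {i. i < ?n \<and> i \<in> matched_left \<and> c i = k})"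
      unfolding a_def b_def by (rule card_Un_disjoint[symmetric]) auto
    also have "{i. i < ?n \<and> i \<notin> matched_left \<and> c i = k} \<union> {i. i < ?n \<and> i \<in> matched_left \<and> c i = k}
      = {k * (l + 1)..<(k + 1) * (l + 1)}"
    proof (rule Set.set_eqI)
      fix i
      have "(k + 1) * (l + 1) \<le> ?n" using that by (intro mult_le_mono1) simp
      then have "i < ?n" if "i < (k + 1) * (l + 1)" using that by (rule less_le_trans[rotated])
      moreover have "c i = k \<longleftrightarrow> k * (l + 1) \<le> i \<and> i < (k + 1) * (l + 1)"
        unfolding c_def by (rule div_eq_iff_interval) simp
      ultimately show "i \<in> {i. i < ?n \<and> i \<notin> matched_left \<and> c i = k} \<union> {i. i < ?n \<and> i \<in> matched_left \<and> c i = k}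
        \<longleftrightarrow> i \<in> {k * (l + 1)..<(k + 1) * (l + 1)}"
        unfolding Un_iff mem_Collect_eq atLeastLessThan_iff by blast
    qed
    finally show ?thesis by simp
  qed
  have column_black: "(if k = 0 then 0 else a (k - 1)) + b k = l" if "k < l" for k
  proof -
    let ?A = "{i. i < ?n \<and> i \<notin> matched_left \<and> c i + 1 = k}" and ?B = "{i. i < ?n \<and> i \<in> matched_left \<and> c i = k}"
    have "l = card {k * l..<(k + 1) * l}" by simp
    also have "{k * l..<(k + 1) * l} = p ` (?A \<union> ?B)"
    proof (rule equalityI; rule subsetI)
      fix x assume x: "x \<in> {k * l..<(k + 1) * l}"
      have "(k + 1) * l \<le> l * (l + 1)"
        using that by (subst mult.commute, intro mult_le_mono) auto
      moreover have "x < (k + 1) * l" using x by simp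
      ultimately have "x < ?n" by (rule less_le_trans[rotated])
      then have "x \<in> p ` {0..<?n}" unfolding permutes_image[OF p] by simp
      then obtain i where i: "i < ?n" "x = p i" by auto
      have "d i = k"
        using x i div_eq_iff_interval[OF l(2), of x k] by (simp add: d_def)
      then show "x \<in> p ` (?A \<union> ?B)" using i dc[of i] by (auto simp: matched_left_def)
    next
      fix x assume "x \<in> p ` (?A \<union> ?B)"
      then obtain i where i: "i \<in> ?A \<union> ?B" "x = p i" by auto
      then have "d i = k" using dc[of i] by (auto simp: matched_left_def)
      then show "x \<in> {k * l..<(k + 1) * l}"
        using div_eq_iff_interval[OF l(2), of x k] i by (simp add: d_def)
    qed
    also have "card (p ` (?A \<union> ?B)) = card (?A \<union> ?B)"
      by (rule card_image) (use permutes_inj[OF p] in \<open>auto intro: inj_on_subset\<close>)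
    also have "\<dots> = card ?A + card ?B"
      by (rule card_Un_disjoint) auto
    also have "card ?A = (if k = 0 then 0 else a (k - 1))"
      by (cases k) (auto simp: a_def)
    finally show ?thesis by (simp add: b_def)
  qed
  have a_eq: "a k = k + 1" if "k < l" for k
    using that
  proof (induction k)
    case 0
    then show ?case using column_white[of 0] column_black[of 0] by simp
  next
    case (Suc k)
    then show ?case using column_white[of "Suc k"] column_black[of "Suc k"] by simp
  qed
  have "(\<Prod>i\<in>{0..<?n} - matched_left. (- 1 :: int) ^ c i)
    = (\<Prod>k=0..<l. \<Prod>i\<in>{i \<in> {0..<?n} - matched_left. c i = k}. (- 1) ^ c i)"
    by (rule prod.group[symmetric]) (use cl in auto)
  also have "\<dots> = (\<Prod>k=0..<l. 1)"
  proof (rule prod.cong)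
    fix k assume k: "k \<in> {0..<l}"
    have "(\<Prod>i\<in>{i \<in> {0..<?n} - matched_left. c i = k}. (- 1 :: int) ^ c i)
      = (\<Prod>i\<in>{i. i < ?n \<and> i \<notin> matched_left \<and> c i = k}. (- 1) ^ k)"
      by (rule prod.cong) auto
    also have "\<dots> = (- 1) ^ (k * a k)"
      by (simp add: a_def power_mult)
    also have "\<dots> = 1" using a_eq[of k] k by simp
    finally show "(\<Prod>i\<in>{i \<in> {0..<?n} - matched_left. c i = k}. (- 1 :: int) ^ c i) = 1" .
  qed simp
  finally have columns: "(\<Prod>i\<in>{0..<?n} - matched_left. (- 1 :: int) ^ c i) = 1" by simp
  have "sign p = (\<Prod>i\<in>{0..<?n} - matched_left. (- 1) ^ (p i + i))"
    using sign_eq_prod_of_split[OF p inversion] .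
  also have "\<dots> = (\<Prod>i\<in>{0..<?n} - matched_left. (- 1) ^ c i * (- 1) ^ (g i + h i))"
    by (rule prod.cong) (auto simp: parity)
  also have "\<dots> = (\<Prod>i\<in>{0..<?n} - matched_left. (- 1) ^ (g i + h i))"
    unfolding prod.distrib columns by simp
  also have "\<dots> = (\<Prod>i\<in>{0..<?n} - matched_left. edge_sign (white_at l i, black_at l (p i)))"
    by (rule prod.cong) (auto simp: edge_sign_eq)
  also have "\<dots> = (\<Prod>i=0..<?n. edge_sign (white_at l i, black_at l (p i)))"
    by (rule prod.mono_neutral_left) (auto simp: edge_sign_eq)
  finally show ?thesis by (metis sign_idempotent)
qed

lemma edges_vertices:
  assumes "(w, b) \<in> edges N"
  shows "w \<in> white_vertices N" and "b \<in> black_vertices N"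
  using assms by (simp_all add: edges_def)

lemma dimer_coverings_subset_edges:
  assumes "M \<in> dimer_coverings N"
  shows "M \<subseteq> edges N"
  using assms by (simp add: dimer_coverings_def)

lemma white_vertex_matched:
  assumes "M \<in> dimer_coverings N" "w \<in> white_vertices N"
  shows "\<exists>!b. (w, b) \<in> M"
  using assms by (simp add: dimer_coverings_def)

lemma black_vertex_matched:
  assumes "M \<in> dimer_coverings N" "b \<in> black_vertices N"
  shows "\<exists>!w. (w, b) \<in> M"
  using assms by (simp add: dimer_coverings_def)

lemma black_vertices_matched_once:
  assumes "M \<in> dimer_coverings N" "(w, b) \<in> M" "(w', b) \<in> M"
  shows "w = w'"
proof -
  have "b \<in> black_vertices N"
    using dimer_coverings_subset_edges[OF assms(1)] assms(2) edges_vertices(2) by blast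
  from black_vertex_matched[OF assms(1) this] show ?thesis
    using assms(2,3) by blast
qed

lemma white_vertices_matched_once:
  assumes "M \<in> dimer_coverings N" "(w, b) \<in> M" "(w, b') \<in> M"
  shows "b = b'"
proof -
  have "w \<in> white_vertices N"
    using dimer_coverings_subset_edges[OF assms(1)] assms(2) edges_vertices(1) by blast
  from white_vertex_matched[OF assms(1) this] show ?thesis
    using assms(2,3) by blast
qed

text \<open>
  Once both colour classes are numbered, a covering is a permutation that uses only edges.
\<close>

lemma bij_betw_permutations_dimer_coverings:
  fixes n :: nat and w b :: "nat \<Rightarrow> vertex"
  assumes w: "bij_betw w {0..<n} (white_vertices N)" and b: "bij_betw b {0..<n} (black_vertices N)"
  shows "bij_betw (\<lambda>p. (\<lambda>i. (w i, b (p i))) ` {0..<n})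
    {p. p permutes {0..<n} \<and> (\<forall>i<n. (w i, b (p i)) \<in> edges N)} (dimer_coverings N)"
    (is "bij_betw ?F ?P _")
proof (rule bij_betw_imageI)
  have winj: "w i = w j \<longleftrightarrow> i = j" and binj: "b i = b j \<longleftrightarrow> i = j" if "i < n" "j < n" for i j
    using inj_on_eq_iff[OF bij_betw_imp_inj_on[OF w]] inj_on_eq_iff[OF bij_betw_imp_inj_on[OF b]] that
    by simp_all
  have wex: "\<exists>i<n. x = w i" if "x \<in> white_vertices N" for x
    using that unfolding bij_betw_imp_surj_on[OF w, symmetric] by auto
  have bex: "\<exists>i<n. x = b i" if "x \<in> black_vertices N" for x
    using that unfolding bij_betw_imp_surj_on[OF b, symmetric] by auto
  show "inj_on ?F ?P"
  proof (rule inj_onI, rule ext)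
    fix p q i assume p: "p \<in> ?P" and q: "q \<in> ?P" and eq: "?F p = ?F q"
    show "p i = q i"
    proof (cases "i < n")
      case True
      then have "(w i, b (p i)) \<in> ?F p" by simp
      then have "(w i, b (p i)) \<in> ?F q" by (simp only: eq)
      then obtain j where j: "j < n" "w i = w j" "b (p i) = b (q j)" by auto
      then have "j = i" using winj[of i j] True by simp
      moreover have "p i < n" "q i < n"
        using p q True permutes_in_image[of p "{0..<n}" i] permutes_in_image[of q "{0..<n}" i] by simp_all
      ultimately show ?thesis using j binj[of "p i" "q i"] by simp
    next
      case False
      then show ?thesis using p q permutes_not_in[of p "{0..<n}" i] permutes_not_in[of q "{0..<n}" i] by simp
    qed
  qed
  show "?F ` ?P = dimer_coverings N"
  proof (rule equalityI; rule subsetI)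
    fix M assume "M \<in> ?F ` ?P"
    then obtain p where p: "p permutes {0..<n}" "\<forall>i<n. (w i, b (p i)) \<in> edges N" and M: "M = ?F p"
      by auto
    have "\<exists>!y. (x, y) \<in> M" if x: "x \<in> white_vertices N" for x
    proof -
      obtain i where i: "i < n" "x = w i" using wex[OF x] by blast
      show ?thesis
        by (rule ex1I[of _ "b (p i)"]) (use i winj in \<open>auto simp: M\<close>)
    qed
    moreover have "\<exists>!x. (x, y) \<in> M" if y: "y \<in> black_vertices N" for y
    proof -
      obtain k where k: "k < n" "y = b k" using bex[OF y] by blast
      have "k \<in> p ` {0..<n}" unfolding permutes_image[OF p(1)] using k by simp
      then obtain i where i: "i < n" "k = p i" by auto
      have pn: "p j < n" if "j < n" for j
        using permutes_in_image[OF p(1), of j] that by auto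
      have ji: "j = i" if "j < n" "b (p j) = b (p i)" for j
      proof -
        have "p j = p i" using binj[OF pn[OF that(1)] pn[OF i(1)]] that(2) by blast
        then show ?thesis using permutes_inj[OF p(1)] by (simp add: inj_eq)
      qed
      show ?thesis
      proof (rule ex1I)
        show "(w i, y) \<in> M" using i k by (auto simp: M)
        fix x assume "(x, y) \<in> M"
        then obtain j where j: "j < n" "x = w j" "y = b (p j)" by (auto simp: M)
        have "b (p j) = y" by (rule j(3)[symmetric])
        also have "y = b (p i)" unfolding k(2) i(2) ..
        finally have "j = i" by (rule ji[OF j(1)])
        then show "x = w i" using j(2) by simp
      qed
    qed
    moreover have "M \<subseteq> edges N" using p M by auto
    ultimately show "M \<in> dimer_coverings N"
      by (simp only: dimer_coverings_def mem_Collect_eq) simp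
  next
    fix M assume M: "M \<in> dimer_coverings N"
    have "\<exists>k. k < n \<and> (w i, b k) \<in> M" if i: "i < n" for i
    proof -
      have "w i \<in> white_vertices N" using bij_betw_apply[OF w] i by simp
      then obtain y where y: "(w i, y) \<in> M" using white_vertex_matched[OF M] by blast
      then have "y \<in> black_vertices N"
        using dimer_coverings_subset_edges[OF M] edges_vertices(2) by blast
      from bex[OF this] obtain k where "k < n" "y = b k" by blast
      then show ?thesis using y by blast
    qed
    then have "\<forall>i\<in>{0..<n}. \<exists>k. k < n \<and> (w i, b k) \<in> M" by simp
    from bchoice[OF this] obtain q where "\<forall>i\<in>{0..<n}. q i < n \<and> (w i, b (q i)) \<in> M" ..
    then have q: "q i < n \<and> (w i, b (q i)) \<in> M" if "i < n" for i using that by simp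
    define p where "p = (\<lambda>i. if i < n then q i else i)"
    have "inj_on p {0..<n}"
    proof (rule inj_onI)
      fix i j assume ij: "i \<in> {0..<n}" "j \<in> {0..<n}" "p i = p j"
      then have "q i = q j" by (simp add: p_def)
      then have "(w i, b (q i)) \<in> M" "(w j, b (q i)) \<in> M"
        using q[of i] q[of j] ij by simp_all
      then have "w i = w j" by (rule black_vertices_matched_once[OF M])
      then show "i = j" using winj[of i j] ij by simp
    qed
    moreover have "p ` {0..<n} \<subseteq> {0..<n}"
    proof (rule image_subsetI)
      fix i assume "i \<in> {0..<n}"
      then show "p i \<in> {0..<n}" using q[of i] by (simp add: p_def)
    qed
    ultimately have "bij_betw p {0..<n} {0..<n}"
      by (intro bij_betw_imageI endo_inj_surj) simp_all
    then have perm: "p permutes {0..<n}"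
      by (rule bij_imp_permutes) (simp add: p_def)
    have pM: "(w i, b (p i)) \<in> M" if "i < n" for i
      using q[OF that] that by (simp add: p_def)
    have "M \<subseteq> ?F p"
    proof (rule subsetI)
      fix e assume eM: "e \<in> M"
      obtain x y where e: "e = (x, y)" by (cases e)
      have xy: "(x, y) \<in> edges N"
        using dimer_coverings_subset_edges[OF M] eM e by blast
      obtain i where i: "i < n" "x = w i"
        using wex[OF edges_vertices(1)[OF xy]] by blast
      have "(w i, y) \<in> M" using e i eM by simp
      then have "y = b (p i)" using pM[OF i(1)] by (rule white_vertices_matched_once[OF M])
      then show "e \<in> ?F p" using e i by (intro image_eqI[of _ _ i]) simp_all
    qed
    moreover have "?F p \<subseteq> M" by (rule image_subsetI) (simp add: pM)
    ultimately have "M = ?F p" by (rule equalityI)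
    moreover have "p \<in> ?P"
      using perm pM subsetD[OF dimer_coverings_subset_edges[OF M]] by blast
    ultimately show "M \<in> ?F ` ?P" by (rule image_eqI)
  qed
qed

section \<open>The Kasteleyn matrix and determinantal correlations\<close>

definition kasteleyn :: "int \<Rightarrow> (edge \<Rightarrow> complex) \<Rightarrow> vertex \<Rightarrow> vertex \<Rightarrow> complex" where
  "kasteleyn N \<nu> w b = (if (w, b) \<in> edges N then of_int (edge_sign (w, b)) * \<nu> (w, b) else 0)"

definition kasteleyn_mat :: "int \<Rightarrow> (edge \<Rightarrow> complex) \<Rightarrow> complex mat" where
  "kasteleyn_mat N \<nu> = (let l = nat (2 * N); n = l * (l + 1) in
     mat n n (\<lambda>(i, j). kasteleyn N \<nu> (white_at l i) (black_at l j)))"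

lemma det_kasteleyn_mat:
  assumes N: "0 < N"
  shows "det (kasteleyn_mat N \<nu>) = (\<Sum>M\<in>dimer_coverings N. \<Prod>e\<in>M. \<nu> e)"
proof -
  define l where "l = nat (2 * N)"
  define n where "n = l * (l + 1)"
  have l: "int l = 2 * N" "0 < l" using N by (auto simp: l_def)
  have w: "bij_betw (white_at l) {0..<n} (white_vertices N)"
    and b: "bij_betw (black_at l) {0..<n} (black_vertices N)"
    unfolding n_def using bij_betw_white_at[OF l(1)] bij_betw_black_at[OF l] by auto
  let ?P = "{p. p permutes {0..<n} \<and> (\<forall>i<n. (white_at l i, black_at l (p i)) \<in> edges N)}"
  let ?F = "\<lambda>p. (\<lambda>i. (white_at l i, black_at l (p i))) ` {0..<n}"
  let ?K = "\<lambda>i j. kasteleyn N \<nu> (white_at l i) (black_at l j)"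
  have mat: "kasteleyn_mat N \<nu> = mat n n (\<lambda>(i, j). ?K i j)"
    by (simp add: kasteleyn_mat_def Let_def l_def n_def)
  have ran: "p i < n" if "p permutes {0..<n}" "i < n" for p i
    using permutes_in_image[OF that(1), of i] that(2) by simp
  have "det (kasteleyn_mat N \<nu>)
    = (\<Sum>p | p permutes {0..<n}. of_int (sign p) * (\<Prod>i=0..<n. ?K i (p i)))"
    unfolding mat
    by (subst det_def'[of _ n]) (auto intro!: sum.cong prod.cong simp: ran)
  also have "\<dots> = (\<Sum>p\<in>?P. of_int (sign p) * (\<Prod>i=0..<n. ?K i (p i)))"
  proof (rule sum.mono_neutral_right)
    show "finite {p. p permutes {0..<n}}" by (simp add: finite_permutations)
    show "?P \<subseteq> {p. p permutes {0..<n}}" by blast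
    show "\<forall>p\<in>{p. p permutes {0..<n}} - ?P. of_int (sign p) * (\<Prod>i=0..<n. ?K i (p i)) = 0"
    proof
      fix p assume "p \<in> {p. p permutes {0..<n}} - ?P"
      then obtain i where "i < n" "(white_at l i, black_at l (p i)) \<notin> edges N" by blast
      then have "(\<Prod>i=0..<n. ?K i (p i)) = 0"
        by (intro prod_zero) (auto intro!: bexI[of _ i] simp: kasteleyn_def)
      then show "of_int (sign p) * (\<Prod>i=0..<n. ?K i (p i)) = 0" by simp
    qed
  qed
  also have "\<dots> = (\<Sum>p\<in>?P. \<Prod>e\<in>?F p. \<nu> e)"
  proof (rule sum.cong)
    fix p assume "p \<in> ?P"
    then have p: "p permutes {0..<n}" and e: "\<And>i. i < n \<Longrightarrow> (white_at l i, black_at l (p i)) \<in> edges N"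
      by auto
    have "of_int (sign p) * (\<Prod>i=0..<n. ?K i (p i))
      = of_int (sign p * (\<Prod>i=0..<n. edge_sign (white_at l i, black_at l (p i))))
        * (\<Prod>i=0..<n. \<nu> (white_at l i, black_at l (p i)))"
      by (simp add: kasteleyn_def e prod.distrib)
    also have "sign p * (\<Prod>i=0..<n. edge_sign (white_at l i, black_at l (p i))) = 1"
      using sign_mult_prod_edge_sign[OF l p[unfolded n_def]] e unfolding n_def by blast
    also have "of_int 1 * (\<Prod>i=0..<n. \<nu> (white_at l i, black_at l (p i))) = (\<Prod>e\<in>?F p. \<nu> e)"
      by (subst prod.reindex)
        (use bij_betw_imp_inj_on[OF w] in \<open>auto simp: inj_on_def\<close>)
    finally show "of_int (sign p) * (\<Prod>i=0..<n. ?K i (p i)) = (\<Prod>e\<in>?F p. \<nu> e)" .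
  qed simp
  also have "\<dots> = (\<Sum>M\<in>dimer_coverings N. \<Prod>e\<in>M. \<nu> e)"
    by (rule sum.reindex_bij_betw[OF bij_betw_permutations_dimer_coverings[OF w b]])
  finally show ?thesis .
qed

definition real_weight :: "int \<Rightarrow> real \<Rightarrow> real \<Rightarrow> edge \<Rightarrow> complex" where
  "real_weight T \<alpha> \<beta> e = of_real (edge_weight T \<alpha> \<beta> e)"

text \<open>
  The half of a column of the Kasteleyn matrix that belongs to the edges to the right of the point \<open>q\<close>.
\<close>

definition point_source :: "int \<Rightarrow> (edge \<Rightarrow> complex) \<Rightarrow> int \<times> int \<Rightarrow> vertex \<Rightarrow> complex" where
  "point_source N \<nu> q w = (if fst w = fst q + 1 then kasteleyn N \<nu> w (black_vertex N q) else 0)"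

definition solves_kasteleyn ::
  "int \<Rightarrow> (edge \<Rightarrow> complex) \<Rightarrow> (vertex \<Rightarrow> complex) \<Rightarrow> (vertex \<Rightarrow> complex) \<Rightarrow> bool" where
  "solves_kasteleyn N \<nu> r v \<longleftrightarrow>
     (\<forall>w\<in>white_vertices N. (\<Sum>b\<in>black_vertices N. kasteleyn N \<nu> w b * v b) = r w)"

lemma finite_vertices [simp]: "finite (white_vertices N)" "finite (black_vertices N)"
  by (simp_all add: white_vertices_def black_vertices_def)

text \<open>
  The linear system on vertices is the one of the numbered matrix, so existence and uniqueness
  of solutions can be read off its determinant.
\<close>

lemma solves_kasteleyn_iff_mat:
  assumes N: "0 < N" and l: "l = nat (2 * N)" and n: "n = l * (l + 1)"
  shows "solves_kasteleyn N \<nu> r v \<longleftrightarrow>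
    kasteleyn_mat N \<nu> *\<^sub>v vec n (\<lambda>j. v (black_at l j)) = vec n (\<lambda>i. r (white_at l i))"
proof -
  have l': "int l = 2 * N" "0 < l" using N l by auto
  have w: "bij_betw (white_at l) {0..<n} (white_vertices N)"
    and b: "bij_betw (black_at l) {0..<n} (black_vertices N)"
    unfolding n using bij_betw_white_at[OF l'(1)] bij_betw_black_at[OF l'] by auto
  have dim: "dim_row (kasteleyn_mat N \<nu>) = n"
    by (simp add: kasteleyn_mat_def Let_def l n)
  have entry: "(kasteleyn_mat N \<nu> *\<^sub>v vec n (\<lambda>j. v (black_at l j))) $ i
      = (\<Sum>b\<in>black_vertices N. kasteleyn N \<nu> (white_at l i) b * v b)" if "i < n" for i
  proof -
    have "(kasteleyn_mat N \<nu> *\<^sub>v vec n (\<lambda>j. v (black_at l j))) $ i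
      = (\<Sum>j\<in>{0..<n}. kasteleyn N \<nu> (white_at l i) (black_at l j) * v (black_at l j))"
      using that unfolding kasteleyn_mat_def Let_def l[symmetric] n[symmetric]
      by (simp add: scalar_prod_def)
    also have "\<dots> = (\<Sum>b\<in>black_vertices N. kasteleyn N \<nu> (white_at l i) b * v b)"
      by (rule sum.reindex_bij_betw[OF b])
    finally show ?thesis .
  qed
  have "kasteleyn_mat N \<nu> *\<^sub>v vec n (\<lambda>j. v (black_at l j)) = vec n (\<lambda>i. r (white_at l i)) \<longleftrightarrow>
    (\<forall>i<n. (\<Sum>b\<in>black_vertices N. kasteleyn N \<nu> (white_at l i) b * v b) = r (white_at l i))"
    using entry by (auto simp: vec_eq_iff dim)
  also have "\<dots> \<longleftrightarrow> solves_kasteleyn N \<nu> r v"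
    unfolding solves_kasteleyn_def bij_betw_imp_surj_on[OF w, symmetric]
    by auto
  finally show ?thesis by simp
qed

lemma det_kasteleyn_mat_nonzero:
  assumes "0 < N" "0 < \<alpha>" "0 < \<beta>"
  shows "det (kasteleyn_mat N (real_weight T \<alpha> \<beta>)) = of_real (partition_function N T \<alpha> \<beta>)"
    and "det (kasteleyn_mat N (real_weight T \<alpha> \<beta>)) \<noteq> 0"
proof -
  show eq: "det (kasteleyn_mat N (real_weight T \<alpha> \<beta>)) = of_real (partition_function N T \<alpha> \<beta>)"
    using assms by (simp add: det_kasteleyn_mat partition_function_def covering_weight_def real_weight_def)
  show "det (kasteleyn_mat N (real_weight T \<alpha> \<beta>)) \<noteq> 0"
    unfolding eq using partition_function_pos[OF assms(2,3), of N T] by simp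
qed

lemma kasteleyn_mat_carrier:
  "kasteleyn_mat N \<nu> \<in> carrier_mat (nat (2 * N) * (nat (2 * N) + 1)) (nat (2 * N) * (nat (2 * N) + 1))"
  by (simp add: kasteleyn_mat_def Let_def)

lemma solves_kasteleyn_exists:
  assumes "0 < N" "0 < \<alpha>" "0 < \<beta>"
  shows "\<exists>v. solves_kasteleyn N (real_weight T \<alpha> \<beta>) r v"
proof -
  define l where "l = nat (2 * N)"
  define n where "n = l * (l + 1)"
  have l: "int l = 2 * N" "0 < l" using assms by (auto simp: l_def)
  let ?K = "kasteleyn_mat N (real_weight T \<alpha> \<beta>)"
  have K: "?K \<in> carrier_mat n n"
    unfolding n_def l_def by (rule kasteleyn_mat_carrier)
  obtain B where B: "B \<in> carrier_mat n n" "?K * B = 1\<^sub>m n"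
    using det_non_zero_imp_unit[OF K det_kasteleyn_mat_nonzero(2)[OF assms]]
    by (auto simp: Units_def ring_mat_def)
  define x where "x = B *\<^sub>v vec n (\<lambda>i. r (white_at l i))"
  have x: "x \<in> carrier_vec n" using B by (auto simp: x_def)
  have "?K *\<^sub>v x = vec n (\<lambda>i. r (white_at l i))"
    unfolding x_def by (subst assoc_mult_mat_vec[OF K B(1), symmetric]) (simp_all add: B(2))
  moreover define v where "v = (\<lambda>y. x $ (the_inv_into {0..<n} (black_at l) y))"
  have "inj_on (black_at l) {0..<n}"
    using bij_betw_black_at[OF l] by (simp add: bij_betw_def n_def)
  then have "vec n (\<lambda>j. v (black_at l j)) = x"
    using x by (intro eq_vecI) (simp_all add: v_def the_inv_into_f_f)
  ultimately have "?K *\<^sub>v vec n (\<lambda>j. v (black_at l j)) = vec n (\<lambda>i. r (white_at l i))"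
    by simp
  then show ?thesis
    using solves_kasteleyn_iff_mat[OF assms(1) l_def n_def] by blast
qed

lemma solves_kasteleyn_unique:
  assumes "0 < N" "0 < \<alpha>" "0 < \<beta>"
    and v: "solves_kasteleyn N (real_weight T \<alpha> \<beta>) r v"
    and u: "solves_kasteleyn N (real_weight T \<alpha> \<beta>) r u"
    and b: "b \<in> black_vertices N"
  shows "v b = u b"
proof -
  define l where "l = nat (2 * N)"
  define n where "n = l * (l + 1)"
  have l: "int l = 2 * N" "0 < l" using assms by (auto simp: l_def)
  let ?K = "kasteleyn_mat N (real_weight T \<alpha> \<beta>)"
  have K: "?K \<in> carrier_mat n n"
    unfolding n_def l_def by (rule kasteleyn_mat_carrier)
  let ?x = "vec n (\<lambda>j. v (black_at l j) - u (black_at l j))"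
  have "solves_kasteleyn N (real_weight T \<alpha> \<beta>) (\<lambda>_. 0) (\<lambda>b. v b - u b)"
    using v u by (simp add: solves_kasteleyn_def right_diff_distrib sum_subtractf)
  then have "?K *\<^sub>v ?x = vec n (\<lambda>i. 0)"
    by (rule solves_kasteleyn_iff_mat[OF assms(1) l_def n_def, THEN iffD1])
  then have "?K *\<^sub>v ?x = 0\<^sub>v n" by (simp add: zero_vec_def)
  then have x0: "?x = 0\<^sub>v n"
    using det_0_iff_vec_prod_zero_field[OF K] det_kasteleyn_mat_nonzero(2)[OF assms(1-3), of T]
    by (metis vec_carrier)
  obtain j where j: "j < n" "b = black_at l j"
    using b unfolding n_def bij_betw_imp_surj_on[OF bij_betw_black_at[OF l], symmetric] by fastforce
  have "?x $ j = 0" unfolding x0 using j by simp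
  then show ?thesis using j by simp
qed

lemma black_vertex_in_black_vertices:
  assumes "p \<in> points N"
  shows "black_vertex N p \<in> black_vertices N" and "fst (black_vertex N p) = fst p"
proof -
  obtain m u where p: "p = (4 * m, u)" "0 < m" "m < N" "- 2 * N \<le> u" "u \<le> - 1"
    using assms unfolding points_def by blast
  have "(2 * m, u + 2 * N) \<in> {0..2 * N} \<times> {0..2 * N - 1}" using p by auto
  then show "black_vertex N p \<in> black_vertices N"
    unfolding black_vertices_def by (rule rev_image_eqI) (simp add: black_vertex_def p)
  show "fst (black_vertex N p) = fst p" by (simp add: black_vertex_def p)
qed

lemma inj_black_vertex: "inj (black_vertex N)"
  by (auto simp: inj_def black_vertex_def)

text \<open>
  Weights that forbid the points of \<open>S\<close> to be matched to the left.
\<close>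

definition forced_weight :: "int \<Rightarrow> (edge \<Rightarrow> complex) \<Rightarrow> (int \<times> int) set \<Rightarrow> edge \<Rightarrow> complex" where
  "forced_weight N \<nu> S e =
     (if snd e \<in> black_vertex N ` S \<and> fst (fst e) \<noteq> fst (snd e) + 1 then 0 else \<nu> e)"

lemma prob_occupied_eq_det_ratio:
  assumes N: "0 < N" and pos: "0 < \<alpha>" "0 < \<beta>" and S: "finite S" "S \<subseteq> points N"
  shows "of_real (measure_pmf.prob (dimer_pmf N T \<alpha> \<beta>) {M. \<forall>p\<in>S. occupied N M p})
    = det (kasteleyn_mat N (forced_weight N (real_weight T \<alpha> \<beta>) S))
      / det (kasteleyn_mat N (real_weight T \<alpha> \<beta>))"
proof -
  let ?Z = "partition_function N T \<alpha> \<beta>"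
  let ?O = "{M \<in> dimer_coverings N. \<forall>p\<in>S. occupied N M p}"
  let ?\<nu> = "forced_weight N (real_weight T \<alpha> \<beta>) S"
  have finO: "finite ?O" using finite_dimer_coverings[of N] by simp
  have "measure_pmf.prob (dimer_pmf N T \<alpha> \<beta>) {M. \<forall>p\<in>S. occupied N M p}
    = measure_pmf.prob (dimer_pmf N T \<alpha> \<beta>) ?O"
    by (rule measure_prob_cong_0) (auto simp: pmf_dimer_pmf[OF pos])
  also have "\<dots> = (\<Sum>M\<in>?O. covering_weight T \<alpha> \<beta> M / ?Z)"
    unfolding measure_measure_pmf_finite[OF finO]
    by (rule sum.cong) (auto simp: pmf_dimer_pmf[OF pos])
  finally have "of_real (measure_pmf.prob (dimer_pmf N T \<alpha> \<beta>) {M. \<forall>p\<in>S. occupied N M p})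
    = (\<Sum>M\<in>?O. \<Prod>e\<in>M. real_weight T \<alpha> \<beta> e) / of_real ?Z"
    by (simp add: sum_divide_distrib covering_weight_def real_weight_def)
  also have "(\<Sum>M\<in>?O. \<Prod>e\<in>M. real_weight T \<alpha> \<beta> e) = (\<Sum>M\<in>?O. \<Prod>e\<in>M. ?\<nu> e)"
  proof (intro sum.cong prod.cong refl)
    fix M e assume M: "M \<in> ?O" and e: "e \<in> M"
    obtain w b where wb: "e = (w, b)" by (cases e)
    have "fst w = fst b + 1" if b: "b \<in> black_vertex N ` S"
    proof -
      obtain p where p: "p \<in> S" "b = black_vertex N p" using b by blast
      then obtain w' where w': "(w', b) \<in> M" "fst w' = fst p + 1"
        using M by (auto simp: occupied_def)
      have "w' = w" using M e w' wb black_vertices_matched_once[of M N w' b w] by simp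
      then show ?thesis using w' p S black_vertex_in_black_vertices(2)[of p N] by auto
    qed
    then show "real_weight T \<alpha> \<beta> e = ?\<nu> e" by (auto simp: forced_weight_def wb)
  qed
  also have "\<dots> = (\<Sum>M\<in>dimer_coverings N. \<Prod>e\<in>M. ?\<nu> e)"
  proof (rule sum.mono_neutral_left[OF finite_dimer_coverings])
    show "\<forall>M\<in>dimer_coverings N - ?O. (\<Prod>e\<in>M. ?\<nu> e) = 0"
    proof
      fix M assume "M \<in> dimer_coverings N - ?O"
      then obtain p where M: "M \<in> dimer_coverings N" and p: "p \<in> S" "\<not> occupied N M p" by blast
      have "black_vertex N p \<in> black_vertices N"
        using black_vertex_in_black_vertices(1) p S by blast
      then obtain w where w: "(w, black_vertex N p) \<in> M"
        using black_vertex_matched[OF M] by blast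
      then have "fst w \<noteq> fst p + 1" using p(2) unfolding occupied_def by blast
      then have "?\<nu> (w, black_vertex N p) = 0"
        using p S black_vertex_in_black_vertices(2)[of p N] by (auto simp: forced_weight_def)
      moreover have "finite M"
        using dimer_coverings_subset_edges[OF M] finite_subset[of "edges N" "white_vertices N \<times> black_vertices N"]
        by (auto simp: edges_def intro: finite_subset)
      ultimately show "(\<Prod>e\<in>M. ?\<nu> e) = 0" using w by (auto intro: prod_zero)
    qed
  qed auto
  also have "\<dots> = det (kasteleyn_mat N ?\<nu>)" by (rule det_kasteleyn_mat[OF N, symmetric])
  finally show ?thesis using det_kasteleyn_mat_nonzero(1)[OF N pos] by simp
qed

text \<open>
  Replacing columns of \<open>K\<close> by the sources is multiplication of \<open>K\<close> from the right by \<open>1 + G C\<close>, where the columns of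
  \<open>G\<close> are the solutions \<open>g\<close> minus unit vectors and \<open>C\<close> selects the replaced columns. The determinant of \<open>1 + C G\<close>, which has
  the size of the list, consists of the values of the solutions at the points.
\<close>

lemma prob_occupied_eq_det_solutions:
  assumes N: "0 < N" and pos: "0 < \<alpha>" "0 < \<beta>"
    and ps: "distinct ps" "set ps \<subseteq> points N"
    and g: "\<And>q. q \<in> set ps \<Longrightarrow>
      solves_kasteleyn N (real_weight T \<alpha> \<beta>) (point_source N (real_weight T \<alpha> \<beta>) q) (g q)"
  shows "of_real (measure_pmf.prob (dimer_pmf N T \<alpha> \<beta>) {M. \<forall>p\<in>set ps. occupied N M p})
    = det (mat (length ps) (length ps) (\<lambda>(a, b). g (ps ! b) (black_vertex N (ps ! a))))"
proof -
  define l where "l = nat (2 * N)"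
  define n where "n = l * (l + 1)"
  define k where "k = length ps"
  let ?\<nu> = "real_weight T \<alpha> \<beta>"
  let ?\<nu>' = "forced_weight N ?\<nu> (set ps)"
  let ?K = "kasteleyn_mat N ?\<nu>"
  let ?K' = "kasteleyn_mat N ?\<nu>'"
  have l: "int l = 2 * N" "0 < l" using N by (auto simp: l_def)
  have K: "?K \<in> carrier_mat n n" and K': "?K' \<in> carrier_mat n n"
    unfolding n_def l_def by (rule kasteleyn_mat_carrier)+
  have Kij: "kasteleyn_mat N \<mu> $$ (i, j) = kasteleyn N \<mu> (white_at l i) (black_at l j)"
    if "i < n" "j < n" for i j \<mu>
    using that unfolding kasteleyn_mat_def Let_def l_def[symmetric] n_def[symmetric] by simp
  \<comment> \<open>The number of the black vertex that belongs to the \<open>a\<close>-th point.\<close>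
  define c where "c = (\<lambda>a. the_inv_into {0..<n} (black_at l) (black_vertex N (ps ! a)))"
  have b: "bij_betw (black_at l) {0..<n} (black_vertices N)"
    unfolding n_def by (rule bij_betw_black_at[OF l])
  have c: "c a < n" "black_at l (c a) = black_vertex N (ps ! a)" if "a < k" for a
  proof -
    have "black_vertex N (ps ! a) \<in> black_at l ` {0..<n}"
      unfolding bij_betw_imp_surj_on[OF b]
      using black_vertex_in_black_vertices(1) ps(2) that nth_mem unfolding k_def by blast
    then show "c a < n" "black_at l (c a) = black_vertex N (ps ! a)"
      using the_inv_into_into[OF bij_betw_imp_inj_on[OF b] _ order_refl]
        f_the_inv_into_f[OF bij_betw_imp_inj_on[OF b]] unfolding c_def by auto
  qed
  have cinj: "c a = c a' \<longleftrightarrow> a = a'" if "a < k" "a' < k" for a a'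
    using c that ps(1) inj_black_vertex[of N] unfolding k_def by (metis inj_eq nth_eq_iff_index_eq)
  define G where "G = mat n k (\<lambda>(i, a). g (ps ! a) (black_at l i) - (if i = c a then 1 else 0))"
  define C where "C = mat k n (\<lambda>(a, j). if j = c a then 1 else 0 :: complex)"
  have G: "G \<in> carrier_mat n k" and C: "C \<in> carrier_mat k n" by (auto simp: G_def C_def)
  have KG: "(?K * G) $$ (i, a) = (?K' - ?K) $$ (i, c a)" if i: "i < n" and a: "a < k" for i a
  proof -
    let ?q = "ps ! a"
    have q: "?q \<in> set ps" using a by (simp add: k_def)
    have w: "white_at l i \<in> white_vertices N"
      using bij_betw_apply[OF bij_betw_white_at[OF l(1)]] i unfolding n_def by simp
    have "(?K * G) $$ (i, a) = (\<Sum>j\<in>{0..<n}. kasteleyn N ?\<nu> (white_at l i) (black_at l j)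
        * (g ?q (black_at l j) - (if j = c a then 1 else 0)))"
      using i a K G by (simp add: scalar_prod_def Kij G_def)
    also have "\<dots> = (\<Sum>j\<in>{0..<n}. kasteleyn N ?\<nu> (white_at l i) (black_at l j) * g ?q (black_at l j))
        - (\<Sum>j\<in>{0..<n}. if j = c a then kasteleyn N ?\<nu> (white_at l i) (black_at l j) else 0)"
      unfolding sum_subtractf[symmetric] by (rule sum.cong) (auto simp: algebra_simps)
    also have "(\<Sum>j\<in>{0..<n}. kasteleyn N ?\<nu> (white_at l i) (black_at l j) * g ?q (black_at l j))
      = (\<Sum>b\<in>black_vertices N. kasteleyn N ?\<nu> (white_at l i) b * g ?q b)"
      by (rule sum.reindex_bij_betw[OF b])
    also have "\<dots> = point_source N ?\<nu> ?q (white_at l i)"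
      using g[OF q] w unfolding solves_kasteleyn_def by blast
    also have "(\<Sum>j\<in>{0..<n}. if j = c a then kasteleyn N ?\<nu> (white_at l i) (black_at l j) else 0)
      = kasteleyn N ?\<nu> (white_at l i) (black_vertex N ?q)"
      using c[OF a] by simp
    also have "point_source N ?\<nu> ?q (white_at l i) - kasteleyn N ?\<nu> (white_at l i) (black_vertex N ?q)
      = kasteleyn N ?\<nu>' (white_at l i) (black_vertex N ?q) - kasteleyn N ?\<nu> (white_at l i) (black_vertex N ?q)"
      using q ps(2) black_vertex_in_black_vertices(2)[of ?q N]
      by (auto simp: point_source_def kasteleyn_def forced_weight_def)
    finally show ?thesis
      using i c[OF a] K K' by (simp add: Kij)
  qed
  have GC: "?K * (1\<^sub>m n + G * C) = ?K'"
  proof (rule eq_matI)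
    fix i j assume "i < dim_row ?K'" "j < dim_col ?K'"
    then have i: "i < n" and j: "j < n" using K' by auto
    define H where "H = ?K * G"
    have H: "H \<in> carrier_mat n k" using K G by (simp add: H_def)
    have "?K * (1\<^sub>m n + G * C) = ?K * 1\<^sub>m n + ?K * (G * C)"
      by (rule mult_add_distrib_mat[OF K]) (use G C in auto)
    also have "\<dots> = ?K + H * C"
      unfolding H_def by (simp only: right_mult_one_mat[OF K] assoc_mult_mat[OF K G C])
    finally have "(?K * (1\<^sub>m n + G * C)) $$ (i, j) = (?K + H * C) $$ (i, j)" by simp
    also have "\<dots> = ?K $$ (i, j) + (\<Sum>a\<in>{0..<k}. H $$ (i, a) * C $$ (a, j))"
      using i j K H C by (simp add: scalar_prod_def)
    also have "(\<Sum>a\<in>{0..<k}. H $$ (i, a) * C $$ (a, j))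
      = (\<Sum>a\<in>{0..<k}. if j = c a then (?K' - ?K) $$ (i, j) else 0)"
      unfolding H_def by (rule sum.cong) (use KG[OF i] j in \<open>auto simp: C_def\<close>)
    also have "\<dots> = (?K' - ?K) $$ (i, j)"
    proof (cases "\<exists>a<k. j = c a")
      case True
      then obtain a where a: "a < k" "j = c a" by blast
      have "(\<Sum>a'\<in>{0..<k}. if j = c a' then (?K' - ?K) $$ (i, j) else 0)
        = (\<Sum>a'\<in>{0..<k}. if a' = a then (?K' - ?K) $$ (i, j) else 0)"
        by (rule sum.cong) (use a cinj in auto)
      then show ?thesis using a by simp
    next
      case False
      have "black_at l j \<notin> black_vertex N ` set ps"
      proof
        assume "black_at l j \<in> black_vertex N ` set ps"
        then obtain a where a: "a < k" "black_at l j = black_vertex N (ps ! a)"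
          unfolding k_def by (metis image_iff in_set_conv_nth)
        then have "black_at l j = black_at l (c a)" using c by simp
        then have "j = c a" using inj_on_eq_iff[OF bij_betw_imp_inj_on[OF b]] j c(1)[OF a(1)] by simp
        then show False using False a by blast
      qed
      then have "(?K' - ?K) $$ (i, j) = 0"
        using i j K K' by (simp add: Kij kasteleyn_def forced_weight_def)
      moreover have "(\<Sum>a\<in>{0..<k}. if j = c a then (?K' - ?K) $$ (i, j) else 0) = 0"
        using False by (intro sum.neutral) auto
      ultimately show ?thesis by simp
    qed
    finally show "(?K * (1\<^sub>m n + G * C)) $$ (i, j) = ?K' $$ (i, j)"
      using i j K K' by simp
  qed (use K K' G C in auto)
  have dims: "1\<^sub>m n + G * C \<in> carrier_mat n n" using G C by simp
  have "det ?K' = det ?K * det (1\<^sub>m n + G * C)"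
    using det_mult[OF K dims] unfolding GC .
  then have "det ?K' / det ?K = det (1\<^sub>m n + G * C)"
    using det_kasteleyn_mat_nonzero(2)[OF N pos, of T] by simp
  also have "\<dots> = det (1\<^sub>m k + C * G)"
    by (rule det_one_add_mult_commute[OF G C])
  also have "1\<^sub>m k + C * G = mat k k (\<lambda>(a, b). g (ps ! b) (black_vertex N (ps ! a)))"
  proof (rule eq_matI)
    fix a b assume "a < dim_row (mat k k (\<lambda>(a, b). g (ps ! b) (black_vertex N (ps ! a))))"
      "b < dim_col (mat k k (\<lambda>(a, b). g (ps ! b) (black_vertex N (ps ! a))))"
    then have ab: "a < k" "b < k" by auto
    have "(C * G) $$ (a, b) = (\<Sum>i\<in>{0..<n}. (if i = c a then 1 else 0) * G $$ (i, b))"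
      using ab G C by (simp add: scalar_prod_def C_def)
    also have "\<dots> = (\<Sum>i\<in>{0..<n}. if i = c a then G $$ (i, b) else 0)"
      by (rule sum.cong) auto
    also have "\<dots> = G $$ (c a, b)"
      using c[OF ab(1)] by simp
    finally show "(1\<^sub>m k + C * G) $$ (a, b)
      = mat k k (\<lambda>(a, b). g (ps ! b) (black_vertex N (ps ! a))) $$ (a, b)"
      using ab G C c[OF ab(1)] cinj[OF ab] by (simp add: G_def)
  qed (use G C in auto)
  finally show ?thesis
    using prob_occupied_eq_det_ratio[OF N pos _ ps(2)] by (simp add: k_def)
qed

text \<open>
  The kernel is only pinned down through linear equations: any function that solves the system for the source at \<open>q\<close>
  gives the values of the kernel, by uniqueness.
\<close>

theorem correlation_kernel_from_solutions:
  assumes N: "0 < N" and pos: "0 < \<alpha>" "0 < \<beta>"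
  shows "\<exists>K. correlation_kernel N T \<alpha> \<beta> K \<and>
    (\<forall>q v p. q \<in> points N \<longrightarrow> p \<in> points N \<longrightarrow>
      solves_kasteleyn N (real_weight T \<alpha> \<beta>) (point_source N (real_weight T \<alpha> \<beta>) q) v \<longrightarrow>
      K q p = v (black_vertex N p))"
proof -
  let ?\<nu> = "real_weight T \<alpha> \<beta>"
  have "\<forall>q. \<exists>v. solves_kasteleyn N ?\<nu> (point_source N ?\<nu> q) v"
    using solves_kasteleyn_exists[OF assms] by blast
  then obtain g where g: "\<And>q. solves_kasteleyn N ?\<nu> (point_source N ?\<nu> q) (g q)" by metis
  define K where "K = (\<lambda>q p. g q (black_vertex N p))"
  have "correlation_kernel N T \<alpha> \<beta> K"
    unfolding correlation_kernel_def
  proof (intro allI impI, elim conjE)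
    fix ps assume ps: "distinct ps" "set ps \<subseteq> points N"
    let ?k = "length ps"
    let ?A = "mat ?k ?k (\<lambda>(a, b). g (ps ! b) (black_vertex N (ps ! a)))"
    have "of_real (measure_pmf.prob (dimer_pmf N T \<alpha> \<beta>) {M. \<forall>p\<in>set ps. occupied N M p}) = det ?A"
      using prob_occupied_eq_det_solutions[OF N pos ps g] .
    also have "\<dots> = det (transpose_mat ?A)"
      by (rule det_transpose[symmetric, of _ ?k]) simp
    also have "transpose_mat ?A = mat ?k ?k (\<lambda>(a, b). K (ps ! a) (ps ! b))"
      by (rule eq_matI) (auto simp: K_def)
    finally show "of_real (measure_pmf.prob (dimer_pmf N T \<alpha> \<beta>) {M. \<forall>p\<in>set ps. occupied N M p})
      = det (mat ?k ?k (\<lambda>(a, b). K (ps ! a) (ps ! b)))" .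
  qed
  moreover have "K q p = v (black_vertex N p)"
    if "p \<in> points N" "solves_kasteleyn N ?\<nu> (point_source N ?\<nu> q) v" for q v p
    unfolding K_def
    by (rule solves_kasteleyn_unique[OF assms g that(2) black_vertex_in_black_vertices(1)[OF that(1)]])
  ultimately show ?thesis by blast
qed

section \<open>Half steps of the transition matrix\<close>

text \<open>
  Two by two matrices as a type, so that ring simplification applies to them without dimension premises.
\<close>

datatype m2 = M2 (e00: complex) (e01: complex) (e10: complex) (e11: complex)

lemma m2_eq_iff: "A = B \<longleftrightarrow> e00 A = e00 B \<and> e01 A = e01 B \<and> e10 A = e10 B \<and> e11 A = e11 B"
  by (cases A; cases B) simp

instantiation m2 :: ring_1
begin
definition "0 = M2 0 0 0 0"
definition "1 = M2 1 0 0 1"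
definition "A + B = M2 (e00 A + e00 B) (e01 A + e01 B) (e10 A + e10 B) (e11 A + e11 B)"
definition "A - B = M2 (e00 A - e00 B) (e01 A - e01 B) (e10 A - e10 B) (e11 A - e11 B)"
definition "- A = M2 (- e00 A) (- e01 A) (- e10 A) (- e11 A)"
definition "A * B = M2 (e00 A * e00 B + e01 A * e10 B) (e00 A * e01 B + e01 A * e11 B)
  (e10 A * e00 B + e11 A * e10 B) (e10 A * e01 B + e11 A * e11 B)"
instance
  by standard
    (auto simp: m2_eq_iff zero_m2_def one_m2_def plus_m2_def minus_m2_def uminus_m2_def times_m2_def algebra_simps)
end

lemmas m2_defs = zero_m2_def one_m2_def plus_m2_def minus_m2_def uminus_m2_def times_m2_def

text \<open>
  Scalar matrices.
\<close>

definition sc :: "complex \<Rightarrow> m2" where "sc c = M2 c 0 0 c"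

definition ent :: "m2 \<Rightarrow> nat \<Rightarrow> nat \<Rightarrow> complex" where
  "ent A i j = (if i = 0 then (if j = 0 then e00 A else e01 A) else (if j = 0 then e10 A else e11 A))"

definition to_mat :: "m2 \<Rightarrow> complex mat" where
  "to_mat A = mat 2 2 (\<lambda>(i, j). ent A i j)"

lemma sc_simps:
  "sc 1 = 1" "sc 0 = 0" "sc (a + b) = sc a + sc b" "sc (a * b) = sc a * sc b"
  "sc (a - b) = sc a - sc b" "sc (- a) = - sc a" "sc (a ^ n) = sc a ^ n"
proof -
  show "sc 1 = 1" "sc 0 = 0" "sc (a + b) = sc a + sc b" "sc (a - b) = sc a - sc b" "sc (- a) = - sc a"
    by (simp_all add: sc_def m2_defs)
  show mult: "sc (a * b) = sc a * sc b" for a b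
    by (simp add: sc_def m2_defs)
  show "sc (a ^ n) = sc a ^ n"
    by (induction n) (simp_all add: mult, simp add: sc_def m2_defs)
qed

lemma sc_commute: "A * sc c = sc c * A"
  by (simp add: sc_def m2_defs mult.commute)

lemma sc_left_commute: "A * (sc c * B) = sc c * (A * B)"
  by (metis mult.assoc sc_commute)

lemma ent_simps:
  "ent (A + B) i j = ent A i j + ent B i j" "ent (A - B) i j = ent A i j - ent B i j"
  "ent (- A) i j = - ent A i j" "ent (sc c * A) i j = c * ent A i j"
  "ent 0 i j = 0"
  "ent (A * B) i j = ent A i 0 * ent B 0 j + ent A i 1 * ent B 1 j"
  by (simp_all add: ent_def m2_defs sc_def)

lemma ent_M2: "ent (M2 a b c d) i j = (if i = 0 then (if j = 0 then a else b) else (if j = 0 then c else d))"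
  by (simp add: ent_def)

lemma ent_one: "i < 2 \<Longrightarrow> j < 2 \<Longrightarrow> ent 1 i j = (if i = j then 1 else 0)"
  by (auto simp: ent_def m2_defs)

lemma to_mat_carrier [simp]: "to_mat A \<in> carrier_mat 2 2" "dim_row (to_mat A) = 2" "dim_col (to_mat A) = 2"
  by (simp_all add: to_mat_def)

lemma to_mat_index: "i < 2 \<Longrightarrow> j < 2 \<Longrightarrow> to_mat A $$ (i, j) = ent A i j"
  by (simp add: to_mat_def)

lemma to_mat_add: "to_mat A + to_mat B = to_mat (A + B)"
  by (rule eq_matI) (auto simp: to_mat_index ent_simps)

lemma to_mat_minus: "to_mat A - to_mat B = to_mat (A - B)"
  by (rule eq_matI) (auto simp: to_mat_index ent_simps)

lemma to_mat_smult: "c \<cdot>\<^sub>m to_mat A = to_mat (sc c * A)"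
  by (rule eq_matI) (auto simp: to_mat_index ent_simps(4))

lemma to_mat_mult: "to_mat A * to_mat B = to_mat (A * B)"
  by (rule eq_matI) (auto simp: to_mat_index ent_simps scalar_prod_def numeral_2_eq_2)

lemma to_mat_one: "1\<^sub>m 2 = to_mat 1"
  by (rule eq_matI) (auto simp: to_mat_index ent_one)

lemma to_mat_power: "to_mat A ^\<^sub>m n = to_mat (A ^ n)"
proof (induction n)
  case 0
  then show ?case by (simp add: to_mat_one)
next
  case (Suc n)
  then show ?case by (simp add: to_mat_mult power_commutes)
qed

lemma to_mat_rows: "mat_of_rows_list 2 [[a, b], [c, d]] = to_mat (M2 a b c d)"
  by (rule eq_matI) (auto simp: to_mat_index ent_M2 mat_of_rows_list_def less_2_cases_iff)

text \<open>
  The negative powers are powers of an explicitly known inverse, so the matrix inversion algorithm never has to be evaluated.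
\<close>

lemma mat_powi_to_mat:
  assumes "A * B = 1" "B * A = 1"
  shows "to_mat A ^\<^sub>m\<^sub>i k = to_mat (if 0 \<le> k then A ^ nat k else B ^ nat (- k))"
proof (cases "0 \<le> k")
  case True
  then show ?thesis by (simp add: mat_powi_def to_mat_power)
next
  case False
  have "mat_inverse (to_mat A) \<noteq> None"
  proof
    assume "mat_inverse (to_mat A) = None"
    then have "to_mat A \<notin> Units (ring_mat TYPE(complex) 2 ())"
      by (rule mat_inverse(1)[OF to_mat_carrier(1)])
    moreover have "to_mat A \<in> Units (ring_mat TYPE(complex) 2 ())"
      unfolding Units_def ring_mat_def
      using assms by (auto simp: to_mat_mult to_mat_one intro!: bexI[of _ "to_mat B"])
    ultimately show False by blast
  qed
  then obtain C where C: "mat_inverse (to_mat A) = Some C" by blast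
  from mat_inverse(2)[OF to_mat_carrier(1) this]
  have CA: "C * to_mat A = 1\<^sub>m 2" and Cc: "C \<in> carrier_mat 2 2" by auto
  have "C = C * (to_mat A * to_mat B)"
    using Cc assms by (simp add: to_mat_mult to_mat_one[symmetric])
  also have "\<dots> = (C * to_mat A) * to_mat B"
    by (rule assoc_mult_mat[symmetric, OF Cc to_mat_carrier(1) to_mat_carrier(1)])
  also have "\<dots> = to_mat B" unfolding CA by simp
  finally have "C = to_mat B" .
  then show ?thesis
    using False by (simp add: mat_powi_def C to_mat_power)
qed

text \<open>
  The matrix that leads from one column of black vertices to the next one; \<open>\<epsilon>\<close> is 1 if the white column between them is unweighted.
  Its inverse is \<open>unstep\<close>.
\<close>

definition step :: "real \<Rightarrow> complex \<Rightarrow> m2" where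
  "step \<epsilon> z = sc (1 / (z - 1)) * M2 (1 + z) (of_real (2 * \<epsilon>\<^sup>2)) (of_real (2 / \<epsilon>\<^sup>2) * z) (1 + z)"

definition unstep :: "real \<Rightarrow> complex \<Rightarrow> m2" where
  "unstep \<epsilon> z = sc (1 / (z - 1)) * M2 (1 + z) (- of_real (2 * \<epsilon>\<^sup>2)) (- of_real (2 / \<epsilon>\<^sup>2) * z) (1 + z)"

lemma step_unstep:
  assumes "z \<noteq> 1" "\<epsilon> \<noteq> 0"
  shows "step \<epsilon> z * unstep \<epsilon> z = 1" "unstep \<epsilon> z * step \<epsilon> z = 1"
proof -
  have prod: "sc c * M2 p A (B * z) p * (sc c * M2 p (- A) (- B * z) p) = sc (c * c * (p * p - A * B * z))"
    "sc c * M2 p (- A) (- B * z) p * (sc c * M2 p A (B * z) p) = sc (c * c * (p * p - A * B * z))" for c p A B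
    by (simp_all add: m2_defs sc_def algebra_simps)
  have "of_real (2 * \<epsilon>\<^sup>2) * of_real (2 / \<epsilon>\<^sup>2) = (4 :: complex)"
    by (subst of_real_mult[symmetric]) (use assms in simp)
  moreover have "(1 + z) * (1 + z) - 4 * z = (z - 1) * (z - 1)" by (simp add: algebra_simps)
  moreover have "1 / (z - 1) * (1 / (z - 1)) * ((z - 1) * (z - 1)) = 1" using assms by simp
  ultimately show "step \<epsilon> z * unstep \<epsilon> z = 1" "unstep \<epsilon> z * step \<epsilon> z = 1"
    unfolding step_def unstep_def prod by (simp_all only: sc_simps)
qed

definition phi :: "real \<Rightarrow> complex \<Rightarrow> m2" where
  "phi \<epsilon> z = step \<epsilon> z * step 1 z"

definition phi_inv :: "real \<Rightarrow> complex \<Rightarrow> m2" where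
  "phi_inv \<epsilon> z = unstep 1 z * unstep \<epsilon> z"

lemma phi_inverse:
  assumes "z \<noteq> 1" "\<epsilon> \<noteq> 0"
  shows "phi \<epsilon> z * phi_inv \<epsilon> z = 1" "phi_inv \<epsilon> z * phi \<epsilon> z = 1"
proof -
  have "phi \<epsilon> z * phi_inv \<epsilon> z = step \<epsilon> z * (step 1 z * unstep 1 z) * unstep \<epsilon> z"
    by (simp add: phi_def phi_inv_def mult.assoc)
  then show "phi \<epsilon> z * phi_inv \<epsilon> z = 1" using step_unstep assms by simp
  have "phi_inv \<epsilon> z * phi \<epsilon> z = unstep 1 z * (unstep \<epsilon> z * step \<epsilon> z) * step 1 z"
    by (simp add: phi_def phi_inv_def mult.assoc)
  then show "phi_inv \<epsilon> z * phi \<epsilon> z = 1" using step_unstep assms by simp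
qed

text \<open>
  The two equal factors of each square in \<open>Phi\<close> combine to one half step.
\<close>

lemma Phi_half:
  assumes "z \<noteq> 0" "z \<noteq> 1" "\<epsilon> \<noteq> 0"
  shows "sc (1 / (1 - 1 / z)) * M2 1 (of_real (\<epsilon>\<^sup>2) / z) (of_real (1 / \<epsilon>\<^sup>2)) 1 ^ 2 = step \<epsilon> z"
proof -
  have 1: "1 / (1 - 1 / z) = z / (z - 1)" using assms by (simp add: field_simps)
  show ?thesis
    unfolding 1 using assms
    by (simp add: step_def m2_defs sc_def power2_eq_square divide_simps)
qed

lemma Phi_eq_to_mat:
  assumes "z \<noteq> 0" "z \<noteq> 1" "\<epsilon> \<noteq> 0"
  shows "Phi \<epsilon> z = to_mat (phi \<epsilon> z)"
proof -
  let ?c = "1 / (1 - 1 / z)" and ?A = "M2 1 (of_real (\<epsilon>\<^sup>2) / z) (of_real (1 / \<epsilon>\<^sup>2)) 1" and ?B = "M2 1 (1 / z) 1 1"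
  have "1 / (1 - 1 / z)\<^sup>2 = ?c * ?c" by (simp add: power2_eq_square)
  then have "Phi \<epsilon> z = to_mat (sc (?c * ?c) * (?A ^ 2 * ?B ^ 2))"
    unfolding Phi_def by (simp only: to_mat_rows to_mat_power to_mat_mult to_mat_smult)
  also have "sc (?c * ?c) * (?A ^ 2 * ?B ^ 2) = (sc ?c * ?A ^ 2) * (sc ?c * ?B ^ 2)"
    by (simp only: sc_simps mult.assoc sc_left_commute[of "?A ^ 2"])
  also have "\<dots> = phi \<epsilon> z"
    using Phi_half[OF assms] Phi_half[of z 1] assms by (simp add: phi_def)
  finally show ?thesis .
qed

text \<open>
  The product of \<open>k\<close> half steps that starts in the column \<open>j\<close>.
\<close>

primrec walk :: "(nat \<Rightarrow> real) \<Rightarrow> nat \<Rightarrow> nat \<Rightarrow> complex \<Rightarrow> m2" where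
  "walk e j 0 z = 1"
| "walk e j (Suc k) z = walk e j k z * step (e (j + k)) z"

primrec walk_inv :: "(nat \<Rightarrow> real) \<Rightarrow> nat \<Rightarrow> nat \<Rightarrow> complex \<Rightarrow> m2" where
  "walk_inv e j 0 z = 1"
| "walk_inv e j (Suc k) z = unstep (e (j + k)) z * walk_inv e j k z"

lemma walk_add: "walk e j (k + l) z = walk e j k z * walk e (j + k) l z"
  by (induction l) (simp_all add: mult.assoc add.assoc)

lemma walk_inverse:
  assumes "z \<noteq> 1" "\<And>j. e j \<noteq> 0"
  shows "walk e j k z * walk_inv e j k z = 1" "walk_inv e j k z * walk e j k z = 1"
proof -
  show "walk e j k z * walk_inv e j k z = 1"
  proof (induction k)
    case (Suc k)
    have "walk e j (Suc k) z * walk_inv e j (Suc k) z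
      = walk e j k z * (step (e (j + k)) z * unstep (e (j + k)) z) * walk_inv e j k z"
      by (simp add: mult.assoc)
    then show ?case using Suc step_unstep[OF assms] by simp
  qed simp
  show "walk_inv e j k z * walk e j k z = 1"
  proof (induction k)
    case (Suc k)
    have "walk_inv e j (Suc k) z * walk e j (Suc k) z
      = unstep (e (j + k)) z * (walk_inv e j k z * walk e j k z) * step (e (j + k)) z"
      by (simp add: mult.assoc)
    then show ?case using Suc step_unstep[OF assms] by simp
  qed simp
qed

section \<open>Branches of the square roots and spectral projections\<close>

lemma csqrt_sq_parts:
  "2 * (Re (csqrt z) * Im (csqrt z)) = Im z" "0 \<le> Re (csqrt z)"
proof -
  define s where "s = csqrt z"
  have "s * s = z" unfolding s_def by (metis power2_csqrt power2_eq_square)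
  then have "2 * (Re s * Im s) = Im z" by auto
  then show "2 * (Re (csqrt z) * Im (csqrt z)) = Im z" unfolding s_def .
  show "0 \<le> Re (csqrt z)" using csqrt_principal[of z] by auto
qed

text \<open>
  Off the segment \<open>[-a, 0]\<close> the product on the right has its argument in the range of the principal branch: the
  imaginary parts of \<open>z\<close> and \<open>1 + a / z\<close> have opposite signs, so the arguments of the two roots partly cancel.
\<close>

lemma csqrt_add_of_real:
  assumes "0 < a" "z \<notin> of_real ` {- a..0}"
  shows "csqrt (z + of_real a) = csqrt z * csqrt (1 + of_real a / z)"
proof (rule csqrt_unique)
  have z0: "z \<noteq> 0" using assms by force
  let ?s = "csqrt z" and ?t = "csqrt (1 + of_real a / z)"
  show "(?s * ?t)\<^sup>2 = z + of_real a" using z0 by (simp add: power_mult_distrib field_simps)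
  show "0 < Re (?s * ?t) \<or> Re (?s * ?t) = 0 \<and> 0 \<le> Im (?s * ?t)"
  proof (cases "Im z = 0")
    case True
    define x where "x = Re z"
    have z: "z = of_real x" using True by (simp add: x_def complex_eq_iff)
    have "1 + complex_of_real a / z = of_real (1 + a / x)" by (simp add: z)
    moreover have pos: "0 < 1 + a / x"
    proof (cases "x > 0")
      case True then show ?thesis using assms by (simp add: add_pos_pos)
    next
      case False
      then have "x < - a" using assms(2) z by (auto simp: image_iff not_le)
      then have "x < 0" "a < - x" using assms(1) by auto
      then show ?thesis by (simp add: field_simps)
    qed
    moreover have "csqrt (of_real (1 + a / x)) = of_real (sqrt (1 + a / x))"
      by (subst csqrt_of_real_nonneg) (use pos in simp_all)
    ultimately have t: "?t = of_real (sqrt (1 + a / x))" by (simp only:)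
    define s where "s = csqrt z"
    have s: "0 < Re s \<or> Re s = 0 \<and> 0 \<le> Im s" unfolding s_def by (rule csqrt_principal)
    have "0 < sqrt (1 + a / x)" using pos by simp
    then show ?thesis using s unfolding t s_def[symmetric] by auto
  next
    case False
    have im: "Im (1 + of_real a / z) = - a * Im z / (cmod z)\<^sup>2"
      by (simp add: Im_divide_of_real Im_divide cmod_power2)
    have s: "2 * (Re ?s * Im ?s) = Im z" "0 \<le> Re ?s" and t: "2 * (Re ?t * Im ?t) = - a * Im z / (cmod z)\<^sup>2" "0 \<le> Re ?t"
      using csqrt_sq_parts[of z] csqrt_sq_parts[of "1 + of_real a / z"] unfolding im by auto
    have "Re ?s \<noteq> 0" "Re ?t \<noteq> 0"
      using s t False z0 assms(1) by auto
    then have pos: "0 < Re ?s" "0 < Re ?t" using s t by auto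
    have "(Re ?s * Im ?s) * (Re ?t * Im ?t) = - a * (Im z)\<^sup>2 / (4 * (cmod z)\<^sup>2)"
    proof -
      have "Re ?s * Im ?s = Im z / 2" "Re ?t * Im ?t = - a * Im z / (cmod z)\<^sup>2 / 2" using s t by auto
      then show ?thesis by (simp only:) (simp add: power2_eq_square)
    qed
    then have "(Re ?s * Re ?t) * (Im ?s * Im ?t) \<le> 0"
      using assms(1) by (simp add: mult_ac)
    then have "Im ?s * Im ?t \<le> 0"
      using pos by (metis mult_pos_pos not_less mult_le_0_iff)
    moreover have "0 < Re ?s * Re ?t" using pos by simp
    ultimately show ?thesis by simp
  qed
qed

lemma not_in_branch_cuts:
  assumes "z \<notin> branch_cuts \<epsilon>" "0 < \<epsilon>"
  shows "z \<noteq> 0" "z \<notin> of_real ` {- (\<epsilon>\<^sup>2)..0}" "1 + of_real (\<epsilon>\<^sup>2) / z \<notin> \<real>\<^sub>\<le>\<^sub>0" "1 + of_real (\<epsilon>\<^sup>2) * z \<notin> \<real>\<^sub>\<le>\<^sub>0"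
proof -
  have cut: "z \<noteq> of_real x" if "x \<le> - (1 / \<epsilon>\<^sup>2) \<or> - (\<epsilon>\<^sup>2) \<le> x \<and> x \<le> 0" for x
    using assms that unfolding branch_cuts_def by auto
  show z0: "z \<noteq> 0" using cut[of 0] by simp
  show "z \<notin> of_real ` {- (\<epsilon>\<^sup>2)..0}"
  proof
    assume "z \<in> of_real ` {- (\<epsilon>\<^sup>2)..0}"
    then obtain x where "z = of_real x" "- (\<epsilon>\<^sup>2) \<le> x" "x \<le> 0" by auto
    then show False using cut[of x] by simp
  qed
  show "1 + of_real (\<epsilon>\<^sup>2) / z \<notin> \<real>\<^sub>\<le>\<^sub>0"
  proof
    assume "1 + of_real (\<epsilon>\<^sup>2) / z \<in> \<real>\<^sub>\<le>\<^sub>0"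
    then obtain r where r: "r \<le> 0" "1 + of_real (\<epsilon>\<^sup>2) / z = of_real r"
      by (auto elim: nonpos_Reals_cases)
    then have "of_real (\<epsilon>\<^sup>2) = z * of_real (r - 1)" using z0 by (simp add: field_simps)
    then have "z = of_real (\<epsilon>\<^sup>2 / (r - 1))" using r by (simp add: field_simps)
    moreover have "- (\<epsilon>\<^sup>2) \<le> \<epsilon>\<^sup>2 / (r - 1)" "\<epsilon>\<^sup>2 / (r - 1) \<le> 0"
      using r mult_nonneg_nonneg[of "\<epsilon>\<^sup>2" "- r"] by (simp_all add: field_simps)
    ultimately show False using cut by blast
  qed
  show "1 + of_real (\<epsilon>\<^sup>2) * z \<notin> \<real>\<^sub>\<le>\<^sub>0"
  proof
    assume "1 + of_real (\<epsilon>\<^sup>2) * z \<in> \<real>\<^sub>\<le>\<^sub>0"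
    then obtain r where r: "r \<le> 0" "1 + of_real (\<epsilon>\<^sup>2) * z = of_real r"
      by (auto elim: nonpos_Reals_cases)
    then have "of_real (\<epsilon>\<^sup>2) * z = of_real (r - 1)" by (simp add: field_simps)
    then have "z = of_real ((r - 1) / \<epsilon>\<^sup>2)" using assms(2) by (simp add: field_simps)
    moreover have "(r - 1) / \<epsilon>\<^sup>2 \<le> - (1 / \<epsilon>\<^sup>2)" using r divide_right_mono[of "r - 1" "- 1" "\<epsilon>\<^sup>2"] by simp
    ultimately show False using cut by blast
  qed
qed

text \<open>
  In this form every root is evaluated off the negative axis, so \<open>S_sqrt\<close> is holomorphic off the cuts.
\<close>

lemma S_sqrt_eq:
  assumes "z \<notin> branch_cuts \<epsilon>" "0 < \<epsilon>"
  shows "S_sqrt \<epsilon> z = z * csqrt (1 + of_real (\<epsilon>\<^sup>2) / z) * csqrt (1 + of_real (\<epsilon>\<^sup>2) * z)"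
proof -
  have "csqrt (z + of_real (\<epsilon>\<^sup>2)) = csqrt z * csqrt (1 + of_real (\<epsilon>\<^sup>2) / z)"
    by (rule csqrt_add_of_real) (use assms not_in_branch_cuts(2)[OF assms] in auto)
  then have "S_sqrt \<epsilon> z = (csqrt z)\<^sup>2 * csqrt (1 + of_real (\<epsilon>\<^sup>2) / z) * csqrt (1 + of_real (\<epsilon>\<^sup>2) * z)"
    unfolding S_sqrt_def by (simp only: power2_eq_square mult_ac)
  then show ?thesis by simp
qed

lemma S_sqrt_power2: "(S_sqrt \<epsilon> z)\<^sup>2 = z * (z + of_real (\<epsilon>\<^sup>2)) * (1 + of_real (\<epsilon>\<^sup>2) * z)"
  by (simp add: S_sqrt_def power_mult_distrib)

lemma S_sqrt_nonzero:
  assumes "z \<notin> branch_cuts \<epsilon>" "0 < \<epsilon>"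
  shows "S_sqrt \<epsilon> z \<noteq> 0"
  using not_in_branch_cuts[OF assms] unfolding S_sqrt_eq[OF assms] by (auto)

lemma holomorphic_S_sqrt:
  assumes "0 < \<epsilon>"
  shows "S_sqrt \<epsilon> holomorphic_on - branch_cuts \<epsilon>"
proof -
  have "(\<lambda>z. z * csqrt (1 + of_real (\<epsilon>\<^sup>2) / z) * csqrt (1 + of_real (\<epsilon>\<^sup>2) * z)) holomorphic_on - branch_cuts \<epsilon>"
    using not_in_branch_cuts assms by (intro holomorphic_intros) auto
  then show ?thesis
    by (rule holomorphic_transform) (use S_sqrt_eq assms in auto)
qed

lemma discriminant_sqrt_eq:
  assumes "0 < \<epsilon>"
  shows "discriminant_sqrt \<epsilon> z = S_sqrt \<epsilon> z / of_real \<epsilon>"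
proof -
  have "csqrt (z + of_real (1 / \<epsilon>\<^sup>2)) = csqrt (1 + of_real (\<epsilon>\<^sup>2) * z) / of_real \<epsilon>"
  proof (rule csqrt_unique)
    show "(csqrt (1 + of_real (\<epsilon>\<^sup>2) * z) / of_real \<epsilon>)\<^sup>2 = z + of_real (1 / \<epsilon>\<^sup>2)"
      using assms by (simp add: power_divide field_simps)
    show "0 < Re (csqrt (1 + of_real (\<epsilon>\<^sup>2) * z) / of_real \<epsilon>) \<or>
      Re (csqrt (1 + of_real (\<epsilon>\<^sup>2) * z) / of_real \<epsilon>) = 0 \<and>
      0 \<le> Im (csqrt (1 + of_real (\<epsilon>\<^sup>2) * z) / of_real \<epsilon>)"
      using csqrt_principal[of "1 + of_real (\<epsilon>\<^sup>2) * z"] assms by auto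
  qed
  then show ?thesis by (simp add: discriminant_sqrt_def S_sqrt_def)
qed

text \<open>
  The numerator of the large eigenvalue \<open>eig_r1\<close>. It never vanishes, so \<open>rho\<close>, which is the small eigenvalue \<open>eig_r2\<close>, extends
  holomorphically across 1 with a double zero there.
\<close>

definition eig_numerator :: "real \<Rightarrow> complex \<Rightarrow> complex" where
  "eig_numerator \<epsilon> z = (z + 1)\<^sup>2 + 2 * z * of_real (\<epsilon>\<^sup>2 + 1 / \<epsilon>\<^sup>2)
     + 2 * of_real (1 + 1 / \<epsilon>\<^sup>2) * S_sqrt \<epsilon> z"

definition rho :: "real \<Rightarrow> complex \<Rightarrow> complex" where
  "rho \<epsilon> z = (z - 1)\<^sup>2 / eig_numerator \<epsilon> z"

text \<open>
  The product of the two eigenvalues is 1.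
\<close>

lemma eig_numerator_conjugate:
  assumes "0 < \<epsilon>"
  shows "eig_numerator \<epsilon> z * ((z + 1)\<^sup>2 + 2 * z * of_real (\<epsilon>\<^sup>2 + 1 / \<epsilon>\<^sup>2)
     - 2 * of_real (1 + 1 / \<epsilon>\<^sup>2) * S_sqrt \<epsilon> z) = (z - 1) ^ 4"
proof -
  define a :: complex where "a = of_real (\<epsilon>\<^sup>2)"
  have a: "a \<noteq> 0" using assms by (simp add: a_def)
  have r: "of_real (\<epsilon>\<^sup>2 + 1 / \<epsilon>\<^sup>2) = a + 1 / a" "of_real (1 + 1 / \<epsilon>\<^sup>2) = 1 + 1 / a"
    by (simp_all add: a_def)
  have "eig_numerator \<epsilon> z * ((z + 1)\<^sup>2 + 2 * z * of_real (\<epsilon>\<^sup>2 + 1 / \<epsilon>\<^sup>2)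
     - 2 * of_real (1 + 1 / \<epsilon>\<^sup>2) * S_sqrt \<epsilon> z)
    = ((z + 1)\<^sup>2 + 2 * z * (a + 1 / a))\<^sup>2 - (2 * (1 + 1 / a))\<^sup>2 * (S_sqrt \<epsilon> z)\<^sup>2"
    unfolding eig_numerator_def r by (simp add: power2_eq_square algebra_simps)
  also have "\<dots> = ((z + 1)\<^sup>2 + 2 * z * (a + 1 / a))\<^sup>2 - (2 * (1 + 1 / a))\<^sup>2 * (z * (z + a) * (1 + a * z))"
    by (simp add: S_sqrt_power2 a_def)
  also have "\<dots> = (z - 1) ^ 4"
  proof -
    have "(z + 1)\<^sup>2 + 2 * z * (a + 1 / a) = (a * (z + 1)\<^sup>2 + 2 * z * (a * a + 1)) / a"
      "2 * (1 + 1 / a) = 2 * (a + 1) / a"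
      using a by (simp_all add: field_simps)
    moreover have "(a * (z + 1)\<^sup>2 + 2 * z * (a * a + 1))\<^sup>2 - (2 * (a + 1))\<^sup>2 * (z * (z + a) * (1 + a * z))
      = a\<^sup>2 * (z - 1) ^ 4"
      by (simp add: power2_eq_square power4_eq_xxxx algebra_simps)
    ultimately show ?thesis
      using a by (simp only: power_divide times_divide_eq_left diff_divide_distrib[symmetric]) simp
  qed
  finally show ?thesis .
qed

lemma S_sqrt_one: "0 < \<epsilon> \<Longrightarrow> S_sqrt \<epsilon> 1 = of_real (1 + \<epsilon>\<^sup>2)"
  unfolding S_sqrt_def
  by (simp only: csqrt_1 mult_1 mult_1_right power2_eq_square[symmetric] power2_csqrt of_real_add of_real_1)

lemma eig_numerator_nonzero:
  assumes "0 < \<epsilon>"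
  shows "eig_numerator \<epsilon> z \<noteq> 0"
proof (cases "z = 1")
  case True
  have "eig_numerator \<epsilon> z = of_real (4 + 2 * (\<epsilon>\<^sup>2 + 1 / \<epsilon>\<^sup>2) + 2 * (1 + 1 / \<epsilon>\<^sup>2) * (1 + \<epsilon>\<^sup>2))"
    using assms by (simp add: True eig_numerator_def S_sqrt_one)
  moreover have "0 < 4 + 2 * (\<epsilon>\<^sup>2 + 1 / \<epsilon>\<^sup>2) + 2 * (1 + 1 / \<epsilon>\<^sup>2) * (1 + \<epsilon>\<^sup>2)"
    by (intro add_pos_nonneg) (auto intro!: mult_nonneg_nonneg add_nonneg_nonneg)
  ultimately show ?thesis by (metis of_real_eq_0_iff less_irrefl)
next
  case False
  then show ?thesis using eig_numerator_conjugate[OF assms, of z] by auto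
qed

lemma eig_r_eq:
  assumes "0 < \<epsilon>" "z \<noteq> 1"
  shows "eig_r1 \<epsilon> z = inverse (rho \<epsilon> z)" "eig_r2 \<epsilon> z = rho \<epsilon> z" "rho \<epsilon> z \<noteq> 0"
proof -
  have k: "2 * of_real (\<epsilon> + 1 / \<epsilon>) * (S_sqrt \<epsilon> z / of_real \<epsilon>) = 2 * of_real (1 + 1 / \<epsilon>\<^sup>2) * S_sqrt \<epsilon> z"
    using assms by (simp add: field_simps power2_eq_square)
  show "eig_r1 \<epsilon> z = inverse (rho \<epsilon> z)"
    by (simp only: eig_r1_def discriminant_sqrt_eq[OF assms(1)] k) (simp add: rho_def eig_numerator_def)
  show "rho \<epsilon> z \<noteq> 0" using eig_numerator_nonzero[OF assms(1)] assms(2) by (simp add: rho_def)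
  have "eig_r2 \<epsilon> z = ((z + 1)\<^sup>2 + 2 * z * of_real (\<epsilon>\<^sup>2 + 1 / \<epsilon>\<^sup>2)
     - 2 * of_real (1 + 1 / \<epsilon>\<^sup>2) * S_sqrt \<epsilon> z) / (z - 1)\<^sup>2"
    by (simp only: eig_r2_def discriminant_sqrt_eq[OF assms(1)] k)
  also have "\<dots> = rho \<epsilon> z"
  proof -
    have 1: "((z + 1)\<^sup>2 + 2 * z * of_real (\<epsilon>\<^sup>2 + 1 / \<epsilon>\<^sup>2)
     - 2 * of_real (1 + 1 / \<epsilon>\<^sup>2) * S_sqrt \<epsilon> z) = (z - 1) ^ 4 / eig_numerator \<epsilon> z"
      using eig_numerator_conjugate[OF assms(1), of z] eig_numerator_nonzero[OF assms(1), of z]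
      by (simp add: eq_divide_eq mult.commute)
    have 2: "(z - 1) ^ 4 = (z - 1)\<^sup>2 * (z - 1)\<^sup>2" by (simp flip: power_add)
    have 3: "d * d / E / d = d / E" if "d \<noteq> 0" for d E :: complex using that by simp
    show ?thesis unfolding rho_def 1 2 by (rule 3) (use assms(2) in simp)
  qed
  finally show "eig_r2 \<epsilon> z = rho \<epsilon> z" .
qed

text \<open>
  The common traceless part: \<open>phi \<epsilon> z\<close> is a combination of 1 and this matrix, whose square is the scalar \<open>(S_sqrt \<epsilon> z)\<^sup>2\<close>.
\<close>

definition traceless :: "real \<Rightarrow> complex \<Rightarrow> m2" where
  "traceless \<epsilon> z = M2 (z * of_real (\<epsilon>\<^sup>2 - 1)) (of_real (\<epsilon>\<^sup>2) * (z + 1)) (z * (z + 1)) (- z * of_real (\<epsilon>\<^sup>2 - 1))"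

definition pr1 :: "real \<Rightarrow> complex \<Rightarrow> m2" where
  "pr1 \<epsilon> z = sc (1 / 2) + sc (1 / (2 * S_sqrt \<epsilon> z)) * traceless \<epsilon> z"

definition pr2 :: "real \<Rightarrow> complex \<Rightarrow> m2" where
  "pr2 \<epsilon> z = 1 - pr1 \<epsilon> z"

lemma proj_F_eq_to_mat: "proj_F1 \<epsilon> z = to_mat (pr1 \<epsilon> z)" "proj_F2 \<epsilon> z = to_mat (pr2 \<epsilon> z)"
proof -
  show 1: "proj_F1 \<epsilon> z = to_mat (pr1 \<epsilon> z)"
    unfolding proj_F1_def pr1_def traceless_def
    by (simp only: to_mat_rows to_mat_one to_mat_smult to_mat_add mult_1_right)
  show "proj_F2 \<epsilon> z = to_mat (pr2 \<epsilon> z)"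
    unfolding proj_F2_def pr2_def 1 by (simp only: to_mat_one to_mat_minus)
qed

lemma traceless_square: "traceless \<epsilon> z * traceless \<epsilon> z = sc ((S_sqrt \<epsilon> z)\<^sup>2)"
  unfolding S_sqrt_power2 traceless_def
  by (simp add: m2_defs sc_def algebra_simps power2_eq_square)

lemma pr1_idem:
  assumes "z \<notin> branch_cuts \<epsilon>" "0 < \<epsilon>"
  shows "pr1 \<epsilon> z * pr1 \<epsilon> z = pr1 \<epsilon> z"
proof -
  let ?k = "1 / (2 * S_sqrt \<epsilon> z)"
  define Y where "Y = sc ?k * traceless \<epsilon> z"
  have "Y * Y = sc ?k * (traceless \<epsilon> z * (sc ?k * traceless \<epsilon> z))" by (simp add: Y_def mult.assoc)
  also have "\<dots> = sc ?k * (sc ?k * (traceless \<epsilon> z * traceless \<epsilon> z))" by (subst sc_left_commute) simp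
  also have "\<dots> = sc (?k * (?k * (S_sqrt \<epsilon> z)\<^sup>2))" unfolding traceless_square by (simp only: sc_simps)
  also have "?k * (?k * (S_sqrt \<epsilon> z)\<^sup>2) = 1 / 4"
    using S_sqrt_nonzero[OF assms] by (simp add: power2_eq_square)
  finally have YY: "Y * Y = sc (1 / 4)" .
  have "(sc (1/2) + Y) * (sc (1/2) + Y) = sc (1/2) * sc (1/2) + Y * Y + (sc (1/2) * Y + Y * sc (1/2))"
    by (simp add: distrib_left distrib_right)
  also have "\<dots> = sc (1/2 * (1/2) + 1/4) + sc (1/2 + 1/2) * Y"
    by (simp only: YY sc_commute[of Y] sc_simps distrib_right)
  also have "\<dots> = sc (1/2) + Y" by (simp add: sc_simps)
  finally show ?thesis by (simp add: pr1_def Y_def)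
qed

lemma pr_orthogonal:
  assumes "z \<notin> branch_cuts \<epsilon>" "0 < \<epsilon>"
  shows "pr1 \<epsilon> z * pr2 \<epsilon> z = 0" "pr2 \<epsilon> z * pr1 \<epsilon> z = 0" "pr2 \<epsilon> z * pr2 \<epsilon> z = pr2 \<epsilon> z"
  using pr1_idem[OF assms] by (simp_all add: pr2_def algebra_simps)

lemma phi_spectral:
  assumes "z \<notin> branch_cuts \<epsilon>" "0 < \<epsilon>" "z \<noteq> 1"
  shows "phi \<epsilon> z = sc (inverse (rho \<epsilon> z)) * pr1 \<epsilon> z + sc (rho \<epsilon> z) * pr2 \<epsilon> z"
proof -
  let ?S = "S_sqrt \<epsilon> z" and ?X = "traceless \<epsilon> z"
  define a :: complex where "a = of_real (\<epsilon>\<^sup>2)"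
  have a: "a \<noteq> 0" using assms by (simp add: a_def)
  define q where "q = (z + 1)\<^sup>2 + 2 * z * (a + 1 / a)"
  define k where "k = 2 * (1 + 1 / a)"
  have r1: "inverse (rho \<epsilon> z) = (q + k * ?S) / (z - 1)\<^sup>2" and r2: "rho \<epsilon> z = (q - k * ?S) / (z - 1)\<^sup>2"
  proof -
    show "inverse (rho \<epsilon> z) = (q + k * ?S) / (z - 1)\<^sup>2"
      by (simp add: rho_def eig_numerator_def q_def k_def a_def)
    have 1: "(q + k * ?S) * (q - k * ?S) = (z - 1) ^ 4"
      using eig_numerator_conjugate[OF assms(2), of z] by (simp add: eig_numerator_def q_def k_def a_def)
    have 2: "(z - 1) ^ 4 = (z - 1)\<^sup>2 * (z - 1)\<^sup>2" by (simp flip: power_add)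
    have 3: "q + k * ?S \<noteq> 0"
      using eig_numerator_nonzero[OF assms(2), of z] by (simp add: eig_numerator_def q_def k_def a_def)
      have "rho \<epsilon> z = (z - 1)\<^sup>2 / (q + k * ?S)"
        by (simp add: rho_def eig_numerator_def q_def k_def a_def)
      also have "\<dots> = (q - k * ?S) / (z - 1)\<^sup>2"
      proof -
        have "d / A = B / d" if "A * B = d * d" "A \<noteq> 0" "d \<noteq> 0" for A B d :: complex
          using that by (simp add: frac_eq_eq mult.commute)
        then show ?thesis using 1[unfolded 2] 3 assms(3) by simp
      qed
      finally show "rho \<epsilon> z = (q - k * ?S) / (z - 1)\<^sup>2" .
  qed
  have "phi \<epsilon> z = sc (1 / (z - 1)\<^sup>2) * (sc q + sc k * ?X)"
  proof -
    have "M2 (1 + z) (of_real (2 * \<epsilon>\<^sup>2)) (of_real (2 / \<epsilon>\<^sup>2) * z) (1 + z) * M2 (1 + z) (of_real (2 * 1\<^sup>2)) (of_real (2 / 1\<^sup>2) * z) (1 + z)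
      = sc q + sc k * ?X"
    proof -
      have 1: "of_real (2 * \<epsilon>\<^sup>2) = 2 * a" "of_real (2 / \<epsilon>\<^sup>2) = 2 * (1 / a)"
        "of_real (2 * 1\<^sup>2) = (2 :: complex)" "of_real (2 / 1\<^sup>2) = (2 :: complex)"
        "of_real (\<epsilon>\<^sup>2 - 1) = a - 1" "of_real (\<epsilon>\<^sup>2) = a" by (simp_all add: a_def)
      define b where "b = 1 / a"
      have ab: "a * b = 1" "a * (b * x) = x" for x using a by (simp_all add: b_def)
      show ?thesis
        unfolding 1 q_def k_def traceless_def b_def[symmetric]
        by (simp add: m2_defs sc_def power2_eq_square algebra_simps ab)
    qed
    then show ?thesis
      unfolding phi_def step_def by (simp only: mult.assoc sc_left_commute[of "M2 _ _ _ _"])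
        (simp add: sc_simps[symmetric] mult.assoc[symmetric] power2_eq_square)
  qed
  also have "?X = sc ?S * (pr1 \<epsilon> z - pr2 \<epsilon> z)"
  proof -
    have "pr1 \<epsilon> z - pr2 \<epsilon> z = sc (1 / ?S) * ?X"
      by (simp add: pr2_def pr1_def m2_eq_iff m2_defs sc_def)
    then show ?thesis
      using S_sqrt_nonzero[OF assms(1,2)] by (simp add: mult.assoc[symmetric] sc_simps(4)[symmetric] sc_simps(1))
  qed
  also have "sc (1 / (z - 1)\<^sup>2) * (sc q + sc k * (sc ?S * (pr1 \<epsilon> z - pr2 \<epsilon> z)))
    = sc (inverse (rho \<epsilon> z)) * pr1 \<epsilon> z + sc (rho \<epsilon> z) * pr2 \<epsilon> z"
  proof -
    have "sc d * (sc q + sc k * (sc S * (P - (1 - P)))) = sc ((q + k * S) * d) * P + sc ((q - k * S) * d) * (1 - P)"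
      for d q k S :: complex and P
      by (simp add: m2_eq_iff m2_defs sc_def algebra_simps)
    moreover have "inverse (rho \<epsilon> z) = (q + k * ?S) * (1 / (z - 1)\<^sup>2)" "rho \<epsilon> z = (q - k * ?S) * (1 / (z - 1)\<^sup>2)"
      by (simp add: r1) (simp add: r2)
    ultimately show ?thesis by (simp only: pr2_def)
  qed
  finally show ?thesis .
qed

text \<open>
  A matrix of rank one compresses every matrix to a multiple of itself, the factor being a trace.
\<close>

lemma compression_rank_one:
  assumes "e00 P * e11 P = e01 P * e10 P"
  shows "P * A * P = sc (e00 (A * P) + e11 (A * P)) * P"
proof -
  obtain p q r s where P: "P = M2 p q r s" by (cases P)
  obtain a b c d where A: "A = M2 a b c d" by (cases A)
  have h: "p * s = q * r" using assms by (simp add: P)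
  let ?t = "a * p + b * r + (c * q + d * s)"
  have d1: "(p * a + q * c) * p + (p * b + q * d) * r - ?t * p = - d * (p * s - q * r)"
    by (simp add: algebra_simps)
  have d2: "(p * a + q * c) * q + (p * b + q * d) * s - ?t * q = b * (p * s - q * r)"
    by (simp add: algebra_simps)
  have d3: "(r * a + s * c) * p + (r * b + s * d) * r - ?t * r = c * (p * s - q * r)"
    by (simp add: algebra_simps)
  have d4: "(r * a + s * c) * q + (r * b + s * d) * s - ?t * s = - a * (p * s - q * r)"
    by (simp add: algebra_simps)
  have "(p * a + q * c) * p + (p * b + q * d) * r = ?t * p"
    using d1 unfolding h by simp
  moreover have "(p * a + q * c) * q + (p * b + q * d) * s = ?t * q"
    using d2 unfolding h by simp
  moreover have "(r * a + s * c) * p + (r * b + s * d) * r = ?t * r"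
    using d3 unfolding h by simp
  moreover have "(r * a + s * c) * q + (r * b + s * d) * s = ?t * s"
    using d4 unfolding h by simp
  ultimately show ?thesis unfolding P A by (simp add: m2_defs sc_def)
qed

definition pr_trace :: "real \<Rightarrow> real \<Rightarrow> complex \<Rightarrow> complex" where
  "pr_trace \<alpha> \<beta> z = e00 (pr1 \<alpha> z * pr1 \<beta> z) + e11 (pr1 \<alpha> z * pr1 \<beta> z)"

lemma pr1_det:
  assumes "z \<notin> branch_cuts \<epsilon>" "0 < \<epsilon>"
  shows "e00 (pr1 \<epsilon> z) * e11 (pr1 \<epsilon> z) = e01 (pr1 \<epsilon> z) * e10 (pr1 \<epsilon> z)"
proof -
  define k where "k = 1 / (2 * S_sqrt \<epsilon> z)"
  define x y u where "x = z * of_real (\<epsilon>\<^sup>2 - 1)" and "y = of_real (\<epsilon>\<^sup>2) * (z + 1)" and "u = z * (z + 1)"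
  have X: "traceless \<epsilon> z = M2 x y u (- x)" by (simp add: traceless_def x_def y_def u_def)
  have "x * x + y * u = (S_sqrt \<epsilon> z)\<^sup>2"
    using traceless_square[of \<epsilon> z] unfolding X by (simp add: m2_defs sc_def)
  moreover have "k * k * (S_sqrt \<epsilon> z)\<^sup>2 = 1 / 4"
    using S_sqrt_nonzero[OF assms] by (simp add: k_def power2_eq_square)
  ultimately have "k * k * (x * x + y * u) = 1 / 4" by simp
  then show ?thesis
    unfolding pr1_def X k_def[symmetric] by (simp add: m2_defs sc_def algebra_simps)
qed

lemma pr_trace_eq:
  assumes "z \<notin> branch_cuts \<alpha>" "0 < \<alpha>" "z \<notin> branch_cuts \<beta>" "0 < \<beta>"
  shows "pr_trace \<alpha> \<beta> z = 1 / 2 + g_fun \<alpha> \<beta> z"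
proof -
  define a b :: complex where "a = of_real (\<alpha>\<^sup>2)" and "b = of_real (\<beta>\<^sup>2)"
  let ?S = "S_sqrt \<alpha> z" and ?R = "S_sqrt \<beta> z"
  let ?n = "2 * z * (1 + a * b) + (a + b) * (z\<^sup>2 + 1)"
  have nz: "?S \<noteq> 0" "?R \<noteq> 0" "z \<noteq> 0"
    using S_sqrt_nonzero assms not_in_branch_cuts(1)[OF assms(1,2)] by auto
  have tr: "pr_trace \<alpha> \<beta> z = 1 / 2 + 1 / (4 * ?S * ?R) * (z * ?n)"
  proof -
    define k l where "k = 1 / (2 * ?S)" and "l = 1 / (2 * ?R)"
    have kl: "1 / (4 * ?S * ?R) = k * l" by (simp add: k_def l_def)
    have X: "traceless \<alpha> z = M2 (z * (a - 1)) (a * (z + 1)) (z * (z + 1)) (- z * (a - 1))"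
      "traceless \<beta> z = M2 (z * (b - 1)) (b * (z + 1)) (z * (z + 1)) (- z * (b - 1))"
      by (simp_all add: traceless_def a_def b_def)
    show ?thesis
      unfolding pr_trace_def pr1_def k_def[symmetric] l_def[symmetric] kl X
      by (simp add: m2_defs sc_def algebra_simps power2_eq_square)
  qed
  have "csqrt (z + a) = csqrt z * csqrt (1 + a / z)" "csqrt (z + b) = csqrt z * csqrt (1 + b / z)"
    unfolding a_def b_def
    by (rule csqrt_add_of_real; use assms not_in_branch_cuts(2) in simp)+
  then have "csqrt (z + a) * csqrt (1 + a * z) * csqrt (z + b) * csqrt (1 + b * z)
    = (csqrt z)\<^sup>2 * csqrt (1 + a / z) * csqrt (1 + a * z) * csqrt (1 + b / z) * csqrt (1 + b * z)"
    by (simp only: power2_eq_square mult_ac)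
  also have "\<dots> = ?S * ?R / z"
    unfolding S_sqrt_eq[OF assms(1,2)] S_sqrt_eq[OF assms(3,4)] a_def[symmetric] b_def[symmetric]
      power2_csqrt
    using nz(3) by simp
  finally have D: "csqrt (z + a) * csqrt (1 + a * z) * csqrt (z + b) * csqrt (1 + b * z) = ?S * ?R / z" .
  have n: "2 * z * of_real (1 + \<alpha>\<^sup>2 * \<beta>\<^sup>2) + of_real (\<alpha>\<^sup>2 + \<beta>\<^sup>2) * (z\<^sup>2 + 1) = ?n"
    by (simp add: a_def b_def)
  have "g_fun \<alpha> \<beta> z = ?n / (4 * (?S * ?R / z))"
    unfolding g_fun_def n a_def[symmetric] b_def[symmetric] D ..
  also have "\<dots> = 1 / (4 * ?S * ?R) * (z * ?n)" using nz by (simp add: mult_ac)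
  finally show ?thesis unfolding tr by simp
qed

lemma S_sqrt_minus_one:
  assumes "0 < \<epsilon>" "\<epsilon> < 1"
  shows "- 1 \<notin> branch_cuts \<epsilon>" "S_sqrt \<epsilon> (- 1) = of_real (- (1 - \<epsilon>\<^sup>2))"
proof -
  have e: "\<epsilon>\<^sup>2 < 1" "1 < 1 / \<epsilon>\<^sup>2" using assms by (simp_all add: power_less_one_iff abs_square_less_1)
  show c: "- 1 \<notin> branch_cuts \<epsilon>"
  proof
    assume "- 1 \<in> branch_cuts \<epsilon>"
    then obtain x where x: "- 1 = complex_of_real x" "x \<le> - (1 / \<epsilon>\<^sup>2) \<or> - (\<epsilon>\<^sup>2) \<le> x"
      unfolding branch_cuts_def by auto
    have "x = - 1" using x(1) by (metis of_real_1 of_real_eq_iff of_real_minus)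
    then show False using x(2) e by auto
  qed
  have "S_sqrt \<epsilon> (- 1) = - (csqrt (1 - of_real (\<epsilon>\<^sup>2)) * csqrt (1 - of_real (\<epsilon>\<^sup>2)))"
    unfolding S_sqrt_eq[OF c assms(1)] by simp
  also have "\<dots> = of_real (- (1 - \<epsilon>\<^sup>2))"
    unfolding power2_eq_square[of "csqrt _", symmetric] power2_csqrt by simp
  finally show "S_sqrt \<epsilon> (- 1) = of_real (- (1 - \<epsilon>\<^sup>2))" .
qed

text \<open>
  If the trace vanishes at \<open>z\<close>, the numerator of \<open>g_fun\<close> is \<open>-2\<close> times the square root in its denominator. The numerator
  squared minus four times the radicand is \<open>(\<alpha>\<^sup>2 - \<beta>\<^sup>2)\<^sup>2 (z\<^sup>2 - 1)\<^sup>2\<close>, so either \<open>\<alpha> = \<beta>\<close> or \<open>z\<close> is 1 or -1, and in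
  these cases the signs of the roots are known and exclude it.
\<close>

lemma pr_trace_nonzero:
  assumes \<alpha>: "0 < \<alpha>" "\<alpha> < 1" and \<beta>: "0 < \<beta>" "\<beta> < 1"
    and z: "z \<notin> branch_cuts \<alpha>" "z \<notin> branch_cuts \<beta>"
  shows "pr_trace \<alpha> \<beta> z \<noteq> 0"
proof
  assume zero: "pr_trace \<alpha> \<beta> z = 0"
  define a b :: complex where "a = of_real (\<alpha>\<^sup>2)" and "b = of_real (\<beta>\<^sup>2)"
  define n where "n = 2 * z * (1 + a * b) + (a + b) * (z\<^sup>2 + 1)"
  define SR where "SR = S_sqrt \<alpha> z * S_sqrt \<beta> z"
  have nz: "SR \<noteq> 0" "z \<noteq> 0"
    using S_sqrt_nonzero z \<alpha> \<beta> not_in_branch_cuts(1) by (auto simp: SR_def)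
  have tr: "pr_trace \<alpha> \<beta> z = 1 / 2 + z * n / (4 * SR)"
  proof -
    define k l where "k = 1 / (2 * S_sqrt \<alpha> z)" and "l = 1 / (2 * S_sqrt \<beta> z)"
    have X: "traceless \<alpha> z = M2 (z * (a - 1)) (a * (z + 1)) (z * (z + 1)) (- z * (a - 1))"
      "traceless \<beta> z = M2 (z * (b - 1)) (b * (z + 1)) (z * (z + 1)) (- z * (b - 1))"
      by (simp_all add: traceless_def a_def b_def)
    have "pr_trace \<alpha> \<beta> z = 1 / 2 + k * l * (z * n)"
      unfolding pr_trace_def pr1_def k_def[symmetric] l_def[symmetric] X n_def
      by (simp add: m2_defs sc_def algebra_simps power2_eq_square)
    also have "k * l * (z * n) = z * n / (4 * SR)" by (simp add: k_def l_def SR_def)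
    finally show ?thesis .
  qed
  have eq: "z * n = - 2 * SR"
  proof -
    have "(1 / 2 + z * n / (4 * SR)) * (4 * SR) = 2 * SR + z * n" using nz by (simp add: distrib_right)
    then have "2 * SR + z * n = 0" using zero unfolding tr by simp
    then show ?thesis by (metis add_eq_0_iff mult_minus_left)
  qed
  have "z\<^sup>2 * n\<^sup>2 = 4 * ((S_sqrt \<alpha> z)\<^sup>2 * (S_sqrt \<beta> z)\<^sup>2)"
    using arg_cong[OF eq, of "\<lambda>x. x\<^sup>2"] by (simp add: power_mult_distrib SR_def)
  also have "\<dots> = z\<^sup>2 * (4 * ((z + a) * (1 + a * z) * (z + b) * (1 + b * z)))"
    unfolding S_sqrt_power2 a_def[symmetric] b_def[symmetric] by (simp add: power2_eq_square)
  finally have "n\<^sup>2 - 4 * ((z + a) * (1 + a * z) * (z + b) * (1 + b * z)) = 0" using nz by simp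
  moreover have "n\<^sup>2 - 4 * ((z + a) * (1 + a * z) * (z + b) * (1 + b * z)) = (a - b)\<^sup>2 * (z\<^sup>2 - 1)\<^sup>2"
    unfolding n_def by (simp add: power2_eq_square algebra_simps)
  ultimately have "a = b \<or> z\<^sup>2 = 1" by simp
  then consider "a = b" | "z = 1" | "z = - 1" using power2_eq_1_iff by blast
  then show False
  proof cases
    case 1
    then have "\<alpha> = \<beta>" using \<alpha> \<beta> by (simp add: a_def b_def power2_eq_iff flip: of_real_power)
    then have "SR = z * ((z + a) * (1 + a * z))"
      by (simp add: SR_def power2_eq_square[symmetric] S_sqrt_power2 a_def)
    moreover have "n = 2 * ((z + a) * (1 + a * z))"
      unfolding n_def 1[symmetric] by (simp add: power2_eq_square algebra_simps)
    ultimately have "z * n = 2 * SR" by simp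
    then show False using eq nz by simp
  next
    case 2
    have "of_real (4 * (1 + \<alpha>\<^sup>2) * (1 + \<beta>\<^sup>2)) = (0 :: complex)"
      using eq unfolding SR_def n_def a_def b_def 2 S_sqrt_one[OF \<alpha>(1)] S_sqrt_one[OF \<beta>(1)]
      by (simp add: algebra_simps add_eq_0_iff2)
    then have "4 * (1 + \<alpha>\<^sup>2) * (1 + \<beta>\<^sup>2) = 0" by (simp only: of_real_eq_0_iff)
    moreover have "0 < 4 * (1 + \<alpha>\<^sup>2) * (1 + \<beta>\<^sup>2)" by (intro mult_pos_pos) (auto intro: add_pos_nonneg)
    ultimately show False by linarith
  next
    case 3
    have "n = - 2 * ((1 - a) * (1 - b))"
      unfolding n_def 3 by (simp add: algebra_simps)
    moreover have "SR = (1 - a) * (1 - b)"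
      unfolding SR_def 3 S_sqrt_minus_one(2)[OF \<alpha>] S_sqrt_minus_one(2)[OF \<beta>] a_def b_def
      by (simp add: algebra_simps)
    ultimately have "z * n = 2 * SR" by (simp add: 3)
    then show False using eq nz by simp
  qed
qed

lemma c_fun_eq:
  assumes "0 < \<alpha>" "\<alpha> < 1" "0 < \<beta>" "\<beta> < 1" "z \<notin> branch_cuts \<alpha>" "z \<notin> branch_cuts \<beta>"
  shows "c_fun \<alpha> \<beta> z = inverse (pr_trace \<alpha> \<beta> z)"
proof -
  have "pr_trace \<alpha> \<beta> z = (1 + 2 * g_fun \<alpha> \<beta> z) / 2"
    by (subst pr_trace_eq) (use assms in \<open>auto simp: add_divide_distrib\<close>)
  then have "1 + 2 * g_fun \<alpha> \<beta> z = 2 * pr_trace \<alpha> \<beta> z" by (simp add: mult.commute)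
  then show ?thesis by (simp add: c_fun_def inverse_eq_divide)
qed

text \<open>
  The function \<open>c\<close> is the reciprocal of the trace of \<open>F\<^sub>\<alpha>\<^sub>,\<^sub>1 F\<^sub>\<beta>\<^sub>,\<^sub>1\<close>. This identity is what makes the
  formula consistent across the interface between the two weights.
\<close>

lemma c_fun_compression:
  assumes "0 < \<alpha>" "\<alpha> < 1" "0 < \<beta>" "\<beta> < 1" "z \<notin> branch_cuts \<alpha>" "z \<notin> branch_cuts \<beta>"
  shows "sc (c_fun \<alpha> \<beta> z) * (pr1 \<beta> z * pr1 \<alpha> z * pr1 \<beta> z) = pr1 \<beta> z"
proof -
  have "pr1 \<beta> z * pr1 \<alpha> z * pr1 \<beta> z = sc (pr_trace \<alpha> \<beta> z) * pr1 \<beta> z"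
    unfolding pr_trace_def by (rule compression_rank_one) (use pr1_det assms in blast)
  then have "sc (c_fun \<alpha> \<beta> z) * (pr1 \<beta> z * pr1 \<alpha> z * pr1 \<beta> z)
    = sc (c_fun \<alpha> \<beta> z * pr_trace \<alpha> \<beta> z) * pr1 \<beta> z"
    by (simp add: sc_simps mult.assoc)
  also have "c_fun \<alpha> \<beta> z * pr_trace \<alpha> \<beta> z = 1"
    using c_fun_eq[OF assms] pr_trace_nonzero[OF assms] by simp
  finally show ?thesis by (simp add: sc_simps)
qed

section \<open>Regularity at 1\<close>

definition holomorphic_m2 :: "(complex \<Rightarrow> m2) \<Rightarrow> complex set \<Rightarrow> bool" where
  "holomorphic_m2 g U \<longleftrightarrow> (\<forall>i j. (\<lambda>w. ent (g w) i j) holomorphic_on U)"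

text \<open>
  Holomorphic after removal of a possible singularity at 1. The value of \<open>h\<close> at 1 is left free because the expressions to which this is
  applied contain divisions by \<open>w - 1\<close>, which have arbitrary default values there.
\<close>

definition regular :: "complex set \<Rightarrow> (complex \<Rightarrow> m2) \<Rightarrow> bool" where
  "regular U h \<longleftrightarrow> (\<exists>g. holomorphic_m2 g U \<and> (\<forall>w\<in>U - {1}. h w = g w))"

lemma regular_cong:
  assumes "regular U h'" "\<And>w. w \<in> U - {1} \<Longrightarrow> h w = h' w"
  shows "regular U h"
  using assms unfolding regular_def by auto

lemma holomorphic_m2_M2:
  assumes "a holomorphic_on U" "b holomorphic_on U" "c holomorphic_on U" "d holomorphic_on U"
  shows "holomorphic_m2 (\<lambda>w. M2 (a w) (b w) (c w) (d w)) U"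
  unfolding holomorphic_m2_def ent_M2
proof (intro allI)
  fix i j :: nat
  show "(\<lambda>z. if i = 0 then if j = 0 then a z else b z else if j = 0 then c z else d z) holomorphic_on U"
    using assms by (cases "i = 0"; cases "j = 0") simp_all
qed

lemma holomorphic_m2_sc: "f holomorphic_on U \<Longrightarrow> holomorphic_m2 (\<lambda>w. sc (f w)) U"
  unfolding sc_def by (intro holomorphic_m2_M2 holomorphic_on_const)

lemma regular_holomorphic: "holomorphic_m2 g U \<Longrightarrow> regular U g"
  unfolding regular_def by blast

lemma regular_mult:
  assumes "regular U f" "regular U g"
  shows "regular U (\<lambda>w. f w * g w)"
proof -
  obtain f' g' where *: "holomorphic_m2 f' U" "holomorphic_m2 g' U"
    "\<forall>w\<in>U - {1}. f w = f' w" "\<forall>w\<in>U - {1}. g w = g' w"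
    using assms unfolding regular_def by auto
  have "holomorphic_m2 (\<lambda>w. f' w * g' w) U"
    using *(1,2) unfolding holomorphic_m2_def ent_simps by (auto intro!: holomorphic_intros)
  then show ?thesis unfolding regular_def using *(3,4) by (intro exI[of _ "\<lambda>w. f' w * g' w"]) auto
qed

lemma regular_add:
  assumes "regular U f" "regular U g"
  shows "regular U (\<lambda>w. f w + g w)"
proof -
  obtain f' g' where *: "holomorphic_m2 f' U" "holomorphic_m2 g' U"
    "\<forall>w\<in>U - {1}. f w = f' w" "\<forall>w\<in>U - {1}. g w = g' w"
    using assms unfolding regular_def by auto
  have "holomorphic_m2 (\<lambda>w. f' w + g' w) U"
    using *(1,2) unfolding holomorphic_m2_def ent_simps by (auto intro!: holomorphic_intros)
  then show ?thesis unfolding regular_def using *(3,4) by (intro exI[of _ "\<lambda>w. f' w + g' w"]) auto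
qed

lemma regular_diff:
  assumes "regular U f" "regular U g"
  shows "regular U (\<lambda>w. f w - g w)"
proof -
  obtain f' g' where *: "holomorphic_m2 f' U" "holomorphic_m2 g' U"
    "\<forall>w\<in>U - {1}. f w = f' w" "\<forall>w\<in>U - {1}. g w = g' w"
    using assms unfolding regular_def by auto
  have "holomorphic_m2 (\<lambda>w. f' w - g' w) U"
    using *(1,2) unfolding holomorphic_m2_def ent_simps by (auto intro!: holomorphic_intros)
  then show ?thesis unfolding regular_def using *(3,4) by (intro exI[of _ "\<lambda>w. f' w - g' w"]) auto
qed

lemma regular_one: "regular U (\<lambda>w. 1)"
  by (rule regular_holomorphic) (auto simp: holomorphic_m2_def one_m2_def ent_M2)

lemma regular_sc: "f holomorphic_on U \<Longrightarrow> regular U (\<lambda>w. sc (f w))"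
  by (intro regular_holomorphic holomorphic_m2_sc)

lemma holomorphic_eig_numerator:
  assumes "0 < \<epsilon>" "U \<inter> branch_cuts \<epsilon> = {}"
  shows "eig_numerator \<epsilon> holomorphic_on U"
proof -
  have "S_sqrt \<epsilon> holomorphic_on U"
    by (rule holomorphic_on_subset[OF holomorphic_S_sqrt[OF assms(1)]]) (use assms(2) in auto)
  then show ?thesis unfolding eig_numerator_def by (intro holomorphic_intros)
qed

lemma holomorphic_rho:
  assumes "0 < \<epsilon>" "U \<inter> branch_cuts \<epsilon> = {}"
  shows "rho \<epsilon> holomorphic_on U"
  unfolding rho_def using eig_numerator_nonzero[OF assms(1)]
  by (intro holomorphic_intros holomorphic_eig_numerator assms) auto

lemma holomorphic_pr1:
  assumes "0 < \<epsilon>" "U \<inter> branch_cuts \<epsilon> = {}"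
  shows "holomorphic_m2 (pr1 \<epsilon>) U"
proof -
  have S: "S_sqrt \<epsilon> holomorphic_on U"
    by (rule holomorphic_on_subset[OF holomorphic_S_sqrt[OF assms(1)]]) (use assms(2) in auto)
  have "S_sqrt \<epsilon> w \<noteq> 0" if "w \<in> U" for w
    using S_sqrt_nonzero[of w \<epsilon>] assms that by auto
  then show ?thesis
    unfolding holomorphic_m2_def pr1_def ent_simps traceless_def sc_def ent_M2
    by (auto intro!: holomorphic_intros S)
qed

lemma regular_pr1:
  assumes "0 < \<epsilon>" "U \<inter> branch_cuts \<epsilon> = {}"
  shows "regular U (pr1 \<epsilon>)"
  using holomorphic_pr1[OF assms] by (rule regular_holomorphic)

lemma regular_pr2:
  assumes "0 < \<epsilon>" "U \<inter> branch_cuts \<epsilon> = {}"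
  shows "regular U (pr2 \<epsilon>)"
  unfolding pr2_def by (intro regular_diff regular_one regular_pr1 assms)

lemma holomorphic_c_fun:
  assumes "0 < \<alpha>" "\<alpha> < 1" "0 < \<beta>" "\<beta> < 1" "U \<inter> branch_cuts \<alpha> = {}" "U \<inter> branch_cuts \<beta> = {}"
  shows "c_fun \<alpha> \<beta> holomorphic_on U"
proof -
  have cut: "w \<notin> branch_cuts \<alpha>" "w \<notin> branch_cuts \<beta>" if "w \<in> U" for w using assms that by auto
  have "(\<lambda>w. ent (pr1 \<alpha> w) i j) holomorphic_on U" "(\<lambda>w. ent (pr1 \<beta> w) i j) holomorphic_on U" for i j
    using holomorphic_pr1 assms unfolding holomorphic_m2_def by blast+
  then have "(\<lambda>w. ent (pr1 \<alpha> w * pr1 \<beta> w) 0 0 + ent (pr1 \<alpha> w * pr1 \<beta> w) 1 1) holomorphic_on U"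
    unfolding ent_simps by (intro holomorphic_intros)
  then have "pr_trace \<alpha> \<beta> holomorphic_on U"
    by (simp add: pr_trace_def[abs_def] ent_def)
  then have "(\<lambda>w. inverse (pr_trace \<alpha> \<beta> w)) holomorphic_on U"
    using pr_trace_nonzero[OF assms(1-4)] cut by (intro holomorphic_intros) auto
  then show ?thesis
    by (rule holomorphic_transform) (use c_fun_eq[OF assms(1-4)] cut in auto)
qed

text \<open>
  A half step has a simple pole at 1 and \<open>rho\<close> a double zero.
\<close>

lemma regular_rho_step:
  assumes "0 < \<epsilon>" "U \<inter> branch_cuts \<epsilon> = {}"
  shows "regular U (\<lambda>w. sc (rho \<epsilon> w) * step e w)" "regular U (\<lambda>w. sc (rho \<epsilon> w) * unstep e w)"
proof -
  have h: "(\<lambda>w. (w - 1) / eig_numerator \<epsilon> w) holomorphic_on U"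
    using eig_numerator_nonzero[OF assms(1)]
    by (intro holomorphic_intros holomorphic_eig_numerator assms) auto
  have eq: "sc (rho \<epsilon> w) * (sc (1 / (w - 1)) * A) = sc ((w - 1) / eig_numerator \<epsilon> w) * A" if "w \<noteq> 1" for w A
  proof -
    have "rho \<epsilon> w * (1 / (w - 1)) = (w - 1) / eig_numerator \<epsilon> w"
      using that by (simp add: rho_def power2_eq_square)
    then show ?thesis by (metis mult.assoc sc_simps(4))
  qed
  have M: "regular U (\<lambda>w. M2 (1 + w) a (b * w) (1 + w))" for a b
    by (intro regular_holomorphic holomorphic_m2_M2 holomorphic_intros)
  show "regular U (\<lambda>w. sc (rho \<epsilon> w) * step e w)"
    by (rule regular_cong[OF regular_mult[OF regular_sc[OF h] M[of "of_real (2 * e\<^sup>2)" "of_real (2 / e\<^sup>2)"]]])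
      (simp add: step_def eq)
  show "regular U (\<lambda>w. sc (rho \<epsilon> w) * unstep e w)"
    by (rule regular_cong[OF regular_mult[OF regular_sc[OF h] M[of "- of_real (2 * e\<^sup>2)" "- of_real (2 / e\<^sup>2)"]]])
      (simp add: unstep_def eq)
qed

lemma pr_phi:
  assumes "z \<notin> branch_cuts \<epsilon>" "0 < \<epsilon>" "z \<noteq> 1"
  shows "pr1 \<epsilon> z * phi \<epsilon> z = sc (inverse (rho \<epsilon> z)) * pr1 \<epsilon> z" (is ?a)
    and "pr2 \<epsilon> z * phi \<epsilon> z = sc (rho \<epsilon> z) * pr2 \<epsilon> z" (is ?b)
    and "pr1 \<epsilon> z * phi_inv \<epsilon> z = sc (rho \<epsilon> z) * pr1 \<epsilon> z" (is ?c)
    and "pr2 \<epsilon> z * phi_inv \<epsilon> z = sc (inverse (rho \<epsilon> z)) * pr2 \<epsilon> z" (is ?d)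
proof -
  have rho0: "rho \<epsilon> z \<noteq> 0" using eig_r_eq(3) assms by blast
  have rr: "sc (rho \<epsilon> z) * sc (inverse (rho \<epsilon> z)) = 1" "sc (inverse (rho \<epsilon> z)) * sc (rho \<epsilon> z) = 1"
    using rho0 by (simp_all add: sc_simps(4)[symmetric] sc_simps(1))
  show a: ?a
    unfolding phi_spectral[OF assms] distrib_left sc_left_commute pr1_idem[OF assms(1,2)] pr_orthogonal[OF assms(1,2)]
    by simp
  show b: ?b
    unfolding phi_spectral[OF assms] distrib_left sc_left_commute pr_orthogonal[OF assms(1,2)]
    by simp
  have inv: "phi \<epsilon> z * phi_inv \<epsilon> z = 1" using phi_inverse(1)[of z \<epsilon>] assms by simp
  have "sc (rho \<epsilon> z) * (pr1 \<epsilon> z * phi \<epsilon> z) * phi_inv \<epsilon> z = pr1 \<epsilon> z * phi_inv \<epsilon> z"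
    unfolding a by (simp only: mult.assoc[symmetric] rr mult_1)
  then show ?c by (simp add: mult.assoc inv)
  have "sc (inverse (rho \<epsilon> z)) * (pr2 \<epsilon> z * phi \<epsilon> z) * phi_inv \<epsilon> z = pr2 \<epsilon> z * phi_inv \<epsilon> z"
    unfolding b by (simp only: mult.assoc[symmetric] rr mult_1)
  then show ?d by (simp add: mult.assoc inv)
qed

lemma eigen_power:
  assumes "P * A = sc r * P"
  shows "P * A ^ k = sc (r ^ k) * P"
proof (induction k)
  case (Suc k)
  have "P * A ^ Suc k = (P * A ^ k) * A" by (simp add: power_commutes mult.assoc)
  also have "\<dots> = sc (r ^ k) * (P * A)" unfolding Suc by (simp add: mult.assoc)
  also have "\<dots> = sc (r ^ Suc k) * P" unfolding assms by (simp only: power_Suc2 sc_simps(4) mult.assoc)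
  finally show ?case .
qed (simp add: sc_simps)

text \<open>
  The half step is a full step followed by an inverse half step with parameter 1, and the full step contributes a factor \<open>rho\<close> on the
  range of \<open>pr2\<close>.
\<close>

lemma regular_pr2_step:
  assumes "0 < \<epsilon>" "U \<inter> branch_cuts \<epsilon> = {}"
  shows "regular U (\<lambda>w. pr2 \<epsilon> w * step \<epsilon> w)"
proof (rule regular_cong[OF regular_mult[OF regular_pr2[OF assms] regular_rho_step(2)[OF assms, of 1]]])
  fix w assume "w \<in> U - {1}"
  then have w: "w \<notin> branch_cuts \<epsilon>" "w \<noteq> 1" using assms by auto
  have "step \<epsilon> w = phi \<epsilon> w * unstep 1 w"
    unfolding phi_def by (simp add: mult.assoc step_unstep[OF w(2)])
  then have "pr2 \<epsilon> w * step \<epsilon> w = (pr2 \<epsilon> w * phi \<epsilon> w) * unstep 1 w"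
    by (simp add: mult.assoc)
  then show "pr2 \<epsilon> w * step \<epsilon> w = pr2 \<epsilon> w * (sc (rho \<epsilon> w) * unstep 1 w)"
    unfolding pr_phi(2)[OF w(1) assms(1) w(2)] sc_left_commute by (simp add: mult.assoc)
qed

lemma regular_rho_power:
  assumes "0 < \<epsilon>" "U \<inter> branch_cuts \<epsilon> = {}"
  shows "regular U (\<lambda>w. sc (rho \<epsilon> w ^ k))"
  by (intro regular_sc holomorphic_intros holomorphic_rho assms)

lemma regular_rho_power_step:
  assumes "0 < \<epsilon>" "U \<inter> branch_cuts \<epsilon> = {}" "0 < k"
  shows "regular U (\<lambda>w. sc (rho \<epsilon> w ^ k) * step e w)"
proof (rule regular_cong[OF regular_mult[OF regular_rho_power[OF assms(1,2), of "k - 1"] regular_rho_step(1)[OF assms(1,2), of e]]])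
  fix w
  show "sc (rho \<epsilon> w ^ k) * step e w = sc (rho \<epsilon> w ^ (k - 1)) * (sc (rho \<epsilon> w) * step e w)"
    using assms(3) by (cases k) (simp, simp only: diff_Suc_1 power_Suc2 sc_simps(4) mult.assoc)
qed

section \<open>The projection that separates the two directions\<close>

text \<open>
  Here \<open>T\<close> is \<open>t N\<close> and \<open>h\<close> is \<open>N / 2\<close>; so there are \<open>4 h\<close> white columns, and \<open>2 h\<close> half steps lead to the middle of the diamond.
\<close>

locale split_model =
  fixes \<alpha> \<beta> :: real and T h :: nat
  assumes \<alpha>: "0 < \<alpha>" "\<alpha> < 1" and \<beta>: "0 < \<beta>" "\<beta> < 1" and T: "0 < T" "T < h"
begin

text \<open>
  The parameter of the white column with \<open>x\<close>-coordinate \<open>2 j + 1\<close>; the odd columns are unweighted.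
\<close>

definition eps :: "nat \<Rightarrow> real" where
  "eps j = (if even j then (if j < 2 * T then \<alpha> else \<beta>) else 1)"

definition cut_domain :: "complex set" where
  "cut_domain = - (branch_cuts \<alpha> \<union> branch_cuts \<beta>)"

lemma eps_pos: "0 < eps j" using \<alpha> \<beta> by (simp add: eps_def)

lemma eps_nonzero: "eps j \<noteq> 0" using eps_pos[of j] by simp

lemma cutsD:
  assumes "w \<in> cut_domain"
  shows "w \<notin> branch_cuts \<alpha>" "w \<notin> branch_cuts \<beta>"
  using assms by (auto simp: cut_domain_def)

lemma cut_domain_disjoint: "cut_domain \<inter> branch_cuts \<alpha> = {}" "cut_domain \<inter> branch_cuts \<beta> = {}"
  by (auto simp: cut_domain_def)

lemma walk_alpha: "a + k \<le> T \<Longrightarrow> walk eps (2 * a) (2 * k) z = phi \<alpha> z ^ k"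
proof (induction k)
  case (Suc k)
  have "eps (2 * a + 2 * k) = \<alpha>" "eps (Suc (2 * a + 2 * k)) = 1" using Suc.prems by (auto simp: eps_def)
  then show ?case using Suc by (simp add: phi_def power_commutes mult.assoc[symmetric])
    (metis power_commutes mult.assoc phi_def)
qed simp

lemma walk_beta: "T \<le> a \<Longrightarrow> walk eps (2 * a) (2 * k) z = phi \<beta> z ^ k"
proof (induction k)
  case (Suc k)
  have "eps (2 * a + 2 * k) = \<beta>" "eps (Suc (2 * a + 2 * k)) = 1" using Suc.prems by (auto simp: eps_def)
  then show ?case using Suc by (simp add: phi_def power_commutes mult.assoc[symmetric])
    (metis power_commutes mult.assoc phi_def)
qed simp

lemma walk_inv_alpha: "a + k \<le> T \<Longrightarrow> walk_inv eps (2 * a) (2 * k) z = phi_inv \<alpha> z ^ k"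
proof (induction k)
  case (Suc k)
  have "eps (2 * a + 2 * k) = \<alpha>" "eps (Suc (2 * a + 2 * k)) = 1" using Suc.prems by (auto simp: eps_def)
  then show ?case using Suc by (simp add: phi_inv_def mult.assoc)
qed simp

lemma walk_inv_beta: "T \<le> a \<Longrightarrow> walk_inv eps (2 * a) (2 * k) z = phi_inv \<beta> z ^ k"
proof (induction k)
  case (Suc k)
  have "eps (2 * a + 2 * k) = \<beta>" "eps (Suc (2 * a + 2 * k)) = 1" using Suc.prems by (auto simp: eps_def)
  then show ?case using Suc by (simp add: phi_inv_def mult.assoc)
qed simp

lemma walk_inv_add: "walk_inv eps j (k + l) z = walk_inv eps (j + k) l z * walk_inv eps j k z"
  by (induction l) (simp_all add: mult.assoc add.assoc)

lemma walk_inv_full: "walk_inv eps 0 (2 * h) z = phi_inv \<beta> z ^ (h - T) * phi_inv \<alpha> z ^ T"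
  using walk_inv_add[of 0 "2 * T" "2 * (h - T)" z] walk_inv_alpha[of 0 T z] walk_inv_beta[of T "h - T" z] T
  by (simp add: algebra_simps)

text \<open>
  For \<open>m \<le> T\<close> this is the projection with the same rows as \<open>F\<^sub>\<alpha>\<^sub>,\<^sub>1\<close> along the rows of \<open>F\<^sub>\<beta>\<^sub>,\<^sub>2\<close>, the latter
  transported from the interface at \<open>T\<close> to the full step \<open>m\<close>; for \<open>m > T\<close> the former are transported instead.
\<close>

definition proj :: "nat \<Rightarrow> complex \<Rightarrow> m2" where
  "proj m w = (if m \<le> T
     then pr1 \<alpha> w + sc (c_fun \<alpha> \<beta> w * rho \<alpha> w ^ (2 * (T - m))) * (pr2 \<alpha> w * pr1 \<beta> w * pr1 \<alpha> w)
     else pr1 \<beta> w + sc (c_fun \<alpha> \<beta> w * rho \<beta> w ^ (2 * (m - T))) * (pr1 \<beta> w * pr1 \<alpha> w * pr2 \<beta> w))"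

lemma holomorphic_parts: "rho \<alpha> holomorphic_on cut_domain" "rho \<beta> holomorphic_on cut_domain" "c_fun \<alpha> \<beta> holomorphic_on cut_domain"
  using holomorphic_rho holomorphic_c_fun \<alpha> \<beta> cut_domain_disjoint by blast+

lemma regular_parts: "regular cut_domain (pr1 \<alpha>)" "regular cut_domain (pr1 \<beta>)" "regular cut_domain (pr2 \<alpha>)" "regular cut_domain (pr2 \<beta>)"
  "regular cut_domain (\<lambda>w. pr2 \<alpha> w * step \<alpha> w)" "regular cut_domain (\<lambda>w. pr2 \<beta> w * step \<beta> w)"
  "0 < k \<Longrightarrow> regular cut_domain (\<lambda>w. sc (rho \<alpha> w ^ k) * step \<epsilon> w)"
  "0 < k \<Longrightarrow> regular cut_domain (\<lambda>w. sc (rho \<beta> w ^ k) * step \<epsilon> w)"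
  "regular cut_domain (\<lambda>w. sc (rho \<alpha> w ^ k))" "regular cut_domain (\<lambda>w. sc (rho \<beta> w ^ k))"
  "regular cut_domain (\<lambda>w. sc (c_fun \<alpha> \<beta> w))"
  by (simp_all add: regular_pr1 regular_pr2 regular_pr2_step regular_rho_power_step regular_rho_power
      regular_sc[OF holomorphic_parts(3)] \<alpha> \<beta> cut_domain_disjoint)

lemma regular_proj: "regular cut_domain (proj m)"
proof (cases "m \<le> T")
  case True
  show ?thesis
    by (rule regular_cong[of _ "\<lambda>w. pr1 \<alpha> w + sc (c_fun \<alpha> \<beta> w) * sc (rho \<alpha> w ^ (2 * (T - m))) * (pr2 \<alpha> w * pr1 \<beta> w * pr1 \<alpha> w)"])
      (auto intro!: regular_mult regular_add regular_parts simp: proj_def True sc_simps(4))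
next
  case False
  show ?thesis
    by (rule regular_cong[of _ "\<lambda>w. pr1 \<beta> w + sc (c_fun \<alpha> \<beta> w) * sc (rho \<beta> w ^ (2 * (m - T))) * (pr1 \<beta> w * pr1 \<alpha> w * pr2 \<beta> w)"])
      (auto intro!: regular_mult regular_add regular_parts simp: proj_def False sc_simps(4))
qed

lemma pr_power:
  assumes "w \<in> cut_domain - {1}"
  shows "pr1 \<alpha> w * phi_inv \<alpha> w ^ k = sc (rho \<alpha> w ^ k) * pr1 \<alpha> w"
    "pr1 \<beta> w * phi_inv \<beta> w ^ k = sc (rho \<beta> w ^ k) * pr1 \<beta> w"
    "pr2 \<alpha> w * phi \<alpha> w ^ k = sc (rho \<alpha> w ^ k) * pr2 \<alpha> w"
    "pr2 \<beta> w * phi \<beta> w ^ k = sc (rho \<beta> w ^ k) * pr2 \<beta> w"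
    "pr1 \<alpha> w * phi \<alpha> w ^ k = sc (inverse (rho \<alpha> w) ^ k) * pr1 \<alpha> w"
    "pr1 \<beta> w * phi \<beta> w ^ k = sc (inverse (rho \<beta> w) ^ k) * pr1 \<beta> w"
    "pr2 \<alpha> w * phi_inv \<alpha> w ^ k = sc (inverse (rho \<alpha> w) ^ k) * pr2 \<alpha> w"
    "pr2 \<beta> w * phi_inv \<beta> w ^ k = sc (inverse (rho \<beta> w) ^ k) * pr2 \<beta> w"
  using assms \<alpha> \<beta> cutsD[of w] by (auto intro!: eigen_power pr_phi)

lemma rho_nonzero:
  assumes "w \<in> cut_domain - {1}"
  shows "rho \<alpha> w \<noteq> 0" "rho \<beta> w \<noteq> 0"
  using eig_r_eq(3) \<alpha> \<beta> assms by auto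

lemma power_cancel: "x \<noteq> 0 \<Longrightarrow> l \<le> k \<Longrightarrow> x ^ k * inverse x ^ l = (x ^ (k - l) :: complex)"
  by (simp add: power_diff power_inverse field_simps)

lemma pr1_idem': "w \<in> cut_domain \<Longrightarrow> pr1 \<alpha> w * pr1 \<alpha> w = pr1 \<alpha> w" "w \<in> cut_domain \<Longrightarrow> pr1 \<beta> w * pr1 \<beta> w = pr1 \<beta> w"
  "w \<in> cut_domain \<Longrightarrow> pr2 \<beta> w * pr2 \<beta> w = pr2 \<beta> w"
  using pr1_idem pr_orthogonal cutsD \<alpha> \<beta> by blast+

lemma compression: "w \<in> cut_domain \<Longrightarrow> sc (c_fun \<alpha> \<beta> w) * (pr1 \<beta> w * (pr1 \<alpha> w * pr1 \<beta> w)) = pr1 \<beta> w"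
  using c_fun_compression[OF \<alpha> \<beta>] cutsD by (simp add: mult.assoc)

lemma sc_move:
  "pr1 \<epsilon> w * (sc c * B) = sc c * (pr1 \<epsilon> w * B)" "pr2 \<epsilon> w * (sc c * B) = sc c * (pr2 \<epsilon> w * B)"
  "proj m w * (sc c * B) = sc c * (proj m w * B)"
  "pr1 \<epsilon> w * sc c = sc c * pr1 \<epsilon> w" "pr2 \<epsilon> w * sc c = sc c * pr2 \<epsilon> w" "proj m w * sc c = sc c * proj m w"
  "sc a * (sc c * B) = sc (a * c) * B" "sc a * sc c = sc (a * c)"
  by (rule sc_left_commute sc_commute)+ (simp_all only: sc_simps(4) mult.assoc)

text \<open>
  Walking to the left multiplies rows of \<open>F\<^sub>\<epsilon>\<^sub>,\<^sub>1\<close> by \<open>rho\<close> in each full step. In the third case, the part of \<open>proj m w\<close>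
  that is left at the interface has only rows of \<open>F\<^sub>\<alpha>\<^sub>,\<^sub>1\<close>, by the compression identity.
\<close>

lemma proj_before:
  assumes w: "w \<in> cut_domain - {1}" and k: "k \<le> m"
  shows "proj m w * walk_inv eps (2 * k) (2 * (m - k)) w =
    (if m \<le> T then sc (rho \<alpha> w ^ (m - k)) * proj m w
     else if T \<le> k then sc (rho \<beta> w ^ (m - k)) * pr1 \<beta> w
       + sc (c_fun \<alpha> \<beta> w) * (pr1 \<beta> w * pr1 \<alpha> w) * (sc (rho \<beta> w ^ (2 * (m - T) - (m - k))) * pr2 \<beta> w)
     else sc (c_fun \<alpha> \<beta> w) * sc (rho \<beta> w ^ (m - T)) * (pr1 \<beta> w * pr1 \<alpha> w) * sc (rho \<alpha> w ^ (T - k)))"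
proof -
  have wU: "w \<in> cut_domain" using w by simp
  consider "m \<le> T" | "m > T" "T \<le> k" | "m > T" "k < T" by linarith
  then show ?thesis
  proof cases
    case 1
    then have "walk_inv eps (2 * k) (2 * (m - k)) w = phi_inv \<alpha> w ^ (m - k)" using walk_inv_alpha[of k "m - k"] k by simp
    moreover have "proj m w = proj m w * pr1 \<alpha> w"
      using 1 pr1_idem'[OF wU] by (simp add: proj_def distrib_right mult.assoc)
    ultimately have "proj m w * walk_inv eps (2 * k) (2 * (m - k)) w = proj m w * (pr1 \<alpha> w * phi_inv \<alpha> w ^ (m - k))"
      by (metis mult.assoc)
    also have "\<dots> = sc (rho \<alpha> w ^ (m - k)) * (proj m w * pr1 \<alpha> w)"
      unfolding pr_power[OF w] by (rule sc_left_commute)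
    finally show ?thesis using 1 \<open>proj m w = proj m w * pr1 \<alpha> w\<close> by simp
  next
    case 2
    then have "walk_inv eps (2 * k) (2 * (m - k)) w = phi_inv \<beta> w ^ (m - k)" by (simp add: walk_inv_beta)
    then have "proj m w * walk_inv eps (2 * k) (2 * (m - k)) w = sc (rho \<beta> w ^ (m - k)) * pr1 \<beta> w
      + sc (c_fun \<alpha> \<beta> w * rho \<beta> w ^ (2 * (m - T)) * inverse (rho \<beta> w) ^ (m - k)) * (pr1 \<beta> w * pr1 \<alpha> w * pr2 \<beta> w)"
      using 2 by (simp add: proj_def distrib_right mult.assoc pr_power[OF w] sc_move mult_ac)
    also have "c_fun \<alpha> \<beta> w * rho \<beta> w ^ (2 * (m - T)) * inverse (rho \<beta> w) ^ (m - k)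
      = c_fun \<alpha> \<beta> w * rho \<beta> w ^ (2 * (m - T) - (m - k))"
      using power_cancel[OF rho_nonzero(2)[OF w], of "m - k" "2 * (m - T)"] 2 by (simp add: mult.assoc)
    finally show ?thesis using 2 by (simp add: mult.assoc sc_move mult_ac)
  next
    case 3
    have "walk_inv eps (2 * k) (2 * (m - k)) w = walk_inv eps (2 * T) (2 * (m - T)) w * walk_inv eps (2 * k) (2 * (T - k)) w"
      using walk_inv_add[of "2 * k" "2 * (T - k)" "2 * (m - T)" w] 3 by (simp add: algebra_simps)
    also have "\<dots> = phi_inv \<beta> w ^ (m - T) * phi_inv \<alpha> w ^ (T - k)"
      using 3 by (simp add: walk_inv_beta walk_inv_alpha)
    finally have "proj m w * walk_inv eps (2 * k) (2 * (m - k)) w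
      = (proj m w * phi_inv \<beta> w ^ (m - T)) * phi_inv \<alpha> w ^ (T - k)" by (simp add: mult.assoc)
    also have "proj m w * phi_inv \<beta> w ^ (m - T) = sc (rho \<beta> w ^ (m - T)) * pr1 \<beta> w
      + sc (c_fun \<alpha> \<beta> w * rho \<beta> w ^ (2 * (m - T)) * inverse (rho \<beta> w) ^ (m - T)) * (pr1 \<beta> w * pr1 \<alpha> w * pr2 \<beta> w)"
      using 3 by (simp add: proj_def distrib_right mult.assoc pr_power[OF w] sc_move mult_ac)
    also have "c_fun \<alpha> \<beta> w * rho \<beta> w ^ (2 * (m - T)) * inverse (rho \<beta> w) ^ (m - T)
      = rho \<beta> w ^ (m - T) * c_fun \<alpha> \<beta> w"
      using power_cancel[OF rho_nonzero(2)[OF w], of "m - T" "2 * (m - T)"] by (simp add: mult.assoc mult.commute)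
    also have "sc (rho \<beta> w ^ (m - T)) * pr1 \<beta> w + sc (rho \<beta> w ^ (m - T) * c_fun \<alpha> \<beta> w) * (pr1 \<beta> w * pr1 \<alpha> w * pr2 \<beta> w)
      = sc (rho \<beta> w ^ (m - T)) * (sc (c_fun \<alpha> \<beta> w) * (pr1 \<beta> w * pr1 \<alpha> w))"
    proof -
      have "pr1 \<beta> w + sc (c_fun \<alpha> \<beta> w) * (pr1 \<beta> w * pr1 \<alpha> w * pr2 \<beta> w)
        = pr1 \<beta> w + sc (c_fun \<alpha> \<beta> w) * (pr1 \<beta> w * pr1 \<alpha> w) - sc (c_fun \<alpha> \<beta> w) * (pr1 \<beta> w * (pr1 \<alpha> w * pr1 \<beta> w))"
        by (simp add: pr2_def algebra_simps)
      then have "pr1 \<beta> w + sc (c_fun \<alpha> \<beta> w) * (pr1 \<beta> w * pr1 \<alpha> w * pr2 \<beta> w) = sc (c_fun \<alpha> \<beta> w) * (pr1 \<beta> w * pr1 \<alpha> w)"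
        unfolding compression[OF wU] by simp
      then show ?thesis by (metis distrib_left mult.assoc sc_simps(4))
    qed
    also have "\<dots> * phi_inv \<alpha> w ^ (T - k) = sc (rho \<beta> w ^ (m - T)) * (sc (c_fun \<alpha> \<beta> w) * (pr1 \<beta> w * (pr1 \<alpha> w * phi_inv \<alpha> w ^ (T - k))))"
      by (simp add: mult.assoc)
    also have "\<dots> = sc (c_fun \<alpha> \<beta> w) * sc (rho \<beta> w ^ (m - T)) * (pr1 \<beta> w * pr1 \<alpha> w) * sc (rho \<alpha> w ^ (T - k))"
      unfolding pr_power[OF w] by (simp add: sc_move mult_ac)
    finally show ?thesis using 3 by simp
  qed
qed

text \<open>
  After an even number of half steps this is \<open>proj_before\<close>. For an odd number, the additional \<open>step\<close> is absorbed by a positive power of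
  \<open>rho\<close> or by \<open>pr2\<close>.
\<close>

lemma regular_before:
  assumes j: "j \<le> 2 * m"
  shows "regular cut_domain (\<lambda>w. proj m w * walk_inv eps j (2 * m - j) w)"
proof -
  have even_case: "regular cut_domain (\<lambda>w. proj m w * walk_inv eps (2 * k) (2 * (m - k)) w)" if k: "k \<le> m" for k
    by (rule regular_cong[OF _ proj_before[OF _ k]])
      (cases "m \<le> T"; cases "T \<le> k"; auto intro!: regular_mult regular_add regular_one regular_parts regular_proj simp: sc_simps(1))
  have odd_case: "regular cut_domain (\<lambda>w. proj m w * walk_inv eps (2 * k) (2 * (m - k)) w * step (eps (2 * k)) w)"
    if k: "k < m" for k
  proof -
    consider "m \<le> T" | "m > T" "T \<le> k" | "m > T" "k < T" by linarith
    then show ?thesis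
    proof cases
      case 1
      have "regular cut_domain (\<lambda>w. proj m w * (sc (rho \<alpha> w ^ (m - k)) * step \<alpha> w))"
        using k by (intro regular_mult regular_parts regular_proj) simp
      then show ?thesis
      proof (rule regular_cong)
        fix w assume w: "w \<in> cut_domain - {1}"
        show "proj m w * walk_inv eps (2 * k) (2 * (m - k)) w * step (eps (2 * k)) w = proj m w * (sc (rho \<alpha> w ^ (m - k)) * step \<alpha> w)"
          unfolding proj_before[OF w less_imp_le[OF k]] using k 1 by (simp add: eps_def sc_move mult_ac)
      qed
    next
      case 2
      have "regular cut_domain (\<lambda>w. pr1 \<beta> w * (sc (rho \<beta> w ^ (m - k)) * step \<beta> w)
        + sc (c_fun \<alpha> \<beta> w) * (pr1 \<beta> w * pr1 \<alpha> w) * (sc (rho \<beta> w ^ (2 * (m - T) - (m - k))) * (pr2 \<beta> w * step \<beta> w)))"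
        using k by (intro regular_mult regular_add regular_parts) simp
      then show ?thesis
      proof (rule regular_cong)
        fix w assume w: "w \<in> cut_domain - {1}"
        show "proj m w * walk_inv eps (2 * k) (2 * (m - k)) w * step (eps (2 * k)) w = pr1 \<beta> w * (sc (rho \<beta> w ^ (m - k)) * step \<beta> w)
        + sc (c_fun \<alpha> \<beta> w) * (pr1 \<beta> w * pr1 \<alpha> w) * (sc (rho \<beta> w ^ (2 * (m - T) - (m - k))) * (pr2 \<beta> w * step \<beta> w))"
          unfolding proj_before[OF w less_imp_le[OF k]] using k 2 by (simp add: eps_def sc_move mult_ac distrib_right)
      qed
    next
      case 3
      have "regular cut_domain (\<lambda>w. sc (c_fun \<alpha> \<beta> w) * sc (rho \<beta> w ^ (m - T)) * (pr1 \<beta> w * pr1 \<alpha> w) * (sc (rho \<alpha> w ^ (T - k)) * step \<alpha> w))"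
        using 3 by (intro regular_mult regular_add regular_parts) simp
      then show ?thesis
      proof (rule regular_cong)
        fix w assume w: "w \<in> cut_domain - {1}"
        show "proj m w * walk_inv eps (2 * k) (2 * (m - k)) w * step (eps (2 * k)) w = sc (c_fun \<alpha> \<beta> w) * sc (rho \<beta> w ^ (m - T)) * (pr1 \<beta> w * pr1 \<alpha> w) * (sc (rho \<alpha> w ^ (T - k)) * step \<alpha> w)"
          unfolding proj_before[OF w less_imp_le[OF k]] using k 3 by (simp add: eps_def sc_move mult_ac)
      qed
    qed
  qed
  show ?thesis
  proof (cases "even j")
    case True
    then obtain k where "j = 2 * k" by blast
    then show ?thesis using even_case[of k] j by (simp add: right_diff_distrib')
  next
    case False
    then obtain k where k: "j = 2 * k + 1" by (elim oddE)
    then have km: "k < m" using j by simp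
    have "walk_inv eps (2 * k) (2 * (m - k)) w * step (eps (2 * k)) w = walk_inv eps j (2 * m - j) w"
      if "w \<noteq> 1" for w
    proof -
      have "2 * (m - k) = 1 + (2 * m - j)" using km k by simp
      then have "walk_inv eps (2 * k) (2 * (m - k)) w = walk_inv eps j (2 * m - j) w * unstep (eps (2 * k)) w"
        using walk_inv_add[of "2 * k" 1 "2 * m - j" w] k by simp
      then show ?thesis using step_unstep[OF that eps_nonzero] by (simp add: mult.assoc)
    qed
    then show ?thesis
      by (intro regular_cong[OF odd_case[OF km]]) (simp add: mult.assoc)
  qed
qed

text \<open>
  The mirror image of \<open>proj_before\<close>: walking to the right multiplies rows of \<open>F\<^sub>\<epsilon>\<^sub>,\<^sub>2\<close> by \<open>rho\<close>, and at the interface only rows of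
  \<open>F\<^sub>\<beta>\<^sub>,\<^sub>2\<close> are left.
\<close>

lemma proj_after:
  assumes w: "w \<in> cut_domain - {1}" and k: "m \<le> k"
  shows "(1 - proj m w) * walk eps (2 * m) (2 * (k - m)) w =
    (if T < m then (1 - proj m w) * (sc (rho \<beta> w ^ (k - m)) * pr2 \<beta> w)
     else if k < T then sc (rho \<alpha> w ^ (k - m)) * pr2 \<alpha> w
       - sc (c_fun \<alpha> \<beta> w) * (pr2 \<alpha> w * pr1 \<beta> w) * (sc (rho \<alpha> w ^ (2 * (T - m) - (k - m))) * pr1 \<alpha> w)
     else (pr2 \<alpha> w - sc (c_fun \<alpha> \<beta> w) * (pr2 \<alpha> w * pr1 \<beta> w * pr1 \<alpha> w))
       * sc (rho \<alpha> w ^ (T - m)) * (sc (rho \<beta> w ^ (k - T)) * pr2 \<beta> w))"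
proof -
  have wU: "w \<in> cut_domain" using w by simp
  consider "T < m" | "m \<le> T" "k < T" | "m \<le> T" "T \<le> k" by linarith
  then show ?thesis
  proof cases
    case 1
    have "1 - proj m w = (1 - proj m w) * pr2 \<beta> w"
    proof -
      have "(1 - proj m w) * pr2 \<beta> w
        = pr2 \<beta> w - pr1 \<beta> w * pr2 \<beta> w - sc (c_fun \<alpha> \<beta> w * rho \<beta> w ^ (2 * (m - T))) * (pr1 \<beta> w * pr1 \<alpha> w * (pr2 \<beta> w * pr2 \<beta> w))"
        using 1 by (simp add: proj_def algebra_simps)
      also have "\<dots> = pr2 \<beta> w - sc (c_fun \<alpha> \<beta> w * rho \<beta> w ^ (2 * (m - T))) * (pr1 \<beta> w * pr1 \<alpha> w * pr2 \<beta> w)"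
        using pr_orthogonal[OF cutsD(2)[OF wU] \<beta>(1)] by simp
      also have "\<dots> = 1 - proj m w" using 1 by (simp add: proj_def pr2_def algebra_simps)
      finally show ?thesis by simp
    qed
    then have "(1 - proj m w) * walk eps (2 * m) (2 * (k - m)) w = (1 - proj m w) * (pr2 \<beta> w * phi \<beta> w ^ (k - m))"
      using 1 by (metis mult.assoc walk_beta less_imp_le)
    then show ?thesis using 1 by (simp add: pr_power[OF w])
  next
    case 2
    then have "walk eps (2 * m) (2 * (k - m)) w = phi \<alpha> w ^ (k - m)" using k by (simp add: walk_alpha)
    moreover have one: "1 - proj m w = pr2 \<alpha> w - sc (c_fun \<alpha> \<beta> w * rho \<alpha> w ^ (2 * (T - m))) * (pr2 \<alpha> w * pr1 \<beta> w * pr1 \<alpha> w)"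
      using 2 by (simp add: proj_def pr2_def)
    ultimately have "(1 - proj m w) * walk eps (2 * m) (2 * (k - m)) w = sc (rho \<alpha> w ^ (k - m)) * pr2 \<alpha> w
      - sc (c_fun \<alpha> \<beta> w * rho \<alpha> w ^ (2 * (T - m)) * inverse (rho \<alpha> w) ^ (k - m)) * (pr2 \<alpha> w * pr1 \<beta> w * pr1 \<alpha> w)"
      by (simp add: left_diff_distrib mult.assoc pr_power[OF w] sc_move mult_ac)
    also have "c_fun \<alpha> \<beta> w * rho \<alpha> w ^ (2 * (T - m)) * inverse (rho \<alpha> w) ^ (k - m)
      = c_fun \<alpha> \<beta> w * rho \<alpha> w ^ (2 * (T - m) - (k - m))"
      using power_cancel[OF rho_nonzero(1)[OF w], of "k - m" "2 * (T - m)"] 2 by (simp add: mult.assoc)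
    finally show ?thesis using 2 by (simp add: mult.assoc sc_move mult_ac)
  next
    case 3
    let ?X = "pr2 \<alpha> w - sc (c_fun \<alpha> \<beta> w) * (pr2 \<alpha> w * pr1 \<beta> w * pr1 \<alpha> w)"
    have "walk eps (2 * m) (2 * (k - m)) w = walk eps (2 * m) (2 * (T - m)) w * walk eps (2 * T) (2 * (k - T)) w"
      using walk_add[of eps "2 * m" "2 * (T - m)" "2 * (k - T)" w] 3 by (simp add: algebra_simps)
    also have "\<dots> = phi \<alpha> w ^ (T - m) * phi \<beta> w ^ (k - T)"
      using 3 by (simp add: walk_alpha walk_beta)
    finally have "(1 - proj m w) * walk eps (2 * m) (2 * (k - m)) w
      = ((1 - proj m w) * phi \<alpha> w ^ (T - m)) * phi \<beta> w ^ (k - T)" by (simp add: mult.assoc)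
    also have "(1 - proj m w) * phi \<alpha> w ^ (T - m)
      = (pr2 \<alpha> w - sc (c_fun \<alpha> \<beta> w * rho \<alpha> w ^ (2 * (T - m))) * (pr2 \<alpha> w * pr1 \<beta> w * pr1 \<alpha> w)) * phi \<alpha> w ^ (T - m)"
    proof -
      have one: "1 - proj m w = pr2 \<alpha> w - sc (c_fun \<alpha> \<beta> w * rho \<alpha> w ^ (2 * (T - m))) * (pr2 \<alpha> w * pr1 \<beta> w * pr1 \<alpha> w)"
        using 3 by (simp add: proj_def pr2_def)
      show ?thesis unfolding one ..
    qed
    also have "\<dots> = sc (rho \<alpha> w ^ (T - m)) * pr2 \<alpha> w
      - sc (c_fun \<alpha> \<beta> w * rho \<alpha> w ^ (2 * (T - m)) * inverse (rho \<alpha> w) ^ (T - m)) * (pr2 \<alpha> w * pr1 \<beta> w * pr1 \<alpha> w)"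
      by (simp add: left_diff_distrib mult.assoc pr_power[OF w] sc_move mult_ac)
    also have "c_fun \<alpha> \<beta> w * rho \<alpha> w ^ (2 * (T - m)) * inverse (rho \<alpha> w) ^ (T - m)
      = rho \<alpha> w ^ (T - m) * c_fun \<alpha> \<beta> w"
      using power_cancel[OF rho_nonzero(1)[OF w], of "T - m" "2 * (T - m)"] by (simp add: mult.assoc mult.commute)
    also have "sc (rho \<alpha> w ^ (T - m)) * pr2 \<alpha> w - sc (rho \<alpha> w ^ (T - m) * c_fun \<alpha> \<beta> w) * (pr2 \<alpha> w * pr1 \<beta> w * pr1 \<alpha> w)
      = sc (rho \<alpha> w ^ (T - m)) * ?X"
      by (simp only: sc_simps(4) right_diff_distrib mult.assoc)
    also have "?X = ?X * pr2 \<beta> w"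
    proof -
      have "?X * pr1 \<beta> w = pr2 \<alpha> w * pr1 \<beta> w - pr2 \<alpha> w * (sc (c_fun \<alpha> \<beta> w) * (pr1 \<beta> w * (pr1 \<alpha> w * pr1 \<beta> w)))"
        by (simp add: left_diff_distrib sc_move mult_ac)
      also have "\<dots> = 0" unfolding compression[OF wU] by simp
      finally show ?thesis by (simp add: pr2_def[of \<beta>] right_diff_distrib)
    qed
    also have "sc (rho \<alpha> w ^ (T - m)) * (?X * pr2 \<beta> w) * phi \<beta> w ^ (k - T)
      = sc (rho \<alpha> w ^ (T - m)) * (?X * (pr2 \<beta> w * phi \<beta> w ^ (k - T)))" by (simp only: mult.assoc)
    also have "\<dots> = ?X * sc (rho \<alpha> w ^ (T - m)) * (sc (rho \<beta> w ^ (k - T)) * pr2 \<beta> w)"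
    proof -
      have "sc r * (X * (sc s * P)) = X * sc r * (sc s * P)" for X P r s
        by (metis mult.assoc sc_commute)
      then show ?thesis unfolding pr_power[OF w] .
    qed
    finally show ?thesis using 3 by simp
  qed
qed

lemma regular_after:
  assumes j: "2 * m \<le> j"
  shows "regular cut_domain (\<lambda>w. (1 - proj m w) * walk eps (2 * m) (j - 2 * m) w)"
proof -
  have even_case: "regular cut_domain (\<lambda>w. (1 - proj m w) * walk eps (2 * m) (2 * (k - m)) w)" if k: "m \<le> k" for k
    by (rule regular_cong[OF _ proj_after[OF _ k]])
      (cases "T < m"; cases "k < T"; auto intro!: regular_mult regular_add regular_diff regular_one regular_parts regular_proj simp: sc_simps(1))
  have odd_case: "regular cut_domain (\<lambda>w. (1 - proj m w) * walk eps (2 * m) (2 * (k - m)) w * step (eps (2 * k)) w)"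
    if k: "m \<le> k" for k
  proof -
    consider "T < m" | "m \<le> T" "k < T" | "m \<le> T" "T \<le> k" by linarith
    then show ?thesis
    proof cases
      case 1
      have "regular cut_domain (\<lambda>w. (1 - proj m w) * (sc (rho \<beta> w ^ (k - m)) * (pr2 \<beta> w * step \<beta> w)))"
        by (intro regular_mult regular_diff regular_one regular_parts regular_proj)
      then show ?thesis
        by (rule regular_cong) (use k 1 in \<open>simp add: proj_after[OF _ k] eps_def mult.assoc\<close>)
    next
      case 2
      have "regular cut_domain (\<lambda>w. sc (rho \<alpha> w ^ (k - m)) * (pr2 \<alpha> w * step \<alpha> w)
       - sc (c_fun \<alpha> \<beta> w) * (pr2 \<alpha> w * pr1 \<beta> w) * (pr1 \<alpha> w * (sc (rho \<alpha> w ^ (2 * (T - m) - (k - m))) * step \<alpha> w)))"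
        using 2 k by (intro regular_mult regular_diff regular_one regular_parts) simp
      then show ?thesis
      proof (rule regular_cong)
        fix w assume w: "w \<in> cut_domain - {1}"
        show "(1 - proj m w) * walk eps (2 * m) (2 * (k - m)) w * step (eps (2 * k)) w
          = sc (rho \<alpha> w ^ (k - m)) * (pr2 \<alpha> w * step \<alpha> w)
       - sc (c_fun \<alpha> \<beta> w) * (pr2 \<alpha> w * pr1 \<beta> w) * (pr1 \<alpha> w * (sc (rho \<alpha> w ^ (2 * (T - m) - (k - m))) * step \<alpha> w))"
          unfolding proj_after[OF w k] using k 2 by (simp add: eps_def left_diff_distrib sc_move mult_ac)
      qed
    next
      case 3
      have "regular cut_domain (\<lambda>w. (pr2 \<alpha> w - sc (c_fun \<alpha> \<beta> w) * (pr2 \<alpha> w * pr1 \<beta> w * pr1 \<alpha> w))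
       * sc (rho \<alpha> w ^ (T - m)) * (sc (rho \<beta> w ^ (k - T)) * (pr2 \<beta> w * step \<beta> w)))"
        by (intro regular_mult regular_diff regular_one regular_parts)
      then show ?thesis
        by (rule regular_cong) (use k 3 in \<open>simp add: proj_after[OF _ k] eps_def mult.assoc\<close>)
    qed
  qed
  show ?thesis
  proof (cases "even j")
    case True
    then obtain k where "j = 2 * k" by blast
    then show ?thesis using even_case[of k] j by (simp add: right_diff_distrib')
  next
    case False
    then obtain k where k: "j = 2 * k + 1" by (elim oddE)
    then have km: "m \<le> k" using j by simp
    have "j - 2 * m = Suc (2 * (k - m))" "2 * m + 2 * (k - m) = 2 * k" using k km by auto
    then show ?thesis using odd_case[OF km] by (simp add: mult.assoc)
  qed
qed

end

section \<open>The contours\<close>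

lemma of_real_image_eq: "complex_of_real ` S = {z. Im z = 0 \<and> Re z \<in> S}"
  by (auto simp: image_iff complex_eq_iff intro!: bexI[of _ "Re _"])

lemma closed_branch_cuts: "closed (branch_cuts \<epsilon>)"
proof -
  have "closed (Re -` ({..- (1 / \<epsilon>\<^sup>2)} \<union> {- (\<epsilon>\<^sup>2)..0}))"
    by (intro continuous_closed_vimage closed_Un closed_atMost closed_atLeastAtMost) auto
  moreover have "closed {z. Im z = 0}"
    by (intro closed_Collect_eq continuous_intros)
  ultimately have "closed ({z. Im z = 0} \<inter> Re -` ({..- (1 / \<epsilon>\<^sup>2)} \<union> {- (\<epsilon>\<^sup>2)..0}))" by blast
  also have "{z. Im z = 0} \<inter> Re -` ({..- (1 / \<epsilon>\<^sup>2)} \<union> {- (\<epsilon>\<^sup>2)..0}) = branch_cuts \<epsilon>"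
    unfolding branch_cuts_def of_real_image_eq by auto
  finally show ?thesis .
qed

text \<open>
  The unbounded cut reaches infinity without meeting the contour, and the bounded one contains 0, which is not inside.
\<close>

lemma branch_cuts_outside:
  assumes disj: "path_image \<gamma> \<inter> branch_cuts \<epsilon> = {}" and zero: "0 \<notin> inside (path_image \<gamma>)"
  shows "branch_cuts \<epsilon> \<subseteq> outside (path_image \<gamma>)"
proof
  fix z assume z: "z \<in> branch_cuts \<epsilon>"
  let ?S = "path_image \<gamma>"
  let ?L = "complex_of_real ` {..- (1 / \<epsilon>\<^sup>2)}" and ?M = "complex_of_real ` {- (\<epsilon>\<^sup>2)..0}"
  have LM: "?L \<subseteq> - ?S" "?M \<subseteq> - ?S" "z \<in> ?L \<or> z \<in> ?M"
    using disj z unfolding branch_cuts_def by auto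
  have conn: "connected ?L" "connected ?M"
    by (intro connected_continuous_image continuous_intros; simp)+
  from LM(3) show "z \<in> outside ?S"
  proof
    assume zL: "z \<in> ?L"
    have "\<not> bounded ?L"
    proof
      assume "bounded ?L"
      then obtain B where B: "\<And>x. x \<le> - (1 / \<epsilon>\<^sup>2) \<Longrightarrow> \<bar>x\<bar> \<le> B"
        unfolding bounded_iff by (auto simp: norm_of_real)
      have "\<bar>min (- (1 / \<epsilon>\<^sup>2)) (- \<bar>B\<bar> - 1)\<bar> \<le> B" by (rule B) simp
      then show False by (simp add: min_def split: if_splits)
    qed
    then have "\<not> bounded (connected_component_set (- ?S) z)"
      using connected_component_maximal[OF zL conn(1) LM(1)] bounded_subset by blast
    then show ?thesis using zL LM(1) unfolding outside_def by auto
  next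
    assume zM: "z \<in> ?M"
    have "0 \<in> ?M" by (auto simp: image_iff intro!: bexI[of _ 0])
    then have "0 \<in> connected_component_set (- ?S) z"
      using connected_component_maximal[OF zM conn(2) LM(2)] by blast
    then have "connected_component_set (- ?S) 0 = connected_component_set (- ?S) z"
      by (rule connected_component_eq)
    moreover have "\<not> bounded (connected_component_set (- ?S) 0)"
    proof -
      have "0 \<in> - ?S" using \<open>0 \<in> ?M\<close> LM(2) by blast
      then show ?thesis using zero unfolding inside_def by blast
    qed
    ultimately show ?thesis using zM LM(2) unfolding outside_def by auto
  qed
qed

locale contour_pair =
  fixes \<alpha> \<beta> :: real and \<gamma>1 \<gamma>01 :: "real \<Rightarrow> complex"
  assumes adm: "admissible_contours \<alpha> \<beta> \<gamma>1 \<gamma>01"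
begin

lemma \<gamma>1: "valid_path \<gamma>1" "pathfinish \<gamma>1 = pathstart \<gamma>1" "winding_number \<gamma>1 1 = 1"
  "path_image \<gamma>1 \<subseteq> - (branch_cuts \<alpha> \<union> branch_cuts \<beta>) - {1}"
  "z \<in> branch_cuts \<alpha> \<union> branch_cuts \<beta> \<Longrightarrow> winding_number \<gamma>1 z = 0"
proof -
  show vp: "valid_path \<gamma>1" and loop: "pathfinish \<gamma>1 = pathstart \<gamma>1" and "winding_number \<gamma>1 1 = 1"
    using adm unfolding admissible_contours_def positively_oriented_contour_def by auto
  have "1 \<notin> path_image \<gamma>1"
  proof -
    have "1 \<in> inside (path_image \<gamma>1)" using adm unfolding admissible_contours_def by blast
    then show ?thesis using inside_no_overlap[of "path_image \<gamma>1"] by blast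
  qed
  then show "path_image \<gamma>1 \<subseteq> - (branch_cuts \<alpha> \<union> branch_cuts \<beta>) - {1}"
    using adm unfolding admissible_contours_def by auto
  have "branch_cuts \<alpha> \<union> branch_cuts \<beta> \<subseteq> outside (path_image \<gamma>1)"
    using adm branch_cuts_outside[of \<gamma>1] unfolding admissible_contours_def by auto
  then show "winding_number \<gamma>1 z = 0" if "z \<in> branch_cuts \<alpha> \<union> branch_cuts \<beta>"
    using that vp loop by (intro winding_number_zero_in_outside valid_path_imp_path) auto
qed

lemma \<gamma>01: "valid_path \<gamma>01" "pathfinish \<gamma>01 = pathstart \<gamma>01"
  "z \<in> insert 0 (insert 1 (path_image \<gamma>1)) \<Longrightarrow> winding_number \<gamma>01 z = 1"
  "z \<in> insert 0 (insert 1 (path_image \<gamma>1)) \<Longrightarrow> z \<notin> path_image \<gamma>01"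
proof -
  show "valid_path \<gamma>01" and "pathfinish \<gamma>01 = pathstart \<gamma>01"
    using adm unfolding admissible_contours_def positively_oriented_contour_def by auto
  have ins: "insert 0 (insert 1 (path_image \<gamma>1)) \<subseteq> inside (path_image \<gamma>01)"
    using adm unfolding admissible_contours_def by auto
  then show "winding_number \<gamma>01 z = 1" if "z \<in> insert 0 (insert 1 (path_image \<gamma>1))"
    using adm that unfolding admissible_contours_def positively_oriented_contour_def by auto
  show "z \<notin> path_image \<gamma>01" if "z \<in> insert 0 (insert 1 (path_image \<gamma>1))"
    using ins that inside_no_overlap[of "path_image \<gamma>01"] by blast
qed

lemma contour_integral_regular:
  assumes g: "g holomorphic_on - (branch_cuts \<alpha> \<union> branch_cuts \<beta>)"
    and eq: "\<And>w. w \<in> - (branch_cuts \<alpha> \<union> branch_cuts \<beta>) - {1} \<Longrightarrow> f w = g w"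
  shows "(f has_contour_integral 0) \<gamma>1"
proof -
  have "open (- (branch_cuts \<alpha> \<union> branch_cuts \<beta>))"
    by (intro open_Compl closed_Un closed_branch_cuts)
  then have "(g has_contour_integral 0) \<gamma>1"
    by (rule Cauchy_theorem_global) (use g \<gamma>1 in auto)
  then show ?thesis
  proof (rule has_contour_integral_eq)
    fix x assume "x \<in> path_image \<gamma>1"
    then have "x \<in> - (branch_cuts \<alpha> \<union> branch_cuts \<beta>) - {1}" using \<gamma>1(4) by blast
    then show "g x = f x" by (rule eq[symmetric])
  qed
qed

lemma contour_integrable_\<gamma>1:
  assumes "f holomorphic_on - (branch_cuts \<alpha> \<union> branch_cuts \<beta>) - {1}"
  shows "f contour_integrable_on \<gamma>1"
proof -
  have "open (- (branch_cuts \<alpha> \<union> branch_cuts \<beta>) - {1})"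
    by (intro open_delete open_Compl closed_Un closed_branch_cuts)
  then show ?thesis
    by (rule contour_integrable_holomorphic_simple[OF assms]) (use \<gamma>1 in auto)
qed

lemma contour_integrable_\<gamma>01:
  assumes "f holomorphic_on - {0, 1}"
  shows "f contour_integrable_on \<gamma>01"
proof -
  have "open (- {0, 1 :: complex})" by (intro open_Compl finite_imp_closed) simp
  then show ?thesis
    by (rule contour_integrable_holomorphic_simple[OF assms]) (use \<gamma>01 in auto)
qed

text \<open>
  Both contours wind once around the only singularity.
\<close>

lemma contour_integral_\<gamma>01_eq_\<gamma>1:
  assumes "f holomorphic_on - {1}"
  shows "contour_integral \<gamma>01 f = contour_integral \<gamma>1 f"
proof -
  have "contour_integral \<gamma>01 f = 2 * pi * \<i> * (\<Sum>p\<in>{1}. winding_number \<gamma>01 p * residue f p)"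
    by (rule Residue_theorem[of UNIV]) (use assms \<gamma>01 in \<open>auto simp: Compl_eq_Diff_UNIV\<close>)
  moreover have "contour_integral \<gamma>1 f = 2 * pi * \<i> * (\<Sum>p\<in>{1}. winding_number \<gamma>1 p * residue f p)"
    by (rule Residue_theorem[of UNIV]) (use assms \<gamma>1 in \<open>auto simp: Compl_eq_Diff_UNIV\<close>)
  ultimately show ?thesis using \<gamma>01(3)[of 1] \<gamma>1(3) by simp
qed

text \<open>
  The contour may be replaced by arbitrarily large circles, on which the integrals tend to 0.
\<close>

lemma contour_integral_\<gamma>01_decay:
  assumes f: "f holomorphic_on - {0, 1}" and B: "\<And>z. 2 \<le> cmod z \<Longrightarrow> cmod (f z) \<le> B / (cmod z)\<^sup>2"
  shows "contour_integral \<gamma>01 f = 0"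
proof -
  have B0: "0 \<le> B"
  proof -
    have "0 \<le> B / (cmod 2)\<^sup>2" by (rule order_trans[OF norm_ge_zero B[of 2]]) simp
    then show ?thesis by simp
  qed
  have bound: "cmod (contour_integral \<gamma>01 f) \<le> 2 * pi * B / r" if r: "2 \<le> r" for r
  proof -
    let ?c = "circlepath 0 r"
    have img: "path_image ?c = sphere 0 r" using r by simp
    have w: "winding_number ?c p = 1" if "p \<in> {0, 1}" for p
      using that r by (intro winding_number_circlepath) auto
    have "contour_integral \<gamma>01 f = 2 * pi * \<i> * (\<Sum>p\<in>{0, 1}. winding_number \<gamma>01 p * residue f p)"
      by (rule Residue_theorem[of UNIV]) (use f \<gamma>01 in \<open>auto simp: Compl_eq_Diff_UNIV\<close>)
    moreover have "contour_integral ?c f = 2 * pi * \<i> * (\<Sum>p\<in>{0, 1}. winding_number ?c p * residue f p)"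
      by (rule Residue_theorem[of UNIV]) (use f r in \<open>auto simp: Compl_eq_Diff_UNIV img\<close>)
    ultimately have eq: "contour_integral \<gamma>01 f = contour_integral ?c f"
      using \<gamma>01(3)[of 0] \<gamma>01(3)[of 1] w[of 0] w[of 1] by simp
    have op: "open (- {0, 1 :: complex})" by (intro open_Compl finite_imp_closed) simp
    have "f contour_integrable_on ?c"
      by (rule contour_integrable_holomorphic_simple[OF f op]) (use r in \<open>auto simp: img\<close>)
    then have "cmod (contour_integral ?c f) \<le> B / r\<^sup>2 * (2 * pi * r)"
      by (intro has_contour_integral_bound_circlepath[OF has_contour_integral_integral])
        (use B B0 r in \<open>auto simp: dist_norm\<close>)
    also have "\<dots> = 2 * pi * B / r" using r by (simp add: power2_eq_square)
    finally show ?thesis unfolding eq .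
  qed
  have "cmod (contour_integral \<gamma>01 f) \<le> 0"
  proof (rule field_le_epsilon)
    fix \<delta> :: real assume \<delta>: "0 < \<delta>"
    define r where "r = max 2 (2 * pi * B / \<delta>)"
    have r: "2 \<le> r" "2 * pi * B / \<delta> \<le> r" by (simp_all add: r_def)
    then have "2 * pi * B / r \<le> \<delta>" using \<delta> by (simp add: field_simps)
    then show "cmod (contour_integral \<gamma>01 f) \<le> 0 + \<delta>" using bound[OF r(1)] by linarith
  qed
  then show ?thesis by simp
qed

lemma has_contour_integral_inverse_power:
  "((\<lambda>z. 1 / z ^ Suc n) has_contour_integral (if n = 0 then 2 * pi * \<i> else 0)) \<gamma>01"
proof (cases n)
  case 0
  have "((\<lambda>z. 1 / (z - 0)) has_contour_integral (2 * pi * \<i> * winding_number \<gamma>01 0)) \<gamma>01"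
    by (rule has_contour_integral_winding_number) (use \<gamma>01 in auto)
  then show ?thesis using 0 \<gamma>01(3)[of 0] by simp
next
  case (Suc k)
  have "((\<lambda>z. 1 / z ^ Suc n) has_contour_integral
    (- 1 / (of_nat n * (pathfinish \<gamma>01) ^ n)) - (- 1 / (of_nat n * (pathstart \<gamma>01) ^ n))) \<gamma>01"
  proof (rule contour_integral_primitive[where S = "- {0}"])
    fix z :: complex assume z: "z \<in> - {0}"
    define c where "c = (of_nat n :: complex)"
    have c: "c \<noteq> 0" using Suc by (simp add: c_def del: of_nat_Suc)
    define y where "y = z ^ (n - 1)"
    have y: "y \<noteq> 0" "z ^ n = z * y" "z ^ Suc n = z * (z * y)"
      using z Suc by (simp_all add: y_def)
    have "((\<lambda>z. z ^ n) has_field_derivative c * y) (at z within - {0})"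
      unfolding c_def y_def using DERIV_power[OF DERIV_ident, of n z "- {0}"] by simp
    then have "((\<lambda>z. - 1 / (c * z ^ n)) has_field_derivative (c * (c * y)) / (c * z ^ n)\<^sup>2) (at z within - {0})"
      using z c unfolding y_def c_def by (auto intro!: derivative_eq_intros simp: power2_eq_square)
    moreover have "(c * (c * y)) / (c * z ^ n)\<^sup>2 = 1 / z ^ Suc n"
      unfolding y(2,3) using z c y(1) by (simp add: power2_eq_square)
    ultimately show "((\<lambda>z. - 1 / (of_nat n * z ^ n)) has_field_derivative 1 / z ^ Suc n) (at z within - {0})"
      unfolding c_def by simp
  qed (use \<gamma>01 in auto)
  then show ?thesis using \<gamma>01(2) Suc by simp
qed

text \<open>
  Dividing by \<open>z^n\<close> and integrating against the Cauchy kernel removes the \<open>n\<close> lowest coefficients: the contour surrounds all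
  poles of \<open>1 / (z^k (z - w))\<close> for \<open>k > 0\<close>, so these terms contribute nothing.
\<close>

lemma has_contour_integral_poly_shift:
  assumes w: "w \<in> path_image \<gamma>1" "w \<noteq> 0"
  shows "((\<lambda>z. poly p z / (z ^ n * (z - w))) has_contour_integral 2 * pi * \<i> * poly (poly_shift n p) w) \<gamma>01"
proof -
  have base: "((\<lambda>z. poly p z / (z - w)) has_contour_integral 2 * pi * \<i> * poly p w) \<gamma>01" for p
  proof -
    have "((\<lambda>z. poly p z / (z - w)) has_contour_integral (2 * pi * \<i> * winding_number \<gamma>01 w * poly p w)) \<gamma>01"
      by (rule Cauchy_integral_formula_global[of UNIV])
        (use \<gamma>01 w in \<open>auto intro!: holomorphic_intros\<close>)
    then show ?thesis using \<gamma>01(3)[of w] w by simp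
  qed
  have one: "((\<lambda>z. 1 / (z ^ n * (z - w))) has_contour_integral (if n = 0 then 2 * pi * \<i> else 0)) \<gamma>01" for n
  proof (induction n)
    case 0
    then show ?case using base[of 1] by simp
  next
    case (Suc n)
    \<comment> \<open>Partial fractions lower the power of \<open>z\<close> by one.\<close>
    have "((\<lambda>z. (1 / (z ^ n * (z - w)) - 1 / z ^ Suc n) / w) has_contour_integral
      ((if n = 0 then 2 * pi * \<i> else 0) - (if n = 0 then 2 * pi * \<i> else 0)) / w) \<gamma>01"
      by (intro has_contour_integral_div has_contour_integral_diff Suc has_contour_integral_inverse_power)
    then have "((\<lambda>z. (1 / (z ^ n * (z - w)) - 1 / z ^ Suc n) / w) has_contour_integral 0) \<gamma>01"
      by simp
    then have "((\<lambda>z. 1 / (z ^ Suc n * (z - w))) has_contour_integral 0) \<gamma>01"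
    proof (rule has_contour_integral_eq)
      fix z assume "z \<in> path_image \<gamma>01"
      then have z: "z \<noteq> 0" "z \<noteq> w" using \<gamma>01(4)[of 0] \<gamma>01(4)[of w] w by auto
      then have "1 / (z ^ n * (z - w)) - 1 / z ^ Suc n = w / (z ^ Suc n * (z - w))"
        by (simp add: field_simps)
      then show "(1 / (z ^ n * (z - w)) - 1 / z ^ Suc n) / w = 1 / (z ^ Suc n * (z - w))"
        using w(2) by simp
    qed
    then show ?case by simp
  qed
  show ?thesis
  proof (induction n arbitrary: p)
    case 0
    then show ?case using base by simp
  next
    case (Suc n)
    obtain a q where p: "p = pCons a q" by (cases p)
    have shift: "poly_shift (Suc n) p = poly_shift n q"
      by (simp add: p poly_eq_iff coeff_poly_shift)
    have "((\<lambda>z. a * (1 / (z ^ Suc n * (z - w))) + poly q z / (z ^ n * (z - w)))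
      has_contour_integral a * 0 + 2 * pi * \<i> * poly (poly_shift n q) w) \<gamma>01"
      using one[of "Suc n"] by (intro has_contour_integral_add has_contour_integral_lmul Suc) simp
    then have "((\<lambda>z. poly p z / (z ^ Suc n * (z - w))) has_contour_integral a * 0 + 2 * pi * \<i> * poly (poly_shift n q) w) \<gamma>01"
    proof (rule has_contour_integral_eq)
      fix z assume "z \<in> path_image \<gamma>01"
      then have "z \<noteq> 0" "z \<noteq> w" using \<gamma>01(4)[of 0] \<gamma>01(4)[of w] w by auto
      then show "a * (1 / (z ^ Suc n * (z - w))) + poly q z / (z ^ n * (z - w)) = poly p z / (z ^ Suc n * (z - w))"
        by (simp add: p add_divide_distrib)
    qed
    then show ?case unfolding shift by simp
  qed
qed

end

section \<open>Degrees and growth of products of half steps\<close>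

text \<open>
  Polynomial entries of degree at most \<open>d\<close>, up to the value at 1, where the functions to which this is applied divide by zero.
\<close>

definition poly_m2 :: "nat \<Rightarrow> (complex \<Rightarrow> m2) \<Rightarrow> bool" where
  "poly_m2 d f \<longleftrightarrow> (\<exists>P. \<forall>i j. degree (P i j) \<le> d \<and> (\<forall>z. z \<noteq> 1 \<longrightarrow> ent (f z) i j = poly (P i j) z))"

lemma poly_m2_mult:
  assumes "poly_m2 d f" "poly_m2 d' g"
  shows "poly_m2 (d + d') (\<lambda>z. f z * g z)"
proof -
  obtain P Q where P: "\<And>i j. degree (P i j) \<le> d" "\<And>i j z. z \<noteq> 1 \<Longrightarrow> ent (f z) i j = poly (P i j) z"
    and Q: "\<And>i j. degree (Q i j) \<le> d'" "\<And>i j z. z \<noteq> 1 \<Longrightarrow> ent (g z) i j = poly (Q i j) z"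
    using assms unfolding poly_m2_def by metis
  have deg: "degree (P i l * Q l j) \<le> d + d'" for i l j
    using degree_mult_le[of "P i l" "Q l j"] P(1)[of i l] Q(1)[of l j] by linarith
  show ?thesis unfolding poly_m2_def
    by (rule exI[of _ "\<lambda>i j. P i 0 * Q 0 j + P i 1 * Q 1 j"])
      (auto simp: ent_simps(6) P(2) Q(2) intro: degree_add_le deg)
qed

lemma poly_m2_cong: "poly_m2 d g \<Longrightarrow> (\<And>z. z \<noteq> 1 \<Longrightarrow> f z = g z) \<Longrightarrow> poly_m2 d f"
  unfolding poly_m2_def by simp

lemma poly_m2_M2:
  assumes "degree p \<le> d" "degree q \<le> d" "degree r \<le> d" "degree s \<le> d"
  shows "poly_m2 d (\<lambda>z. M2 (poly p z) (poly q z) (poly r z) (poly s z))"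
  unfolding poly_m2_def
  by (rule exI[of _ "\<lambda>i j. if i = 0 then if j = 0 then p else q else if j = 0 then r else s"])
    (use assms in \<open>auto simp: ent_M2\<close>)

lemma poly_m2_one: "poly_m2 0 (\<lambda>z. 1)"
  using poly_m2_M2[of 1 0 0 0 1] by (simp add: one_m2_def)

lemma poly_m2_sc: "poly_m2 k (\<lambda>z. sc ((z - 1) ^ k))"
proof -
  have "degree ([:-1, 1:] ^ k :: complex poly) \<le> k"
    using degree_power_le[of "[:-1, 1:] :: complex poly" k] by simp
  from poly_m2_M2[OF this _ _ this, of 0 0] show ?thesis by (simp add: sc_def)
qed

lemma sc_cancel: "z \<noteq> 1 \<Longrightarrow> sc (z - 1) * (sc (1 / (z - 1)) * A) = A"
  by (simp add: mult.assoc[symmetric] sc_simps(4)[symmetric] sc_simps(1))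

lemma poly_m2_step: "poly_m2 1 (\<lambda>z. sc (z - 1) * step \<epsilon> z)" "poly_m2 1 (\<lambda>z. sc (z - 1) * unstep \<epsilon> z)"
proof -
  have M: "poly_m2 1 (\<lambda>z. M2 (1 + z) a (b * z) (1 + z))" for a b
    using poly_m2_M2[of "[:1, 1:]" 1 "[:a:]" "[:0, b:]" "[:1, 1:]"] by (simp add: mult.commute)
  show "poly_m2 1 (\<lambda>z. sc (z - 1) * step \<epsilon> z)" "poly_m2 1 (\<lambda>z. sc (z - 1) * unstep \<epsilon> z)"
    by (rule poly_m2_cong[OF M]; simp only: step_def unstep_def; rule sc_cancel; assumption)+
qed

lemma sc_power_mult: "sc (x ^ Suc k) * (A * B) = (sc (x ^ k) * A) * (sc x * B)"
  by (metis mult.assoc power_Suc2 sc_commute sc_simps(4))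

lemma poly_m2_walk:
  "poly_m2 k (\<lambda>z. sc ((z - 1) ^ k) * walk eps j k z)" "poly_m2 k (\<lambda>z. sc ((z - 1) ^ k) * walk_inv eps j k z)"
proof -
  show "poly_m2 k (\<lambda>z. sc ((z - 1) ^ k) * walk eps j k z)"
  proof (induction k)
    case 0
    then show ?case using poly_m2_one by (simp add: sc_simps)
  next
    case (Suc k)
    have "poly_m2 (Suc k) (\<lambda>z. (sc ((z - 1) ^ k) * walk eps j k z) * (sc (z - 1) * step (eps (j + k)) z))"
      using poly_m2_mult[OF Suc poly_m2_step(1)[of "eps (j + k)"]] by (simp only: Suc_eq_plus1)
    then show ?case by (rule poly_m2_cong) (simp only: walk.simps sc_power_mult)
  qed
  show "poly_m2 k (\<lambda>z. sc ((z - 1) ^ k) * walk_inv eps j k z)"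
  proof (induction k)
    case 0
    then show ?case using poly_m2_one by (simp add: sc_simps)
  next
    case (Suc k)
    have "sc ((z - 1) ^ Suc k) * walk_inv eps j (Suc k) z
      = (sc (z - 1) * unstep (eps (j + k)) z) * (sc ((z - 1) ^ k) * walk_inv eps j k z)" for z
      by (metis mult.assoc power_Suc sc_commute sc_simps(4) walk_inv.simps(2))
    then show ?case
      using poly_m2_mult[OF poly_m2_step(2)[of "eps (j + k)"] Suc] by simp
  qed
qed

text \<open>
  Boundedness near infinity; the radius 2 keeps the pole at 1 at a distance.
\<close>

definition bounded_m2 :: "(complex \<Rightarrow> m2) \<Rightarrow> bool" where
  "bounded_m2 f \<longleftrightarrow> (\<exists>B. \<forall>z i j. 2 \<le> cmod z \<longrightarrow> cmod (ent (f z) i j) \<le> B)"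

lemma bounded_m2_mult:
  assumes "bounded_m2 f" "bounded_m2 g"
  shows "bounded_m2 (\<lambda>z. f z * g z)"
proof -
  obtain B C where B: "\<And>z i j. 2 \<le> cmod z \<Longrightarrow> cmod (ent (f z) i j) \<le> B"
    and C: "\<And>z i j. 2 \<le> cmod z \<Longrightarrow> cmod (ent (g z) i j) \<le> C"
    using assms unfolding bounded_m2_def by metis
  have "cmod (ent (f z) i l * ent (g z) l j) \<le> B * C" if "2 \<le> cmod z" for z i j l
    unfolding norm_mult
    by (rule mult_mono[OF B[OF that] C[OF that]]) (use order_trans[OF norm_ge_zero B[OF that]] in auto)
  then have "cmod (ent (f z * g z) i j) \<le> B * C + B * C" if "2 \<le> cmod z" for z i j
    unfolding ent_simps(6) using that by (intro norm_triangle_le add_mono) auto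
  then show ?thesis unfolding bounded_m2_def by blast
qed

lemma bounded_m2_step: "bounded_m2 (step \<epsilon>)"
proof -
  define a b :: complex where "a = of_real (2 * \<epsilon>\<^sup>2)" and "b = of_real (2 / \<epsilon>\<^sup>2)"
  \<comment> \<open>For \<open>\<bar>z\<bar> \<ge> 2\<close>, both \<open>\<bar>1 + z\<bar> / 3\<close> and \<open>\<bar>z\<bar> / 2\<close> are at most \<open>\<bar>z - 1\<bar>\<close>.\<close>
  define B where "B = 3 + cmod a + 2 * cmod b"
  have "cmod (ent (step \<epsilon> z) i j) \<le> B" if z: "2 \<le> cmod z" for z i j
  proof -
    have m: "cmod z - 1 \<le> cmod (z - 1)" using norm_triangle_ineq2[of z 1] by simp
    then have pos: "0 < cmod (z - 1)" "1 \<le> cmod (z - 1)" "cmod z \<le> 2 * cmod (z - 1)" using z by auto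
    have 1: "cmod ((1 + z) / (z - 1)) \<le> B"
    proof -
      have "cmod (1 + z) \<le> 1 + cmod z" using norm_triangle_ineq[of 1 z] by simp
      also have "\<dots> \<le> 3 * cmod (z - 1)" using pos by linarith
      also have "\<dots> \<le> B * cmod (z - 1)" using pos by (intro mult_right_mono) (auto simp: B_def)
      finally show ?thesis using pos(1) by (simp add: norm_divide divide_le_eq)
    qed
    have 2: "cmod (a / (z - 1)) \<le> B"
    proof -
      have "cmod a * 1 \<le> B * cmod (z - 1)" using pos by (intro mult_mono) (auto simp: B_def)
      then show ?thesis using pos(1) by (simp add: norm_divide divide_le_eq)
    qed
    have 3: "cmod (b * z / (z - 1)) \<le> B"
    proof -
      have "cmod b * cmod z \<le> cmod b * (2 * cmod (z - 1))" using pos by (intro mult_left_mono) auto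
      also have "\<dots> = (2 * cmod b) * cmod (z - 1)" by simp
      also have "\<dots> \<le> B * cmod (z - 1)" using pos by (intro mult_right_mono) (auto simp: B_def)
      finally show ?thesis using pos(1) by (simp add: norm_divide norm_mult divide_le_eq)
    qed
    have "ent (step \<epsilon> z) i j = (if i = 0 then if j = 0 then (1 + z) / (z - 1) else a / (z - 1)
      else if j = 0 then b * z / (z - 1) else (1 + z) / (z - 1))"
      unfolding step_def ent_simps(4) ent_M2 a_def b_def by simp
    then show ?thesis using 1 2 3 by simp
  qed
  then show ?thesis unfolding bounded_m2_def by blast
qed

lemma bounded_m2_walk: "bounded_m2 (walk eps j k)"
proof (induction k)
  case 0
  have "cmod (ent 1 i j) \<le> 1" for i j by (simp add: one_m2_def ent_M2)
  then show ?case unfolding bounded_m2_def walk.simps by blast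
next
  case (Suc k)
  have "walk eps j (Suc k) = (\<lambda>z. walk eps j k z * step (eps (j + k)) z)" by (rule ext) simp
  then show ?case using bounded_m2_mult[OF Suc bounded_m2_step[of "eps (j + k)"]] by simp
qed

lemma holomorphic_m2_mult:
  assumes "holomorphic_m2 f A" "holomorphic_m2 g A"
  shows "holomorphic_m2 (\<lambda>w. f w * g w) A"
  using assms unfolding holomorphic_m2_def ent_simps by (auto intro!: holomorphic_intros)

lemma holomorphic_m2_diff:
  assumes "holomorphic_m2 f A" "holomorphic_m2 g A"
  shows "holomorphic_m2 (\<lambda>w. f w - g w) A"
  using assms unfolding holomorphic_m2_def ent_simps by (auto intro!: holomorphic_intros)

lemma holomorphic_m2_one: "holomorphic_m2 (\<lambda>w. 1) A"
  unfolding one_m2_def by (intro holomorphic_m2_M2 holomorphic_on_const)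

lemma holomorphic_m2_step:
  assumes "1 \<notin> A" shows "holomorphic_m2 (step \<epsilon>) A" "holomorphic_m2 (unstep \<epsilon>) A"
proof -
  have "(\<lambda>z. 1 / (z - 1)) holomorphic_on A" using assms by (intro holomorphic_intros) auto
  note hol = holomorphic_m2_mult[OF holomorphic_m2_sc[OF this] holomorphic_m2_M2]
  show "holomorphic_m2 (step \<epsilon>) A"
    unfolding step_def[abs_def] by (rule hol; intro holomorphic_intros)
  show "holomorphic_m2 (unstep \<epsilon>) A"
    unfolding unstep_def[abs_def] by (rule hol; intro holomorphic_intros)
qed

lemma holomorphic_m2_walk:
  assumes "1 \<notin> A" shows "holomorphic_m2 (walk eps j k) A" "holomorphic_m2 (walk_inv eps j k) A"
proof -
  show "holomorphic_m2 (walk eps j k) A"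
  proof (induction k)
    case 0 show ?case using holomorphic_m2_one by simp
  next
    case (Suc k)
    have "walk eps j (Suc k) = (\<lambda>z. walk eps j k z * step (eps (j + k)) z)" by (rule ext) simp
    then show ?case using holomorphic_m2_mult[OF Suc holomorphic_m2_step(1)[OF assms]] by simp
  qed
  show "holomorphic_m2 (walk_inv eps j k) A"
  proof (induction k)
    case 0 show ?case using holomorphic_m2_one by simp
  next
    case (Suc k)
    have "walk_inv eps j (Suc k) = (\<lambda>z. unstep (eps (j + k)) z * walk_inv eps j k z)" by (rule ext) simp
    then show ?case using holomorphic_m2_mult[OF holomorphic_m2_step(2)[OF assms] Suc] by simp
  qed
qed

lemma holomorphic_m2_power:
  assumes "holomorphic_m2 f A"
  shows "holomorphic_m2 (\<lambda>w. f w ^ k) A"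
  by (induction k) (simp_all add: holomorphic_m2_one holomorphic_m2_mult assms)

section \<open>The factors of the double integrals\<close>

context split_model
begin

text \<open>
  The factors that depend on \<open>w\<close> in the two double integrals, with the large eigenvalue written as the inverse of \<open>rho\<close>.
\<close>

definition factor1 :: "nat \<Rightarrow> complex \<Rightarrow> m2" where
  "factor1 m w = (if m \<le> T then sc (inverse (rho \<alpha> w) ^ (T - m)) * pr1 \<alpha> w * phi \<beta> w ^ (h - T)
     else sc (rho \<beta> w powi (int m - int h)) * pr1 \<beta> w)"

definition factor2 :: "nat \<Rightarrow> complex \<Rightarrow> m2" where
  "factor2 m w = (if m \<le> T
     then sc (rho \<alpha> w ^ (T - m) * c_fun \<alpha> \<beta> w) * (pr2 \<alpha> w * pr1 \<beta> w * pr1 \<alpha> w) * phi \<beta> w ^ (h - T)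
     else sc (rho \<beta> w powi (int h + int m - 2 * int T) * c_fun \<alpha> \<beta> w) * (pr1 \<beta> w * pr1 \<alpha> w * pr2 \<beta> w))"

lemma holomorphic_factors: "holomorphic_m2 (factor1 m) (cut_domain - {1})" "holomorphic_m2 (factor2 m) (cut_domain - {1})"
proof -
  have nz: "rho \<alpha> w \<noteq> 0" "rho \<beta> w \<noteq> 0" if "w \<in> cut_domain - {1}" for w using rho_nonzero[OF that] .
  have hr: "rho \<alpha> holomorphic_on cut_domain - {1}" "rho \<beta> holomorphic_on cut_domain - {1}" "c_fun \<alpha> \<beta> holomorphic_on cut_domain - {1}"
    using holomorphic_parts by (auto intro: holomorphic_on_subset)
  have hp: "holomorphic_m2 (pr1 \<alpha>) (cut_domain - {1})" "holomorphic_m2 (pr1 \<beta>) (cut_domain - {1})"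
    using holomorphic_pr1 \<alpha> \<beta> cut_domain_disjoint by (auto simp: Diff_Int_distrib2)
  have hp2: "holomorphic_m2 (pr2 \<alpha>) (cut_domain - {1})" "holomorphic_m2 (pr2 \<beta>) (cut_domain - {1})"
    unfolding pr2_def[abs_def] by (intro holomorphic_m2_diff holomorphic_m2_one hp)+
  have hphi: "holomorphic_m2 (\<lambda>w. phi \<beta> w ^ k) (cut_domain - {1})" for k
    unfolding phi_def by (intro holomorphic_m2_power holomorphic_m2_mult holomorphic_m2_step) auto
  have 1: "(\<lambda>w. inverse (rho \<alpha> w) ^ k) holomorphic_on cut_domain - {1}" for k
    using nz by (intro holomorphic_intros hr) auto
  have 2: "(\<lambda>w. rho \<beta> w powi k) holomorphic_on cut_domain - {1}" for k
    using nz by (intro holomorphic_intros hr) auto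
  have 3: "(\<lambda>w. rho \<alpha> w ^ k * c_fun \<alpha> \<beta> w) holomorphic_on cut_domain - {1}" for k
    by (intro holomorphic_intros hr)
  have 4: "(\<lambda>w. rho \<beta> w powi k * c_fun \<alpha> \<beta> w) holomorphic_on cut_domain - {1}" for k
    by (intro holomorphic_intros hr 2)
  show "holomorphic_m2 (factor1 m) (cut_domain - {1})"
    by (cases "m \<le> T") (auto simp: factor1_def[abs_def] intro!: holomorphic_m2_mult holomorphic_m2_sc hp hphi 1 2)
  show "holomorphic_m2 (factor2 m) (cut_domain - {1})"
    by (cases "m \<le> T") (auto simp: factor2_def[abs_def] intro!: holomorphic_m2_mult holomorphic_m2_sc hp hp2 hphi 3 4)
qed

lemma phi_mult_inv:
  assumes "w \<noteq> 1"
  shows "phi \<alpha> w ^ k * phi_inv \<alpha> w ^ k = 1" "phi \<beta> w ^ k * phi_inv \<beta> w ^ k = 1"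
    "phi_inv \<alpha> w ^ k * phi \<alpha> w ^ k = 1" "phi_inv \<beta> w ^ k * phi \<beta> w ^ k = 1"
proof -
  have *: "A ^ k * B ^ k = 1" if "A * B = 1" for A B :: m2
  proof (induction k)
    case (Suc k)
    have "A ^ Suc k * B ^ Suc k = A ^ k * (A * B) * B ^ k"
      by (simp only: power_Suc2[of A] power_Suc[of B] mult.assoc)
    then show ?case using Suc that by simp
  qed simp
  have nz: "\<alpha> \<noteq> 0" "\<beta> \<noteq> 0" using \<alpha> \<beta> by auto
  show "phi \<alpha> w ^ k * phi_inv \<alpha> w ^ k = 1" "phi \<beta> w ^ k * phi_inv \<beta> w ^ k = 1"
    "phi_inv \<alpha> w ^ k * phi \<alpha> w ^ k = 1" "phi_inv \<beta> w ^ k * phi \<beta> w ^ k = 1"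
    by (rule *[OF phi_inverse(1)[OF assms nz(1)]] *[OF phi_inverse(1)[OF assms nz(2)]]
        *[OF phi_inverse(2)[OF assms nz(1)]] *[OF phi_inverse(2)[OF assms nz(2)]])+
qed

text \<open>
  Multiplied by the inverse of the walk to the middle and the walk to the primed column, the two factors add up to the projection, because all powers of the
  eigenvalues cancel except those in \<open>proj\<close>.
\<close>

lemma factors_eq_proj:
  assumes w: "w \<in> cut_domain - {1}" and m: "0 < m"
  shows "(factor1 m w + factor2 m w) * walk_inv eps 0 (2 * h) w * walk eps 0 (2 * m) w = proj m w"
proof -
  have w1: "w \<noteq> 1" using w by simp
  show ?thesis
  proof (cases "m \<le> T")
    case True
    have wm: "walk eps 0 (2 * m) w = phi \<alpha> w ^ m" using walk_alpha[of 0 m w] True by simp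
    have split: "phi_inv \<alpha> w ^ T = phi_inv \<alpha> w ^ (T - m) * phi_inv \<alpha> w ^ m"
      using True by (simp flip: power_add)
    have tail: "phi \<beta> w ^ (h - T) * (phi_inv \<beta> w ^ (h - T) * phi_inv \<alpha> w ^ T) * phi \<alpha> w ^ m = phi_inv \<alpha> w ^ (T - m)"
    proof -
      have "phi \<beta> w ^ (h - T) * (phi_inv \<beta> w ^ (h - T) * phi_inv \<alpha> w ^ T) * phi \<alpha> w ^ m
        = (phi \<beta> w ^ (h - T) * phi_inv \<beta> w ^ (h - T)) * phi_inv \<alpha> w ^ (T - m) * (phi_inv \<alpha> w ^ m * phi \<alpha> w ^ m)"
        unfolding split by (simp only: mult.assoc)
      then show ?thesis by (simp add: phi_mult_inv[OF w1])
    qed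
    let ?B = "sc (inverse (rho \<alpha> w) ^ (T - m)) * pr1 \<alpha> w
      + sc (rho \<alpha> w ^ (T - m) * c_fun \<alpha> \<beta> w) * (pr2 \<alpha> w * pr1 \<beta> w * pr1 \<alpha> w)"
    have "(factor1 m w + factor2 m w) * walk_inv eps 0 (2 * h) w * walk eps 0 (2 * m) w
      = ?B * (phi \<beta> w ^ (h - T) * (phi_inv \<beta> w ^ (h - T) * phi_inv \<alpha> w ^ T) * phi \<alpha> w ^ m)"
      unfolding walk_inv_full wm using True by (simp add: factor1_def factor2_def distrib_right mult.assoc)
    also have "\<dots> = sc (inverse (rho \<alpha> w) ^ (T - m) * rho \<alpha> w ^ (T - m)) * pr1 \<alpha> w
      + sc (c_fun \<alpha> \<beta> w * (rho \<alpha> w ^ (T - m) * rho \<alpha> w ^ (T - m))) * (pr2 \<alpha> w * pr1 \<beta> w * pr1 \<alpha> w)"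
      unfolding tail by (simp add: distrib_right sc_move mult_ac pr_power[OF w])
    also have "inverse (rho \<alpha> w) ^ (T - m) * rho \<alpha> w ^ (T - m) = 1"
      using rho_nonzero[OF w] by (simp add: power_mult_distrib[symmetric])
    also have "rho \<alpha> w ^ (T - m) * rho \<alpha> w ^ (T - m) = rho \<alpha> w ^ (2 * (T - m))"
      by (simp flip: power_add mult_2)
    finally show ?thesis using True by (simp add: proj_def sc_simps(1))
  next
    case False
    have wm: "walk eps 0 (2 * m) w = phi \<alpha> w ^ T * phi \<beta> w ^ (m - T)"
      using walk_add[of eps 0 "2 * T" "2 * (m - T)" w] walk_alpha[of 0 T w] walk_beta[of T "m - T" w] False
      by (simp add: algebra_simps)
    have tail: "phi_inv \<beta> w ^ (h - T) * phi_inv \<alpha> w ^ T * (phi \<alpha> w ^ T * phi \<beta> w ^ (m - T))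
      = phi_inv \<beta> w ^ (h - T) * phi \<beta> w ^ (m - T)"
    proof -
      have "phi_inv \<beta> w ^ (h - T) * phi_inv \<alpha> w ^ T * (phi \<alpha> w ^ T * phi \<beta> w ^ (m - T))
        = phi_inv \<beta> w ^ (h - T) * (phi_inv \<alpha> w ^ T * phi \<alpha> w ^ T) * phi \<beta> w ^ (m - T)"
        by (simp only: mult.assoc)
      then show ?thesis by (simp add: phi_mult_inv[OF w1])
    qed
    let ?r = "rho \<beta> w"
    have r: "?r \<noteq> 0" by (rule rho_nonzero(2)[OF w])
    have p1: "pr1 \<beta> w * (phi_inv \<beta> w ^ (h - T) * phi \<beta> w ^ (m - T)) = sc (?r ^ (h - T) * inverse ?r ^ (m - T)) * pr1 \<beta> w"
      by (simp add: mult.assoc[symmetric] pr_power[OF w]) (simp add: mult.assoc pr_power[OF w] sc_move)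
    have p2: "pr2 \<beta> w * (phi_inv \<beta> w ^ (h - T) * phi \<beta> w ^ (m - T)) = sc (inverse ?r ^ (h - T) * ?r ^ (m - T)) * pr2 \<beta> w"
      by (simp add: mult.assoc[symmetric] pr_power[OF w]) (simp add: mult.assoc pr_power[OF w] sc_move)
    have nat_power: "?r ^ (a - b) = ?r powi (int a - int b)" "inverse ?r ^ (a - b) = ?r powi (int b - int a)"
      if "b \<le> a" for a b :: nat
    proof -
      have 1: "int a - int b = int (a - b)" "int b - int a = - int (a - b)" using that by simp_all
      show "?r ^ (a - b) = ?r powi (int a - int b)" "inverse ?r ^ (a - b) = ?r powi (int b - int a)"
        unfolding 1 by (simp_all only: power_int_of_nat power_int_minus power_inverse)
    qed
    have e1: "?r powi (int m - int h) * (?r ^ (h - T) * inverse ?r ^ (m - T)) = 1"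
    proof -
      have "?r powi (int m - int h) * (?r powi (int h - int T) * ?r powi (int T - int m))
        = ?r powi ((int m - int h) + ((int h - int T) + (int T - int m)))"
        using r by (simp only: power_int_add simp_thms)
      then show ?thesis using nat_power(1)[of T h] nat_power(2)[of T m] T False by simp
    qed
    have e2: "?r powi (int h + int m - 2 * int T) * (inverse ?r ^ (h - T) * ?r ^ (m - T)) = ?r ^ (2 * (m - T))"
    proof -
      have "?r powi (int h + int m - 2 * int T) * (?r powi (int T - int h) * ?r powi (int m - int T))
        = ?r powi ((int h + int m - 2 * int T) + ((int T - int h) + (int m - int T)))"
        using r by (simp only: power_int_add simp_thms)
      also have "(int h + int m - 2 * int T) + ((int T - int h) + (int m - int T)) = int (2 * m) - int (2 * T)"
        by simp
      also have "?r powi (int (2 * m) - int (2 * T)) = ?r ^ (2 * (m - T))"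
        using nat_power(1)[of "2 * T" "2 * m"] False by (simp add: right_diff_distrib')
      finally show ?thesis using nat_power(2)[of T h] nat_power(1)[of T m] T False by simp
    qed
    have "(factor1 m w + factor2 m w) * walk_inv eps 0 (2 * h) w * walk eps 0 (2 * m) w
      = (factor1 m w + factor2 m w) * (phi_inv \<beta> w ^ (h - T) * phi \<beta> w ^ (m - T))"
      unfolding walk_inv_full wm using tail by (simp only: mult.assoc)
    also have "\<dots> = sc (?r powi (int m - int h)) * (pr1 \<beta> w * (phi_inv \<beta> w ^ (h - T) * phi \<beta> w ^ (m - T)))
      + sc (?r powi (int h + int m - 2 * int T) * c_fun \<alpha> \<beta> w) * (pr1 \<beta> w * pr1 \<alpha> w * (pr2 \<beta> w * (phi_inv \<beta> w ^ (h - T) * phi \<beta> w ^ (m - T))))"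
      using False by (simp only: factor1_def factor2_def if_False distrib_right mult.assoc)
    also have "\<dots> = sc (?r powi (int m - int h) * (?r ^ (h - T) * inverse ?r ^ (m - T))) * pr1 \<beta> w
      + sc (c_fun \<alpha> \<beta> w * (?r powi (int h + int m - 2 * int T) * (inverse ?r ^ (h - T) * ?r ^ (m - T)))) * (pr1 \<beta> w * pr1 \<alpha> w * pr2 \<beta> w)"
      unfolding p1 p2 by (simp add: sc_move mult_ac)
    also have "\<dots> = proj m w"
      unfolding e1 e2 using False by (simp add: proj_def sc_simps(1))
    finally show ?thesis .
  qed
qed

text \<open>
  The walk from the middle of the diamond to the column \<open>j\<close>, cleared of its poles at 1.
\<close>

definition cleared_walk :: "nat \<Rightarrow> complex \<Rightarrow> m2" where
  "cleared_walk j z = sc ((z - 1) ^ (2 * h)) * (walk_inv eps 0 (2 * h) z * walk eps 0 j z)"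

lemma cleared_walk_Suc: "cleared_walk (Suc j) z = cleared_walk j z * step (eps j) z"
  by (simp add: cleared_walk_def mult.assoc)

text \<open>
  At most \<open>2 h\<close> half steps lead from the middle to any column, each with a simple pole at 1 and growth of degree 0 at infinity. The
  remaining factors \<open>z - 1\<close> are polynomials of degree 1.
\<close>

lemma poly_cleared_walk:
  assumes "j \<le> 4 * h"
  shows "poly_m2 (2 * h) (cleared_walk j)"
proof (cases "j \<le> 2 * h")
  case True
  have sum: "j + (2 * h - j) = 2 * h" using True by simp
  have "poly_m2 (j + (2 * h - j)) (\<lambda>z. sc ((z - 1) ^ j) * (sc ((z - 1) ^ (2 * h - j)) * walk_inv eps j (2 * h - j) z))"
    by (intro poly_m2_mult poly_m2_sc poly_m2_walk)
  then show ?thesis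
    unfolding sum
  proof (rule poly_m2_cong)
    fix z :: complex assume z: "z \<noteq> 1"
    have "walk_inv eps 0 (2 * h) z * walk eps 0 j z = walk_inv eps j (2 * h - j) z * (walk_inv eps 0 j z * walk eps 0 j z)"
      using walk_inv_add[of 0 j "2 * h - j" z] True by (simp add: mult.assoc)
    also have "\<dots> = walk_inv eps j (2 * h - j) z"
      using walk_inverse(2)[OF z, of eps 0 j] eps_nonzero by simp
    finally show "cleared_walk j z = sc ((z - 1) ^ j) * (sc ((z - 1) ^ (2 * h - j)) * walk_inv eps j (2 * h - j) z)"
      using True by (simp add: cleared_walk_def sc_move power_add[symmetric])
  qed
next
  case False
  then have j: "2 * h \<le> j" by simp
  have sum: "(4 * h - j) + (j - 2 * h) = 2 * h" using j assms by simp
  have "poly_m2 ((4 * h - j) + (j - 2 * h)) (\<lambda>z. sc ((z - 1) ^ (4 * h - j)) * (sc ((z - 1) ^ (j - 2 * h)) * walk eps (2 * h) (j - 2 * h) z))"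
    by (intro poly_m2_mult poly_m2_sc poly_m2_walk)
  then show ?thesis
    unfolding sum
  proof (rule poly_m2_cong)
    fix z :: complex assume z: "z \<noteq> 1"
    have "walk_inv eps 0 (2 * h) z * walk eps 0 j z = (walk_inv eps 0 (2 * h) z * walk eps 0 (2 * h) z) * walk eps (2 * h) (j - 2 * h) z"
      using walk_add[of eps 0 "2 * h" "j - 2 * h" z] j by (simp add: mult.assoc)
    also have "\<dots> = walk eps (2 * h) (j - 2 * h) z"
      using walk_inverse(2)[OF z, of eps 0 "2 * h"] eps_nonzero by simp
    finally show "cleared_walk j z = sc ((z - 1) ^ (4 * h - j)) * (sc ((z - 1) ^ (j - 2 * h)) * walk eps (2 * h) (j - 2 * h) z)"
      using sum by (simp add: cleared_walk_def sc_move power_add[symmetric])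
  qed
qed

lemma factors_cleared_before:
  assumes w: "w \<in> cut_domain - {1}" and m: "0 < m" and j: "j \<le> 2 * m"
  shows "(factor1 m w + factor2 m w) * cleared_walk j w = sc ((w - 1) ^ (2 * h)) * (proj m w * walk_inv eps j (2 * m - j) w)"
proof -
  have w1: "w \<noteq> 1" using w by simp
  have "walk eps 0 (2 * m) w * walk_inv eps j (2 * m - j) w = walk eps 0 j w * (walk eps j (2 * m - j) w * walk_inv eps j (2 * m - j) w)"
    using walk_add[of eps 0 j "2 * m - j" w] j by (simp add: mult.assoc)
  then have "walk eps 0 j w = walk eps 0 (2 * m) w * walk_inv eps j (2 * m - j) w"
    using walk_inverse(1)[OF w1, of eps j "2 * m - j"] eps_nonzero by simp
  then have "(factor1 m w + factor2 m w) * cleared_walk j w = sc ((w - 1) ^ (2 * h)) *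
      (((factor1 m w + factor2 m w) * walk_inv eps 0 (2 * h) w * walk eps 0 (2 * m) w) * walk_inv eps j (2 * m - j) w)"
    unfolding cleared_walk_def by (subst sc_left_commute) (simp only: mult.assoc)
  then show ?thesis unfolding factors_eq_proj[OF w m] .
qed

lemma factors_cleared_after:
  assumes w: "w \<in> cut_domain - {1}" and m: "0 < m" and j: "2 * m \<le> j"
  shows "(factor1 m w + factor2 m w) * cleared_walk j w = sc ((w - 1) ^ (2 * h)) * (proj m w * walk eps (2 * m) (j - 2 * m) w)"
proof -
  have "walk eps 0 j w = walk eps 0 (2 * m) w * walk eps (2 * m) (j - 2 * m) w"
    using walk_add[of eps 0 "2 * m" "j - 2 * m" w] j by simp
  then have "(factor1 m w + factor2 m w) * cleared_walk j w = sc ((w - 1) ^ (2 * h)) *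
      (((factor1 m w + factor2 m w) * walk_inv eps 0 (2 * h) w * walk eps 0 (2 * m) w) * walk eps (2 * m) (j - 2 * m) w)"
    unfolding cleared_walk_def by (subst sc_left_commute) (simp only: mult.assoc)
  then show ?thesis unfolding factors_eq_proj[OF w m] .
qed

end

section \<open>The contour-integral formula\<close>

text \<open>
  The primed point has column \<open>4 m\<close> and its second coordinate is \<open>2 (K - 2 h) + r\<close>; so \<open>K\<close> is \<open>\<xi>' + N\<close>, and \<open>r\<close> selects the row of
  the blocks.
\<close>

locale kernel_setup = split_model \<alpha> \<beta> T h + contour_pair \<alpha> \<beta> \<gamma>1 \<gamma>01
  for \<alpha> \<beta> :: real and T h :: nat and \<gamma>1 \<gamma>01 :: "real \<Rightarrow> complex" +
  fixes m K r :: nat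
  assumes m: "0 < m" "m < 2 * h" and K: "K < 2 * h" and r: "r < 2"
begin

definition cleared_poly :: "nat \<Rightarrow> nat \<Rightarrow> nat \<Rightarrow> complex poly" where
  "cleared_poly j = (SOME p. \<forall>i l. degree (p i l) \<le> 2 * h \<and> (\<forall>z. z \<noteq> 1 \<longrightarrow> ent (cleared_walk j z) i l = poly (p i l) z))"

lemma cleared_poly:
  assumes "j \<le> 4 * h"
  shows "degree (cleared_poly j i l) \<le> 2 * h" "z \<noteq> 1 \<Longrightarrow> ent (cleared_walk j z) i l = poly (cleared_poly j i l) z"
  using someI_ex[OF poly_cleared_walk[OF assms, unfolded poly_m2_def]] unfolding cleared_poly_def by blast+

definition outer_factor :: "(nat \<Rightarrow> complex \<Rightarrow> m2) \<Rightarrow> complex \<Rightarrow> m2" where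
  "outer_factor A w = sc (w ^ K / (w - 1) ^ (2 * h)) * A m w"

text \<open>
  The integral over \<open>w\<close> as a linear functional of the polynomial that results from the integral over \<open>z\<close>.
\<close>

definition outer_integral :: "(nat \<Rightarrow> complex \<Rightarrow> m2) \<Rightarrow> nat \<Rightarrow> complex poly \<Rightarrow> complex" where
  "outer_integral A l p = contour_integral \<gamma>1 (\<lambda>w. ent (outer_factor A w) r l * poly p w) / (2 * pi * \<i>)"

definition admissible_factor :: "(nat \<Rightarrow> complex \<Rightarrow> m2) \<Rightarrow> bool" where
  "admissible_factor A \<longleftrightarrow> holomorphic_m2 (A m) (cut_domain - {1})"

lemma admissible_factors: "admissible_factor factor1" "admissible_factor factor2"
  unfolding admissible_factor_def by (rule holomorphic_factors)+

lemma holomorphic_outer_factor: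
  assumes "admissible_factor A"
  shows "(\<lambda>w. ent (outer_factor A w) r l) holomorphic_on cut_domain - {1}"
  using assms unfolding admissible_factor_def holomorphic_m2_def outer_factor_def ent_simps(4)
  by (auto intro!: holomorphic_intros)

lemma cut_domain_eq: "cut_domain - {1} = - (branch_cuts \<alpha> \<union> branch_cuts \<beta>) - {1}"
  by (simp add: cut_domain_def)

lemma integrable_outer_factor:
  assumes "admissible_factor A"
  shows "(\<lambda>w. ent (outer_factor A w) r l * poly p w) contour_integrable_on \<gamma>1"
  by (rule contour_integrable_\<gamma>1, unfold cut_domain_eq[symmetric]) (intro holomorphic_intros holomorphic_outer_factor assms)

lemma outer_integral_add: "admissible_factor A \<Longrightarrow> outer_integral A l (p + q) = outer_integral A l p + outer_integral A l q"
  unfolding outer_integral_def by (simp add: distrib_left contour_integral_add integrable_outer_factor add_divide_distrib)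

lemma outer_integral_smult: "admissible_factor A \<Longrightarrow> outer_integral A l (Polynomial.smult c p) = c * outer_integral A l p"
proof -
  assume A: "admissible_factor A"
  have "contour_integral \<gamma>1 (\<lambda>w. ent (outer_factor A w) r l * poly (Polynomial.smult c p) w)
    = contour_integral \<gamma>1 (\<lambda>w. c * (ent (outer_factor A w) r l * poly p w))"
    by (rule contour_integral_cong) (auto simp: mult_ac)
  also have "\<dots> = c * contour_integral \<gamma>1 (\<lambda>w. ent (outer_factor A w) r l * poly p w)"
    by (rule contour_integral_lmul[OF integrable_outer_factor[OF A]])
  finally show ?thesis by (simp add: outer_integral_def)
qed

lemma outer_integral_zero: "outer_integral A l 0 = 0"
  by (simp add: outer_integral_def)

text \<open>
  One double integral after evaluation of its inner integral, for the black column \<open>j\<close>, with \<open>n = \<xi> + N + 1\<close>. The fictitious rows are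
  \<open>n = 0\<close> below and \<open>n = 2 h + 1\<close> above the diamond.
\<close>

definition double_part :: "(nat \<Rightarrow> complex \<Rightarrow> m2) \<Rightarrow> nat \<Rightarrow> nat \<Rightarrow> nat \<Rightarrow> complex" where
  "double_part A j n i = outer_integral A 0 (poly_shift n (cleared_poly j 0 i)) + outer_integral A 1 (poly_shift n (cleared_poly j 1 i))"

lemma double_integral_eq_double_part:
  assumes A: "admissible_factor A" and j: "j \<le> 4 * h"
  shows "contour_integral \<gamma>1 (\<lambda>w. contour_integral \<gamma>01 (\<lambda>z.
      1 / (z * (z - w)) * ((w ^ K * (z - 1) ^ (2 * h)) / (z ^ n * (w - 1) ^ (2 * h)))
      * ent (A m w * (walk_inv eps 0 (2 * h) z * walk eps 0 j z)) r i)) / (2 * pi * \<i>) ^ 2 = double_part A j (Suc n) i"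
proof -
  let ?p = "\<lambda>l. poly_shift (Suc n) (cleared_poly j l i)"
  have inner: "contour_integral \<gamma>01 (\<lambda>z.
      1 / (z * (z - w)) * ((w ^ K * (z - 1) ^ (2 * h)) / (z ^ n * (w - 1) ^ (2 * h)))
      * ent (A m w * (walk_inv eps 0 (2 * h) z * walk eps 0 j z)) r i)
    = 2 * pi * \<i> * (ent (outer_factor A w) r 0 * poly (?p 0) w + ent (outer_factor A w) r 1 * poly (?p 1) w)"
    if w: "w \<in> path_image \<gamma>1" for w
  proof (rule contour_integral_unique)
    have wU: "w \<in> cut_domain - {1}" using \<gamma>1(4) w unfolding cut_domain_eq by blast
    have w0: "w \<noteq> 0" using cutsD(1)[of w] wU not_in_branch_cuts(1)[of w \<alpha>] \<alpha> by auto
    let ?E = "\<lambda>l. ent (outer_factor A w) r l"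
    have "((\<lambda>z. ?E 0 * (poly (cleared_poly j 0 i) z / (z ^ Suc n * (z - w))) + ?E 1 * (poly (cleared_poly j 1 i) z / (z ^ Suc n * (z - w))))
      has_contour_integral ?E 0 * (2 * pi * \<i> * poly (?p 0) w) + ?E 1 * (2 * pi * \<i> * poly (?p 1) w)) \<gamma>01"
      by (intro has_contour_integral_add has_contour_integral_lmul has_contour_integral_poly_shift w w0)
    then have "((\<lambda>z. 1 / (z * (z - w)) * ((w ^ K * (z - 1) ^ (2 * h)) / (z ^ n * (w - 1) ^ (2 * h)))
      * ent (A m w * (walk_inv eps 0 (2 * h) z * walk eps 0 j z)) r i)
      has_contour_integral ?E 0 * (2 * pi * \<i> * poly (?p 0) w) + ?E 1 * (2 * pi * \<i> * poly (?p 1) w)) \<gamma>01"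
    proof (rule has_contour_integral_eq)
      fix z assume "z \<in> path_image \<gamma>01"
      then have z: "z \<noteq> 1" using \<gamma>01(4)[of 1] by auto
      let ?W = "walk_inv eps 0 (2 * h) z * walk eps 0 j z"
      have P': "poly (cleared_poly j l i) z = (z - 1) ^ (2 * h) * ent ?W l i" for l
        using cleared_poly(2)[OF j z, of l i] by (simp add: cleared_walk_def ent_simps(4))
      have "?E 0 * (poly (cleared_poly j 0 i) z / (z ^ Suc n * (z - w))) + ?E 1 * (poly (cleared_poly j 1 i) z / (z ^ Suc n * (z - w)))
        = (w ^ K / (w - 1) ^ (2 * h)) * (z - 1) ^ (2 * h) / (z ^ Suc n * (z - w))
          * (ent (A m w) r 0 * ent ?W 0 i + ent (A m w) r 1 * ent ?W 1 i)"
        unfolding P' outer_factor_def ent_simps(4) by (simp add: distrib_left add_divide_distrib mult_ac)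
      also have "ent (A m w) r 0 * ent ?W 0 i + ent (A m w) r 1 * ent ?W 1 i = ent (A m w * ?W) r i"
        by (rule ent_simps(6)[symmetric])
      finally show "?E 0 * (poly (cleared_poly j 0 i) z / (z ^ Suc n * (z - w))) + ?E 1 * (poly (cleared_poly j 1 i) z / (z ^ Suc n * (z - w)))
        = 1 / (z * (z - w)) * ((w ^ K * (z - 1) ^ (2 * h)) / (z ^ n * (w - 1) ^ (2 * h))) * ent (A m w * ?W) r i"
        by (simp add: mult_ac)
    qed
    then show "((\<lambda>z. 1 / (z * (z - w)) * ((w ^ K * (z - 1) ^ (2 * h)) / (z ^ n * (w - 1) ^ (2 * h)))
      * ent (A m w * (walk_inv eps 0 (2 * h) z * walk eps 0 j z)) r i)
      has_contour_integral 2 * pi * \<i> * (?E 0 * poly (?p 0) w + ?E 1 * poly (?p 1) w)) \<gamma>01"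
      by (simp add: algebra_simps)
  qed
  have "contour_integral \<gamma>1 (\<lambda>w. contour_integral \<gamma>01 (\<lambda>z.
      1 / (z * (z - w)) * ((w ^ K * (z - 1) ^ (2 * h)) / (z ^ n * (w - 1) ^ (2 * h)))
      * ent (A m w * (walk_inv eps 0 (2 * h) z * walk eps 0 j z)) r i))
    = contour_integral \<gamma>1 (\<lambda>w. 2 * pi * \<i> * (ent (outer_factor A w) r 0 * poly (?p 0) w + ent (outer_factor A w) r 1 * poly (?p 1) w))"
    by (rule contour_integral_eq) (rule inner)
  also have "\<dots> = 2 * pi * \<i> * (contour_integral \<gamma>1 (\<lambda>w. ent (outer_factor A w) r 0 * poly (?p 0) w)
      + contour_integral \<gamma>1 (\<lambda>w. ent (outer_factor A w) r 1 * poly (?p 1) w))"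
    by (simp add: contour_integral_lmul contour_integral_add contour_integrable_add integrable_outer_factor[OF A])
  finally have eq: "contour_integral \<gamma>1 (\<lambda>w. contour_integral \<gamma>01 (\<lambda>z.
      1 / (z * (z - w)) * ((w ^ K * (z - 1) ^ (2 * h)) / (z ^ n * (w - 1) ^ (2 * h)))
      * ent (A m w * (walk_inv eps 0 (2 * h) z * walk eps 0 j z)) r i))
    = 2 * pi * \<i> * (contour_integral \<gamma>1 (\<lambda>w. ent (outer_factor A w) r 0 * poly (?p 0) w)
      + contour_integral \<gamma>1 (\<lambda>w. ent (outer_factor A w) r 1 * poly (?p 1) w))" .
  have "c * (x + y) / c ^ 2 = x / c + y / c" if "c \<noteq> 0" for c x y :: complex
    using that by (simp add: power2_eq_square add_divide_distrib)
  then show ?thesis unfolding eq double_part_def outer_integral_def by simp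
qed

text \<open>
  The single integral, in the same coordinates.
\<close>

definition transition_part :: "nat \<Rightarrow> nat \<Rightarrow> nat \<Rightarrow> complex" where
  "transition_part j n i = contour_integral \<gamma>01 (\<lambda>z. z ^ K / z ^ n * ent (walk eps (2 * m) (j - 2 * m) z) r i) / (2 * pi * \<i>)"

definition formula :: "nat \<Rightarrow> nat \<Rightarrow> nat \<Rightarrow> complex" where
  "formula j n i = double_part factor1 j n i + double_part factor2 j n i - (if 2 * m < j then transition_part j n i else 0)"

lemma holomorphic_walk_ent: "(\<lambda>z. z ^ K / z ^ n * ent (walk eps j k z) i l) holomorphic_on - {0, 1}"
  using holomorphic_m2_walk(1)[of "- {0, 1}" eps j k] unfolding holomorphic_m2_def
  by (auto intro!: holomorphic_intros)

lemma integrable_walk_ent: "(\<lambda>z. z ^ K / z ^ n * ent (walk eps j k z) i l) contour_integrable_on \<gamma>01"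
  by (intro contour_integrable_\<gamma>01 holomorphic_walk_ent)

text \<open>
  One half step is the solution of the Kasteleyn equations at the white vertices of the column, for
  generating functions: multiplication by \<open>z\<close> shifts the row by one.
\<close>

lemma step_relations:
  assumes "z \<noteq> 1" "Y = X * step (eps j) z"
  shows "of_real ((eps j)\<^sup>2) * ent X i 0 + z * ent X i 1 + of_real ((eps j)\<^sup>2) * ent Y i 0 - z * ent Y i 1 = 0"
    "ent X i 0 + of_real (1 / (eps j)\<^sup>2) * ent X i 1 - ent Y i 0 + of_real (1 / (eps j)\<^sup>2) * ent Y i 1 = 0"
proof -
  define a b :: complex where "a = of_real ((eps j)\<^sup>2)" and "b = of_real (1 / (eps j)\<^sup>2)"
  \<comment> \<open>Modulo this identity, both relations times \<open>z - 1\<close> hold identically in the entries of \<open>X\<close>.\<close>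
  have ab: "a * b = 1" using eps_nonzero[of j] by (simp add: a_def b_def)
  have "of_real (2 * (eps j)\<^sup>2) = 2 * a" "of_real (2 / (eps j)\<^sup>2) = 2 * b" by (simp_all add: a_def b_def)
  have Y: "(z - 1) * ent Y i 0 = ent X i 0 * (1 + z) + ent X i 1 * (2 * b * z)"
    "(z - 1) * ent Y i 1 = ent X i 0 * (2 * a) + ent X i 1 * (1 + z)"
  proof -
    have "Y = sc (1 / (z - 1)) * (X * M2 (1 + z) (of_real (2 * (eps j)\<^sup>2)) (of_real (2 / (eps j)\<^sup>2) * z) (1 + z))"
      unfolding assms(2) step_def by (rule sc_left_commute)
    then have Y': "ent Y i l = 1 / (z - 1) * ent (X * M2 (1 + z) (2 * a) (2 * b * z) (1 + z)) i l" for l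
      by (simp only: ent_simps(4) \<open>of_real (2 * (eps j)\<^sup>2) = 2 * a\<close> \<open>of_real (2 / (eps j)\<^sup>2) = 2 * b\<close>)
    show "(z - 1) * ent Y i 0 = ent X i 0 * (1 + z) + ent X i 1 * (2 * b * z)"
      "(z - 1) * ent Y i 1 = ent X i 0 * (2 * a) + ent X i 1 * (1 + z)"
      unfolding Y' ent_simps(6) ent_M2 using assms(1) by simp_all
  qed
  have 1: "(z - 1) * (a * ent X i 0 + z * ent X i 1 + a * ent Y i 0 - z * ent Y i 1) = 0"
  proof -
    have "(z - 1) * (a * ent X i 0 + z * ent X i 1 + a * ent Y i 0 - z * ent Y i 1)
      = (z - 1) * (a * ent X i 0 + z * ent X i 1) + a * ((z - 1) * ent Y i 0) - z * ((z - 1) * ent Y i 1)"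
      by (simp add: algebra_simps)
    also have "\<dots> = 2 * z * ent X i 1 * (a * b - 1)" unfolding Y by (simp add: algebra_simps)
    finally show ?thesis using ab by simp
  qed
  have 2: "(z - 1) * (ent X i 0 + b * ent X i 1 - ent Y i 0 + b * ent Y i 1) = 0"
  proof -
    have "(z - 1) * (ent X i 0 + b * ent X i 1 - ent Y i 0 + b * ent Y i 1)
      = (z - 1) * (ent X i 0 + b * ent X i 1) - (z - 1) * ent Y i 0 + b * ((z - 1) * ent Y i 1)"
      by (simp add: algebra_simps)
    also have "\<dots> = 2 * ent X i 0 * (a * b - 1)" unfolding Y by (simp add: algebra_simps)
    finally show ?thesis using ab by simp
  qed
  show "of_real ((eps j)\<^sup>2) * ent X i 0 + z * ent X i 1 + of_real ((eps j)\<^sup>2) * ent Y i 0 - z * ent Y i 1 = 0"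
    using 1 assms(1) unfolding a_def by simp
  show "ent X i 0 + of_real (1 / (eps j)\<^sup>2) * ent X i 1 - ent Y i 0 + of_real (1 / (eps j)\<^sup>2) * ent Y i 1 = 0"
    using 2 assms(1) unfolding b_def by simp
qed

lemma poly_eq_zeroI:
  fixes p :: "complex poly"
  assumes "\<And>z. z \<noteq> 1 \<Longrightarrow> poly p z = 0"
  shows "p = 0"
proof (rule ccontr)
  assume "p \<noteq> 0"
  then have "finite {z. poly p z = 0}" by (rule poly_roots_finite)
  moreover have "UNIV - {1} \<subseteq> {z. poly p z = 0}" using assms by auto
  ultimately have "finite (UNIV - {1 :: complex})" by (rule rev_finite_subset)
  then show False using infinite_UNIV_char_0[where 'a = complex] by simp
qed

lemma cleared_poly_relations:
  assumes j: "Suc j \<le> 4 * h"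
  shows "Polynomial.smult (of_real ((eps j)\<^sup>2)) (cleared_poly j l 0) + pCons 0 (cleared_poly j l 1)
      + Polynomial.smult (of_real ((eps j)\<^sup>2)) (cleared_poly (Suc j) l 0) - pCons 0 (cleared_poly (Suc j) l 1) = 0"
    "cleared_poly j l 0 + Polynomial.smult (of_real (1 / (eps j)\<^sup>2)) (cleared_poly j l 1) - cleared_poly (Suc j) l 0
      + Polynomial.smult (of_real (1 / (eps j)\<^sup>2)) (cleared_poly (Suc j) l 1) = 0"
proof -
  have rel: "of_real ((eps j)\<^sup>2) * ent (cleared_walk j z) l 0 + z * ent (cleared_walk j z) l 1 + of_real ((eps j)\<^sup>2) * ent (cleared_walk (Suc j) z) l 0 - z * ent (cleared_walk (Suc j) z) l 1 = 0"
    "ent (cleared_walk j z) l 0 + of_real (1 / (eps j)\<^sup>2) * ent (cleared_walk j z) l 1 - ent (cleared_walk (Suc j) z) l 0 + of_real (1 / (eps j)\<^sup>2) * ent (cleared_walk (Suc j) z) l 1 = 0"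
    if "z \<noteq> 1" for z
    using step_relations[OF that cleared_walk_Suc[of j z]] by blast+
  have P': "ent (cleared_walk j z) l i = poly (cleared_poly j l i) z" "ent (cleared_walk (Suc j) z) l i = poly (cleared_poly (Suc j) l i) z" if "z \<noteq> 1" for z i
    using cleared_poly(2)[of j z l i] cleared_poly(2)[of "Suc j" z l i] j that by auto
  show "Polynomial.smult (of_real ((eps j)\<^sup>2)) (cleared_poly j l 0) + pCons 0 (cleared_poly j l 1)
      + Polynomial.smult (of_real ((eps j)\<^sup>2)) (cleared_poly (Suc j) l 0) - pCons 0 (cleared_poly (Suc j) l 1) = 0"
    by (rule poly_eq_zeroI) (use rel(1) P' in simp)
  show "cleared_poly j l 0 + Polynomial.smult (of_real (1 / (eps j)\<^sup>2)) (cleared_poly j l 1) - cleared_poly (Suc j) l 0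
      + Polynomial.smult (of_real (1 / (eps j)\<^sup>2)) (cleared_poly (Suc j) l 1) = 0"
    by (rule poly_eq_zeroI) (use rel(2) P' in simp)
qed

lemma double_part_relations:
  assumes A: "admissible_factor A" and j: "Suc j \<le> 4 * h"
  shows "of_real ((eps j)\<^sup>2) * double_part A j (Suc n) 0 + double_part A j n 1
      + of_real ((eps j)\<^sup>2) * double_part A (Suc j) (Suc n) 0 - double_part A (Suc j) n 1 = 0"
    "double_part A j n 0 + of_real (1 / (eps j)\<^sup>2) * double_part A j n 1 - double_part A (Suc j) n 0
      + of_real (1 / (eps j)\<^sup>2) * double_part A (Suc j) n 1 = 0"
proof -
  let ?a = "of_real ((eps j)\<^sup>2) :: complex" and ?b = "of_real (1 / (eps j)\<^sup>2) :: complex"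
  have diff: "outer_integral A l (p - q) = outer_integral A l p - outer_integral A l q" for l p q
    using outer_integral_add[OF A, of l "p - q" q] by simp
  have shift1: "Polynomial.smult ?a (poly_shift (Suc n) (cleared_poly j l 0)) + poly_shift n (cleared_poly j l 1)
      + Polynomial.smult ?a (poly_shift (Suc n) (cleared_poly (Suc j) l 0)) - poly_shift n (cleared_poly (Suc j) l 1) = 0" for l
  proof (rule poly_eqI)
    fix i
    have "coeff (Polynomial.smult ?a (cleared_poly j l 0) + pCons 0 (cleared_poly j l 1)
      + Polynomial.smult ?a (cleared_poly (Suc j) l 0) - pCons 0 (cleared_poly (Suc j) l 1)) (Suc (i + n)) = 0"
      unfolding cleared_poly_relations[OF j] by simp
    then show "coeff (Polynomial.smult ?a (poly_shift (Suc n) (cleared_poly j l 0)) + poly_shift n (cleared_poly j l 1)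
      + Polynomial.smult ?a (poly_shift (Suc n) (cleared_poly (Suc j) l 0)) - poly_shift n (cleared_poly (Suc j) l 1)) i = coeff 0 i"
      by (simp add: coeff_poly_shift)
  qed
  have shift2: "poly_shift n (cleared_poly j l 0) + Polynomial.smult ?b (poly_shift n (cleared_poly j l 1)) - poly_shift n (cleared_poly (Suc j) l 0)
      + Polynomial.smult ?b (poly_shift n (cleared_poly (Suc j) l 1)) = 0" for l
  proof (rule poly_eqI)
    fix i
    have "coeff (cleared_poly j l 0 + Polynomial.smult ?b (cleared_poly j l 1) - cleared_poly (Suc j) l 0
      + Polynomial.smult ?b (cleared_poly (Suc j) l 1)) (i + n) = 0"
      unfolding cleared_poly_relations[OF j] by simp
    then show "coeff (poly_shift n (cleared_poly j l 0) + Polynomial.smult ?b (poly_shift n (cleared_poly j l 1)) - poly_shift n (cleared_poly (Suc j) l 0)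
      + Polynomial.smult ?b (poly_shift n (cleared_poly (Suc j) l 1))) i = coeff 0 i"
      by (simp add: coeff_poly_shift)
  qed
  have 1: "?a * outer_integral A l (poly_shift (Suc n) (cleared_poly j l 0)) + outer_integral A l (poly_shift n (cleared_poly j l 1))
      + ?a * outer_integral A l (poly_shift (Suc n) (cleared_poly (Suc j) l 0)) - outer_integral A l (poly_shift n (cleared_poly (Suc j) l 1)) = 0" for l
    using arg_cong[OF shift1[of l], of "outer_integral A l"] by (simp only: diff outer_integral_add[OF A] outer_integral_smult[OF A] outer_integral_zero)
  have 2: "outer_integral A l (poly_shift n (cleared_poly j l 0)) + ?b * outer_integral A l (poly_shift n (cleared_poly j l 1)) - outer_integral A l (poly_shift n (cleared_poly (Suc j) l 0))
      + ?b * outer_integral A l (poly_shift n (cleared_poly (Suc j) l 1)) = 0" for l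
    using arg_cong[OF shift2[of l], of "outer_integral A l"] by (simp only: diff outer_integral_add[OF A] outer_integral_smult[OF A] outer_integral_zero)
  have "?a * double_part A j (Suc n) 0 + double_part A j n 1 + ?a * double_part A (Suc j) (Suc n) 0 - double_part A (Suc j) n 1
    = (?a * outer_integral A 0 (poly_shift (Suc n) (cleared_poly j 0 0)) + outer_integral A 0 (poly_shift n (cleared_poly j 0 1))
      + ?a * outer_integral A 0 (poly_shift (Suc n) (cleared_poly (Suc j) 0 0)) - outer_integral A 0 (poly_shift n (cleared_poly (Suc j) 0 1)))
    + (?a * outer_integral A 1 (poly_shift (Suc n) (cleared_poly j 1 0)) + outer_integral A 1 (poly_shift n (cleared_poly j 1 1))
      + ?a * outer_integral A 1 (poly_shift (Suc n) (cleared_poly (Suc j) 1 0)) - outer_integral A 1 (poly_shift n (cleared_poly (Suc j) 1 1)))"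
    unfolding double_part_def by (simp add: algebra_simps)
  then show "?a * double_part A j (Suc n) 0 + double_part A j n 1 + ?a * double_part A (Suc j) (Suc n) 0 - double_part A (Suc j) n 1 = 0"
    unfolding 1 by simp
  have "double_part A j n 0 + ?b * double_part A j n 1 - double_part A (Suc j) n 0 + ?b * double_part A (Suc j) n 1
    = (outer_integral A 0 (poly_shift n (cleared_poly j 0 0)) + ?b * outer_integral A 0 (poly_shift n (cleared_poly j 0 1)) - outer_integral A 0 (poly_shift n (cleared_poly (Suc j) 0 0))
      + ?b * outer_integral A 0 (poly_shift n (cleared_poly (Suc j) 0 1)))
    + (outer_integral A 1 (poly_shift n (cleared_poly j 1 0)) + ?b * outer_integral A 1 (poly_shift n (cleared_poly j 1 1)) - outer_integral A 1 (poly_shift n (cleared_poly (Suc j) 1 0))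
      + ?b * outer_integral A 1 (poly_shift n (cleared_poly (Suc j) 1 1)))"
    unfolding double_part_def by (simp add: algebra_simps)
  then show "double_part A j n 0 + ?b * double_part A j n 1 - double_part A (Suc j) n 0 + ?b * double_part A (Suc j) n 1 = 0"
    unfolding 2 by simp
qed

lemma transition_part_relations:
  assumes j: "2 * m \<le> j"
  shows "of_real ((eps j)\<^sup>2) * transition_part j (Suc n) 0 + transition_part j n 1 + of_real ((eps j)\<^sup>2) * transition_part (Suc j) (Suc n) 0 - transition_part (Suc j) n 1 = 0"
    "transition_part j n 0 + of_real (1 / (eps j)\<^sup>2) * transition_part j n 1 - transition_part (Suc j) n 0 + of_real (1 / (eps j)\<^sup>2) * transition_part (Suc j) n 1 = 0"
proof -
  let ?a = "of_real ((eps j)\<^sup>2) :: complex" and ?b = "of_real (1 / (eps j)\<^sup>2) :: complex"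
  define X where "X = walk eps (2 * m) (j - 2 * m)"
  define Y where "Y = walk eps (2 * m) (Suc j - 2 * m)"
  have YX: "Y z = X z * step (eps j) z" for z
    using j by (simp add: X_def Y_def Suc_diff_le)
  have int: "(\<lambda>z. z ^ K / z ^ n * ent (X z) i l) contour_integrable_on \<gamma>01"
    "(\<lambda>z. z ^ K / z ^ n * ent (Y z) i l) contour_integrable_on \<gamma>01" for n i l
    unfolding X_def Y_def by (rule integrable_walk_ent)+
  note has = int[THEN has_contour_integral_integral]
  let ?I = "\<lambda>W n i. contour_integral \<gamma>01 (\<lambda>z. z ^ K / z ^ n * ent (W z) r i)"
  have CI: "transition_part j n i = ?I X n i / (2 * pi * \<i>)" "transition_part (Suc j) n i = ?I Y n i / (2 * pi * \<i>)" for n i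
    by (simp_all add: transition_part_def X_def Y_def)
  have img: "z \<noteq> 0" "z \<noteq> 1" if "z \<in> path_image \<gamma>01" for z
    using \<gamma>01(4)[of 0] \<gamma>01(4)[of 1] that by auto
  have "((\<lambda>z. ?a * (z ^ K / z ^ Suc n * ent (X z) r 0) + z ^ K / z ^ n * ent (X z) r 1
      + ?a * (z ^ K / z ^ Suc n * ent (Y z) r 0) - z ^ K / z ^ n * ent (Y z) r 1)
    has_contour_integral ?a * ?I X (Suc n) 0 + ?I X n 1 + ?a * ?I Y (Suc n) 0 - ?I Y n 1) \<gamma>01"
    by (intro has_contour_integral_add has_contour_integral_diff has_contour_integral_lmul has)
  moreover have "((\<lambda>z. ?a * (z ^ K / z ^ Suc n * ent (X z) r 0) + z ^ K / z ^ n * ent (X z) r 1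
      + ?a * (z ^ K / z ^ Suc n * ent (Y z) r 0) - z ^ K / z ^ n * ent (Y z) r 1)
    has_contour_integral 0) \<gamma>01"
  proof (rule has_contour_integral_eq[OF has_contour_integral_0])
    fix z assume z: "z \<in> path_image \<gamma>01"
    have "?a * (z ^ K / z ^ Suc n * ent (X z) r 0) + z ^ K / z ^ n * ent (X z) r 1
      + ?a * (z ^ K / z ^ Suc n * ent (Y z) r 0) - z ^ K / z ^ n * ent (Y z) r 1
      = z ^ K / z ^ Suc n * (?a * ent (X z) r 0 + z * ent (X z) r 1 + ?a * ent (Y z) r 0 - z * ent (Y z) r 1)"
      using img[OF z] by (simp add: field_simps)
    also have "\<dots> = 0" unfolding step_relations(1)[OF img(2)[OF z] YX] by simp
    finally show "0 = ?a * (z ^ K / z ^ Suc n * ent (X z) r 0) + z ^ K / z ^ n * ent (X z) r 1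
      + ?a * (z ^ K / z ^ Suc n * ent (Y z) r 0) - z ^ K / z ^ n * ent (Y z) r 1" by simp
  qed
  ultimately have "?a * ?I X (Suc n) 0 + ?I X n 1 + ?a * ?I Y (Suc n) 0 - ?I Y n 1 = 0"
    by (rule has_contour_integral_unique)
  then have "(?a * ?I X (Suc n) 0 + ?I X n 1 + ?a * ?I Y (Suc n) 0 - ?I Y n 1) / (2 * pi * \<i>) = 0" by simp
  then show "?a * transition_part j (Suc n) 0 + transition_part j n 1 + ?a * transition_part (Suc j) (Suc n) 0 - transition_part (Suc j) n 1 = 0"
    unfolding CI by (simp only: add_divide_distrib diff_divide_distrib times_divide_eq_right)
  have "((\<lambda>z. z ^ K / z ^ n * ent (X z) r 0 + ?b * (z ^ K / z ^ n * ent (X z) r 1)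
      - z ^ K / z ^ n * ent (Y z) r 0 + ?b * (z ^ K / z ^ n * ent (Y z) r 1))
    has_contour_integral ?I X n 0 + ?b * ?I X n 1 - ?I Y n 0 + ?b * ?I Y n 1) \<gamma>01"
    by (intro has_contour_integral_add has_contour_integral_diff has_contour_integral_lmul has)
  moreover have "((\<lambda>z. z ^ K / z ^ n * ent (X z) r 0 + ?b * (z ^ K / z ^ n * ent (X z) r 1)
      - z ^ K / z ^ n * ent (Y z) r 0 + ?b * (z ^ K / z ^ n * ent (Y z) r 1)) has_contour_integral 0) \<gamma>01"
  proof (rule has_contour_integral_eq[OF has_contour_integral_0])
    fix z assume z: "z \<in> path_image \<gamma>01"
    have "z ^ K / z ^ n * ent (X z) r 0 + ?b * (z ^ K / z ^ n * ent (X z) r 1)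
      - z ^ K / z ^ n * ent (Y z) r 0 + ?b * (z ^ K / z ^ n * ent (Y z) r 1)
      = z ^ K / z ^ n * (ent (X z) r 0 + ?b * ent (X z) r 1 - ent (Y z) r 0 + ?b * ent (Y z) r 1)"
      by (simp only: distrib_left right_diff_distrib mult_ac)
    also have "\<dots> = 0" unfolding step_relations(2)[OF img(2)[OF z] YX] by simp
    finally show "0 = z ^ K / z ^ n * ent (X z) r 0 + ?b * (z ^ K / z ^ n * ent (X z) r 1)
      - z ^ K / z ^ n * ent (Y z) r 0 + ?b * (z ^ K / z ^ n * ent (Y z) r 1)" by simp
  qed
  ultimately have "?I X n 0 + ?b * ?I X n 1 - ?I Y n 0 + ?b * ?I Y n 1 = 0"
    by (rule has_contour_integral_unique)
  then have "(?I X n 0 + ?b * ?I X n 1 - ?I Y n 0 + ?b * ?I Y n 1) / (2 * pi * \<i>) = 0" by simp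
  then show "transition_part j n 0 + ?b * transition_part j n 1 - transition_part (Suc j) n 0 + ?b * transition_part (Suc j) n 1 = 0"
    unfolding CI by (simp only: add_divide_distrib diff_divide_distrib times_divide_eq_right)
qed

text \<open>
  At the column of the primed point the walk is empty, and only a power of \<open>z\<close> is integrated.
\<close>

lemma transition_part_source:
  assumes "i < 2"
  shows "transition_part (2 * m) (Suc n) i = (if n = K \<and> i = r then 1 else 0)"
proof -
  have one: "ent 1 r i = (if i = r then 1 else 0)" using assms r by (auto simp: ent_one)
  have "((\<lambda>z. z ^ K / z ^ Suc n) has_contour_integral (if n = K then 2 * pi * \<i> else 0)) \<gamma>01"
  proof (cases "n < K")
    case True
    define k where "k = K - Suc n"
    have "((\<lambda>z. z ^ k) has_contour_integral 0) \<gamma>01"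
      by (rule Cauchy_theorem_global[of UNIV]) (use \<gamma>01 in \<open>auto intro!: holomorphic_intros\<close>)
    then have "((\<lambda>z. z ^ K / z ^ Suc n) has_contour_integral 0) \<gamma>01"
    proof (rule has_contour_integral_eq)
      fix z assume "z \<in> path_image \<gamma>01"
      then have "z \<noteq> 0" using \<gamma>01(4)[of 0] by auto
      moreover have "K = k + Suc n" using True by (simp add: k_def)
      ultimately show "z ^ k = z ^ K / z ^ Suc n" by (simp only: power_add) simp
    qed
    then show ?thesis using True by simp
  next
    case False
    have "((\<lambda>z. 1 / z ^ Suc (n - K)) has_contour_integral (if n - K = 0 then 2 * pi * \<i> else 0)) \<gamma>01"
      by (rule has_contour_integral_inverse_power)
    then have "((\<lambda>z. z ^ K / z ^ Suc n) has_contour_integral (if n - K = 0 then 2 * pi * \<i> else 0)) \<gamma>01"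
    proof (rule has_contour_integral_eq)
      fix z assume "z \<in> path_image \<gamma>01"
      then have "z \<noteq> 0" using \<gamma>01(4)[of 0] by auto
      moreover have "Suc n = K + Suc (n - K)" using False by simp
      then have "z ^ Suc n = z ^ K * z ^ Suc (n - K)" by (metis power_add)
      ultimately show "1 / z ^ Suc (n - K) = z ^ K / z ^ Suc n" by simp
    qed
    then show ?thesis using False by (simp add: le_less)
  qed
  then have eq: "contour_integral \<gamma>01 (\<lambda>z. z ^ K / z ^ Suc n) = (if n = K then 2 * pi * \<i> else 0)"
    by (rule contour_integral_unique)
  show ?thesis
  proof (cases "i = r")
    case True
    have "ent 1 r i = 1" using one True by simp
    then have "transition_part (2 * m) (Suc n) i = contour_integral \<gamma>01 (\<lambda>z. z ^ K / z ^ Suc n) / (2 * pi * \<i>)"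
      by (simp only: transition_part_def diff_self_eq_0 walk.simps mult_1_right)
    then show ?thesis unfolding eq using True by simp
  next
    case False
    then show ?thesis by (simp add: transition_part_def one)
  qed
qed

lemma transition_part_source_bottom: "transition_part (2 * m) 0 i = 0"
proof -
  have "((\<lambda>z. z ^ K * ent 1 r i) has_contour_integral 0) \<gamma>01"
    by (rule Cauchy_theorem_global[of UNIV]) (use \<gamma>01 in \<open>auto intro!: holomorphic_intros\<close>)
  then show ?thesis by (simp add: transition_part_def contour_integral_unique)
qed

text \<open>
  The integrand is bounded by a multiple of \<open>1 / z\<^sup>2\<close>, since \<open>K < 2 h\<close>.
\<close>

lemma transition_part_top:
  shows "transition_part j (Suc (2 * h)) i = 0"
proof -
  obtain B where B: "\<And>z. 2 \<le> cmod z \<Longrightarrow> cmod (ent (walk eps (2 * m) (j - 2 * m) z) r i) \<le> B"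
    using bounded_m2_walk unfolding bounded_m2_def by metis
  have B0: "0 \<le> B" using order_trans[OF norm_ge_zero B[of 2]] by simp
  have "contour_integral \<gamma>01 (\<lambda>z. z ^ K / z ^ Suc (2 * h) * ent (walk eps (2 * m) (j - 2 * m) z) r i) = 0"
  proof (rule contour_integral_\<gamma>01_decay[OF holomorphic_walk_ent])
    fix z :: complex assume z: "2 \<le> cmod z"
    \<comment> \<open>Two of the \<open>2 h + 1 - K\<close> remaining powers of \<open>z\<close> in the denominator are kept; the other \<open>k\<close> are at least 1 in modulus.\<close>
    define k where "k = 2 * h - 1 - K"
    have "Suc (2 * h) = K + (2 + k)" using K by (simp add: k_def)
    then have "z ^ Suc (2 * h) = z ^ K * (z\<^sup>2 * z ^ k)" by (metis power_add)
    moreover have "z \<noteq> 0" using z by auto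
    ultimately have "z ^ K / z ^ Suc (2 * h) = 1 / (z\<^sup>2 * z ^ k)" by simp
    then have "cmod (z ^ K / z ^ Suc (2 * h) * ent (walk eps (2 * m) (j - 2 * m) z) r i)
      = cmod (ent (walk eps (2 * m) (j - 2 * m) z) r i) / ((cmod z)\<^sup>2 * cmod z ^ k)"
      by (simp add: norm_mult norm_divide norm_power)
    also have "\<dots> \<le> B / (cmod z)\<^sup>2"
    proof (rule frac_le)
      have "(cmod z)\<^sup>2 * 1 \<le> (cmod z)\<^sup>2 * cmod z ^ k" using z by (intro mult_left_mono one_le_power) auto
      then show "(cmod z)\<^sup>2 \<le> (cmod z)\<^sup>2 * cmod z ^ k" by simp
    qed (use B[OF z] B0 z in auto)
    finally show "cmod (z ^ K / z ^ Suc (2 * h) * ent (walk eps (2 * m) (j - 2 * m) z) r i) \<le> B / (cmod z)\<^sup>2" .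
  qed
  then show ?thesis by (simp add: transition_part_def)
qed

text \<open>
  The degree of the polynomials is at most \<open>2 h\<close>.
\<close>

lemma formula_top:
  assumes "j \<le> 4 * h"
  shows "formula j (Suc (2 * h)) i = 0"
proof -
  have "poly_shift (Suc (2 * h)) (cleared_poly j l i) = 0" for l
    using cleared_poly(1)[OF assms, of l i] by (intro poly_eqI) (simp add: coeff_poly_shift coeff_eq_0)
  then show ?thesis by (simp add: formula_def double_part_def outer_integral_zero transition_part_top)
qed

lemma double_part_bottom:
  assumes A: "admissible_factor A" and j: "j \<le> 4 * h"
  shows "double_part A j 0 i = contour_integral \<gamma>1 (\<lambda>w. ent (outer_factor A w * cleared_walk j w) r i) / (2 * pi * \<i>)"
proof -
  have "contour_integral \<gamma>1 (\<lambda>w. ent (outer_factor A w * cleared_walk j w) r i)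
    = contour_integral \<gamma>1 (\<lambda>w. ent (outer_factor A w) r 0 * poly (cleared_poly j 0 i) w + ent (outer_factor A w) r 1 * poly (cleared_poly j 1 i) w)"
  proof (rule contour_integral_eq)
    fix w assume "w \<in> path_image \<gamma>1"
    then have "w \<noteq> 1" using \<gamma>1(4) by auto
    then show "ent (outer_factor A w * cleared_walk j w) r i = ent (outer_factor A w) r 0 * poly (cleared_poly j 0 i) w + ent (outer_factor A w) r 1 * poly (cleared_poly j 1 i) w"
      using cleared_poly(2)[OF j] by (simp add: ent_simps(6))
  qed
  then show ?thesis
    by (simp add: double_part_def outer_integral_def contour_integral_add integrable_outer_factor[OF A] add_divide_distrib)
qed

lemma regular_contour_integral:
  assumes "regular cut_domain f"
  shows "((\<lambda>w. w ^ K * ent (f w) r i) has_contour_integral 0) \<gamma>1"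
proof -
  obtain g where g: "holomorphic_m2 g cut_domain" "\<And>w. w \<in> cut_domain - {1} \<Longrightarrow> f w = g w"
    using assms unfolding regular_def by blast
  have "(\<lambda>w. w ^ K * ent (g w) r i) holomorphic_on cut_domain"
    using g(1) unfolding holomorphic_m2_def by (auto intro!: holomorphic_intros)
  then show ?thesis
    unfolding cut_domain_def by (rule contour_integral_regular) (use g(2) in \<open>simp add: cut_domain_eq\<close>)
qed

text \<open>
  To the right of the primed point, the walk itself is split off from the integrand so that the rest is regular. The integral of the walk
  is then moved to the larger contour, where it is the single integral.
\<close>

lemma formula_bottom:
  assumes j: "j \<le> 4 * h"
  shows "formula j 0 i = 0"
proof -
  have int: "(\<lambda>w. ent (outer_factor A w * cleared_walk j w) r i) contour_integrable_on \<gamma>1" if A: "admissible_factor A" for A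
  proof (rule contour_integrable_\<gamma>1, unfold cut_domain_eq[symmetric])
    have "(\<lambda>w. ent (outer_factor A w) r 0 * poly (cleared_poly j 0 i) w + ent (outer_factor A w) r 1 * poly (cleared_poly j 1 i) w) holomorphic_on cut_domain - {1}"
      by (intro holomorphic_intros holomorphic_outer_factor A)
    then show "(\<lambda>w. ent (outer_factor A w * cleared_walk j w) r i) holomorphic_on cut_domain - {1}"
      by (rule holomorphic_transform) (use cleared_poly(2)[OF j] in \<open>simp add: ent_simps(6)\<close>)
  qed
  have sum: "double_part factor1 j 0 i + double_part factor2 j 0 i
    = contour_integral \<gamma>1 (\<lambda>w. ent (outer_factor factor1 w * cleared_walk j w) r i + ent (outer_factor factor2 w * cleared_walk j w) r i) / (2 * pi * \<i>)"
    using int[OF admissible_factors(1)] int[OF admissible_factors(2)]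
    by (simp add: double_part_bottom[OF admissible_factors(1) j] double_part_bottom[OF admissible_factors(2) j] contour_integral_add add_divide_distrib)
  have E12: "ent (outer_factor factor1 w * cleared_walk j w) r i + ent (outer_factor factor2 w * cleared_walk j w) r i
    = w ^ K / (w - 1) ^ (2 * h) * ent ((factor1 m w + factor2 m w) * cleared_walk j w) r i" for w
    by (simp add: outer_factor_def mult.assoc ent_simps(4) distrib_right ent_simps(1) distrib_left)
  have wU: "w \<in> cut_domain - {1}" if "w \<in> path_image \<gamma>1" for w using \<gamma>1(4) that unfolding cut_domain_eq by blast
  show ?thesis
  proof (cases "j \<le> 2 * m")
    case True
    have "contour_integral \<gamma>1 (\<lambda>w. ent (outer_factor factor1 w * cleared_walk j w) r i + ent (outer_factor factor2 w * cleared_walk j w) r i)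
      = contour_integral \<gamma>1 (\<lambda>w. w ^ K * ent (proj m w * walk_inv eps j (2 * m - j) w) r i)"
    proof (rule contour_integral_eq)
      fix w assume w: "w \<in> path_image \<gamma>1"
      show "ent (outer_factor factor1 w * cleared_walk j w) r i + ent (outer_factor factor2 w * cleared_walk j w) r i = w ^ K * ent (proj m w * walk_inv eps j (2 * m - j) w) r i"
        unfolding E12 factors_cleared_before[OF wU[OF w] m(1) True] ent_simps(4) using wU[OF w] by simp
    qed
    also have "\<dots> = 0"
      using regular_contour_integral[OF regular_before[OF True]] by (rule contour_integral_unique)
    finally show ?thesis using True by (simp add: formula_def sum)
  next
    case False
    then have mj: "2 * m \<le> j" by simp
    let ?W = "walk eps (2 * m) (j - 2 * m)"
    have hol: "(\<lambda>w. w ^ K * ent (?W w) r i) holomorphic_on - {1}"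
      using holomorphic_m2_walk(1)[of "- {1}" eps "2 * m" "j - 2 * m"] unfolding holomorphic_m2_def
      by (auto intro!: holomorphic_intros)
    have "(\<lambda>w. w ^ K * ent (?W w) r i) contour_integrable_on \<gamma>1"
      by (rule contour_integrable_\<gamma>1) (rule holomorphic_on_subset[OF hol], auto)
    then have "((\<lambda>w. w ^ K * ent (?W w) r i - w ^ K * ent ((1 - proj m w) * ?W w) r i)
      has_contour_integral contour_integral \<gamma>1 (\<lambda>w. w ^ K * ent (?W w) r i) - 0) \<gamma>1"
      by (intro has_contour_integral_diff has_contour_integral_integral regular_contour_integral regular_after mj)
    then have "((\<lambda>w. ent (outer_factor factor1 w * cleared_walk j w) r i + ent (outer_factor factor2 w * cleared_walk j w) r i)
      has_contour_integral contour_integral \<gamma>1 (\<lambda>w. w ^ K * ent (?W w) r i) - 0) \<gamma>1"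
    proof (rule has_contour_integral_eq)
      fix w assume w: "w \<in> path_image \<gamma>1"
      have "ent (?W w) r i - ent ((1 - proj m w) * ?W w) r i = ent (proj m w * ?W w) r i"
        by (simp add: left_diff_distrib ent_simps(2))
      then show "w ^ K * ent (?W w) r i - w ^ K * ent ((1 - proj m w) * ?W w) r i
        = ent (outer_factor factor1 w * cleared_walk j w) r i + ent (outer_factor factor2 w * cleared_walk j w) r i"
        unfolding E12 factors_cleared_after[OF wU[OF w] m(1) mj] ent_simps(4) using wU[OF w]
        by (simp add: right_diff_distrib[symmetric])
    qed
    then have "contour_integral \<gamma>1 (\<lambda>w. ent (outer_factor factor1 w * cleared_walk j w) r i + ent (outer_factor factor2 w * cleared_walk j w) r i)
      = contour_integral \<gamma>1 (\<lambda>w. w ^ K * ent (?W w) r i)"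
      by (simp add: contour_integral_unique)
    also have "\<dots> = contour_integral \<gamma>01 (\<lambda>w. w ^ K * ent (?W w) r i)"
      by (rule contour_integral_\<gamma>01_eq_\<gamma>1[OF hol, symmetric])
    finally show ?thesis using False by (simp add: formula_def sum transition_part_def)
  qed
qed

text \<open>
  All parts satisfy the homogeneous equations, except that the single integral starts to the right of the column \<open>2 m\<close>; its missing values
  in this column appear on the right-hand side.
\<close>

lemma formula_relations:
  assumes j: "Suc j \<le> 4 * h"
  shows "of_real ((eps j)\<^sup>2) * formula j (Suc n) 0 + formula j n 1 + of_real ((eps j)\<^sup>2) * formula (Suc j) (Suc n) 0 - formula (Suc j) n 1
      = (if j = 2 * m then of_real ((eps j)\<^sup>2) * transition_part j (Suc n) 0 + transition_part j n 1 else 0)" (is ?even)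
    "formula j n 0 + of_real (1 / (eps j)\<^sup>2) * formula j n 1 - formula (Suc j) n 0 + of_real (1 / (eps j)\<^sup>2) * formula (Suc j) n 1
      = (if j = 2 * m then transition_part j n 0 + of_real (1 / (eps j)\<^sup>2) * transition_part j n 1 else 0)" (is ?odd)
proof -
  let ?a = "of_real ((eps j)\<^sup>2) :: complex" and ?b = "of_real (1 / (eps j)\<^sup>2) :: complex"
  let ?C = "\<lambda>j n i. if 2 * m < j then transition_part j n i else 0"
  note D1 = double_part_relations[OF admissible_factors(1) j] and D2 = double_part_relations[OF admissible_factors(2) j]
  have "?a * formula j (Suc n) 0 + formula j n 1 + ?a * formula (Suc j) (Suc n) 0 - formula (Suc j) n 1
    = (?a * double_part factor1 j (Suc n) 0 + double_part factor1 j n 1 + ?a * double_part factor1 (Suc j) (Suc n) 0 - double_part factor1 (Suc j) n 1)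
    + (?a * double_part factor2 j (Suc n) 0 + double_part factor2 j n 1 + ?a * double_part factor2 (Suc j) (Suc n) 0 - double_part factor2 (Suc j) n 1)
    - (?a * ?C j (Suc n) 0 + ?C j n 1 + ?a * ?C (Suc j) (Suc n) 0 - ?C (Suc j) n 1)"
    unfolding formula_def by (simp only: distrib_left right_diff_distrib) simp
  also have "\<dots> = - (?a * ?C j (Suc n) 0 + ?C j n 1 + ?a * ?C (Suc j) (Suc n) 0 - ?C (Suc j) n 1)"
    unfolding D1 D2 by simp
  also have "\<dots> = (if j = 2 * m then ?a * transition_part j (Suc n) 0 + transition_part j n 1 else 0)"
  proof (cases "2 * m \<le> j")
    case True
    then show ?thesis using transition_part_relations(1)[OF True, of n]
      by (cases "j = 2 * m") (auto simp: algebra_simps add_eq_0_iff)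
  qed auto
  finally show ?even .
  have "formula j n 0 + ?b * formula j n 1 - formula (Suc j) n 0 + ?b * formula (Suc j) n 1
    = (double_part factor1 j n 0 + ?b * double_part factor1 j n 1 - double_part factor1 (Suc j) n 0 + ?b * double_part factor1 (Suc j) n 1)
    + (double_part factor2 j n 0 + ?b * double_part factor2 j n 1 - double_part factor2 (Suc j) n 0 + ?b * double_part factor2 (Suc j) n 1)
    - (?C j n 0 + ?b * ?C j n 1 - ?C (Suc j) n 0 + ?b * ?C (Suc j) n 1)"
    unfolding formula_def by (simp only: distrib_left right_diff_distrib) simp
  also have "\<dots> = - (?C j n 0 + ?b * ?C j n 1 - ?C (Suc j) n 0 + ?b * ?C (Suc j) n 1)"
    unfolding D1 D2 by simp
  also have "\<dots> = (if j = 2 * m then transition_part j n 0 + ?b * transition_part j n 1 else 0)"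
  proof (cases "2 * m \<le> j")
    case True
    then show ?thesis using transition_part_relations(2)[OF True, of n]
      by (cases "j = 2 * m") (auto simp: algebra_simps add_eq_0_iff)
  qed auto
  finally show ?odd .
qed

end

section \<open>The formula solves the Kasteleyn equations\<close>

context kernel_setup
begin

text \<open>
  The rows come in pairs, and the vertices with second coordinates \<open>4 k + 1\<close> and \<open>4 k + 3\<close> form the pair \<open>n = k + 1\<close>. The
  coordinate \<open>-1\<close> belongs to the fictitious row \<open>n = 0\<close>, which explains the offset 3.
\<close>

definition formula_vertex :: "vertex \<Rightarrow> complex" where
  "formula_vertex b = formula (nat (fst b div 2)) (nat ((snd b + 3) div 4)) (nat (((snd b - 1) div 2) mod 2))"

abbreviation diamond_size :: int where "diamond_size \<equiv> 2 * int h"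

lemma formula_vertex_eq: "formula_vertex (2 * int j, 4 * int k + 1) = formula j (Suc k) 0"
  "formula_vertex (2 * int j, 4 * int k - 1) = formula j k 1" "formula_vertex (2 * int j, 4 * int k + 3) = formula j (Suc k) 1"
proof -
  have d: "(4 * int k + 1 + 3) div 4 = int (Suc k)" "((4 * int k + 1 - 1) div 2) mod 2 = int 0"
    "(4 * int k - 1 + 3) div 4 = int k" "((4 * int k - 1 - 1) div 2) mod 2 = int 1"
    "(4 * int k + 3 + 3) div 4 = int (Suc k)" "((4 * int k + 3 - 1) div 2) mod 2 = int 1"
    "(2 * int j) div 2 = int j"
    by presburger+
  show "formula_vertex (2 * int j, 4 * int k + 1) = formula j (Suc k) 0" "formula_vertex (2 * int j, 4 * int k - 1) = formula j k 1"
    "formula_vertex (2 * int j, 4 * int k + 3) = formula j (Suc k) 1"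
    unfolding formula_vertex_def fst_conv snd_conv d nat_int by (rule refl)+
qed

lemma black_iff: "(x, y) \<in> black_vertices diamond_size \<longleftrightarrow>
    (\<exists>j k. 0 \<le> j \<and> j \<le> 4 * int h \<and> 0 \<le> k \<and> k \<le> 4 * int h - 1 \<and> x = 2 * j \<and> y = 2 * k + 1)"
  unfolding black_vertices_def by force

lemma white_cases:
  assumes "w \<in> white_vertices diamond_size"
  obtains j k where "j < 4 * h" "k \<le> 4 * h" "w = (2 * int j + 1, 2 * int k)"
proof -
  obtain j k where jk: "0 \<le> j" "j \<le> 2 * diamond_size - 1" "0 \<le> k" "k \<le> 2 * diamond_size" "w = (2 * j + 1, 2 * k)"
    using assms unfolding white_vertices_def by auto
  show ?thesis by (rule that[of "nat j" "nat k"]) (use jk in auto)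
qed

text \<open>
  Vertices outside the diamond may be included in the sum, because \<open>g\<close> vanishes there.
\<close>

lemma sum_black_neighbours:
  assumes j: "j < 4 * h" and k: "k \<le> 4 * h"
    and g: "\<And>x. x \<in> {2 * int j, 2 * int j + 2} \<Longrightarrow> k = 0 \<Longrightarrow> g (x, - 1) = 0"
      "\<And>x. x \<in> {2 * int j, 2 * int j + 2} \<Longrightarrow> k = 4 * h \<Longrightarrow> g (x, 8 * int h + 1) = 0"
  shows "(\<Sum>b\<in>black_vertices diamond_size. if ((2 * int j + 1, 2 * int k), b) \<in> edges diamond_size then g b else 0)
    = g (2 * int j, 2 * int k + 1) + g (2 * int j, 2 * int k - 1)
      + g (2 * int j + 2, 2 * int k + 1) + g (2 * int j + 2, 2 * int k - 1)"
proof -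
  let ?w = "(2 * int j + 1, 2 * int k)"
  let ?B = "{(2 * int j, 2 * int k + 1), (2 * int j, 2 * int k - 1), (2 * int j + 2, 2 * int k + 1), (2 * int j + 2, 2 * int k - 1)}"
  have w: "?w \<in> white_vertices diamond_size"
    unfolding white_vertices_def using j k by (intro image_eqI[of _ _ "(int j, int k)"]) auto
  have edge: "(?w, b) \<in> edges diamond_size \<longleftrightarrow> b \<in> black_vertices diamond_size \<and> b \<in> ?B" for b
    using w by (cases b) (auto simp: edges_def minus_prod_def)
  have "(\<Sum>b\<in>black_vertices diamond_size. if (?w, b) \<in> edges diamond_size then g b else 0)
    = (\<Sum>b\<in>black_vertices diamond_size. if b \<in> ?B then g b else 0)"
  proof (rule sum.cong[OF refl])
    fix b assume "b \<in> black_vertices diamond_size"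
    then show "(if (?w, b) \<in> edges diamond_size then g b else 0) = (if b \<in> ?B then g b else 0)"
      by (simp only: edge simp_thms)
  qed
  also have "\<dots> = (\<Sum>b\<in>black_vertices diamond_size \<inter> ?B. g b)"
    by (rule sum.inter_restrict[symmetric]) simp
  also have "\<dots> = (\<Sum>b\<in>?B. g b)"
  proof (rule sum.mono_neutral_left)
    show "\<forall>b\<in>?B - black_vertices diamond_size \<inter> ?B. g b = 0"
    proof
      fix b assume b: "b \<in> ?B - black_vertices diamond_size \<inter> ?B"
      have "k = 4 * h \<and> snd b = 2 * int k + 1 \<or> k = 0 \<and> snd b = 2 * int k - 1"
      proof (rule ccontr)
        assume no: "\<not> ?thesis"
        have "fst b = 2 * int j \<or> fst b = 2 * (int j + 1)" using b by auto
        then obtain x where x: "x = int j \<or> x = int j + 1" "fst b = 2 * x" by blast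
        have "snd b = 2 * int k + 1 \<or> snd b = 2 * (int k - 1) + 1" using b by auto
        then obtain y where y: "y = int k \<or> y = int k - 1" "snd b = 2 * y + 1" by blast
        have "0 \<le> y" "y \<le> 4 * int h - 1" using y no k by auto
        then have "(fst b, snd b) \<in> black_vertices diamond_size"
          unfolding black_iff using x y j by (intro exI[of _ x] exI[of _ y]) auto
        then show False using b by auto
      qed
      moreover have "fst b \<in> {2 * int j, 2 * int j + 2}" using b by auto
      ultimately show "g b = 0"
        using g(1)[of "fst b"] g(2)[of "fst b"] by (cases b) auto
    qed
  qed auto
  also have "\<dots> = g (2 * int j, 2 * int k + 1) + g (2 * int j, 2 * int k - 1)
      + g (2 * int j + 2, 2 * int k + 1) + g (2 * int j + 2, 2 * int k - 1)"
    by (simp add: add_ac)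
  finally show ?thesis .
qed

lemma weight_values:
  fixes x :: int
  assumes "x = 2 * int j \<or> x = 2 * int j + 2"
  shows "real_weight (int T) \<alpha> \<beta> ((2 * int j + 1, 4 * int k), (x, 4 * int k + 1)) = of_real ((eps j)\<^sup>2)"
    "real_weight (int T) \<alpha> \<beta> ((2 * int j + 1, 4 * int k), (x, 4 * int k - 1)) = 1"
    "real_weight (int T) \<alpha> \<beta> ((2 * int j + 1, 4 * int k + 2), (x, 4 * int k + 3)) = of_real (1 / (eps j)\<^sup>2)"
    "real_weight (int T) \<alpha> \<beta> ((2 * int j + 1, 4 * int k + 2), (x, 4 * int k + 1)) = 1"
proof -
  have m: "(2 * int j + 1) mod 4 = 1 \<longleftrightarrow> even j" "(4 * int k) mod 4 = 0" "(4 * int k + 2) mod 4 \<noteq> 0"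
    "2 * int j + 1 < 4 * int T \<longleftrightarrow> j < 2 * T" by presburger+
  have d: "(2 * int j + 1, y) - (x, y') \<in> {(1, -1), (-1, -1)} \<longleftrightarrow> y - y' = -1" for y y' :: int
    using assms by (auto simp: minus_prod_def)
  show "real_weight (int T) \<alpha> \<beta> ((2 * int j + 1, 4 * int k), (x, 4 * int k + 1)) = of_real ((eps j)\<^sup>2)"
    "real_weight (int T) \<alpha> \<beta> ((2 * int j + 1, 4 * int k), (x, 4 * int k - 1)) = 1"
    "real_weight (int T) \<alpha> \<beta> ((2 * int j + 1, 4 * int k + 2), (x, 4 * int k + 3)) = of_real (1 / (eps j)\<^sup>2)"
    "real_weight (int T) \<alpha> \<beta> ((2 * int j + 1, 4 * int k + 2), (x, 4 * int k + 1)) = 1"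
    unfolding real_weight_def edge_weight_def case_prod_conv Let_def fst_conv snd_conv d m(1,4)
    using m(2,3) by (auto simp: eps_def)
qed

lemma sign_values:
  "edge_sign ((2 * int j + 1, y), (2 * int j, y')) = 1"
  "edge_sign ((2 * int j + 1, y), (2 * int j + 2, y')) = (if y' = y + 1 then 1 else - 1)"
  by (simp_all add: edge_sign_def)

lemma formula_solves_kasteleyn:
  "solves_kasteleyn diamond_size (real_weight (int T) \<alpha> \<beta>)
    (point_source diamond_size (real_weight (int T) \<alpha> \<beta>) (4 * int m, 2 * (int K - diamond_size) + int r)) formula_vertex"
  unfolding solves_kasteleyn_def
proof
  fix w assume "w \<in> white_vertices diamond_size"
  then obtain j k where j: "j < 4 * h" and k: "k \<le> 4 * h" and w: "w = (2 * int j + 1, 2 * int k)"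
    by (rule white_cases)
  let ?\<nu> = "real_weight (int T) \<alpha> \<beta>" and ?q = "(4 * int m, 2 * (int K - diamond_size) + int r)"
  let ?g = "\<lambda>b. of_int (edge_sign (w, b)) * ?\<nu> (w, b) * formula_vertex b"
  have bq: "black_vertex diamond_size ?q = (4 * int m, 4 * int K + 2 * int r + 1)"
    by (simp add: black_vertex_def)
  have bq_black: "black_vertex diamond_size ?q \<in> black_vertices diamond_size"
    unfolding bq black_iff using m K r
    by (intro exI[of _ "2 * int m"] exI[of _ "2 * int K + int r"]) auto
  have wW: "w \<in> white_vertices diamond_size" by fact
  have edge_iff: "(w, black_vertex diamond_size ?q) \<in> edges diamond_size \<longleftrightarrow> 2 * int k - (4 * int K + 2 * int r + 1) \<in> {1, -1}"
    if "j = 2 * m"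
  proof -
    have "(w, black_vertex diamond_size ?q) \<in> edges diamond_size \<longleftrightarrow>
      w - black_vertex diamond_size ?q \<in> {(1, 1), (1, -1), (-1, 1), (-1, -1)}"
      using wW bq_black by (simp only: edges_def mem_Collect_eq case_prod_conv simp_thms)
    also have "w - black_vertex diamond_size ?q = (1, 2 * int k - (4 * int K + 2 * int r + 1))"
      unfolding bq w using that by (simp add: minus_prod_def)
    finally show ?thesis by auto
  qed
  have source: "point_source diamond_size ?\<nu> ?q w = (if (w, black_vertex diamond_size ?q) \<in> edges diamond_size
      then of_int (edge_sign (w, black_vertex diamond_size ?q)) * ?\<nu> (w, black_vertex diamond_size ?q) else 0)"
    if "j = 2 * m"
    using that unfolding point_source_def kasteleyn_def w by simp
  have V0: "formula_vertex (x, - 1) = 0" "formula_vertex (x, 8 * int h + 1) = 0" if "x \<in> {2 * int j, 2 * int j + 2}" for x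
  proof -
    have "x = 2 * int j \<or> x = 2 * int (Suc j)" using that by auto
    then obtain i where "x = 2 * int i" "i = j \<or> i = Suc j" by blast
    then have i: "x = 2 * int i" "i \<le> 4 * h" using j by auto
    show "formula_vertex (x, - 1) = 0" using formula_vertex_eq(2)[of i 0] formula_bottom[OF i(2)] i by simp
    show "formula_vertex (x, 8 * int h + 1) = 0" using formula_vertex_eq(1)[of i "2 * h"] formula_top[OF i(2)] i by simp
  qed
  have "(\<Sum>b\<in>black_vertices diamond_size. kasteleyn diamond_size ?\<nu> w b * formula_vertex b)
    = (\<Sum>b\<in>black_vertices diamond_size. if (w, b) \<in> edges diamond_size then ?g b else 0)"
    by (rule sum.cong) (auto simp: kasteleyn_def)
  also have "\<dots> = ?g (2 * int j, 2 * int k + 1) + ?g (2 * int j, 2 * int k - 1)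
      + ?g (2 * int j + 2, 2 * int k + 1) + ?g (2 * int j + 2, 2 * int k - 1)"
    unfolding w by (rule sum_black_neighbours[OF j k]) (use V0 in auto)
  also have "\<dots> = point_source diamond_size ?\<nu> ?q w"
  proof (cases "even k")
    case True
    then obtain n where n: "k = 2 * n" by blast
    have V2: "formula_vertex (2 * int j + 2, 4 * int n + 1) = formula (Suc j) (Suc n) 0" "formula_vertex (2 * int j + 2, 4 * int n - 1) = formula (Suc j) n 1"
      using formula_vertex_eq[of "Suc j" n] by (simp_all add: algebra_simps)
    have "?g (2 * int j, 2 * int k + 1) + ?g (2 * int j, 2 * int k - 1)
      + ?g (2 * int j + 2, 2 * int k + 1) + ?g (2 * int j + 2, 2 * int k - 1)
      = of_real ((eps j)\<^sup>2) * formula j (Suc n) 0 + formula j n 1 + of_real ((eps j)\<^sup>2) * formula (Suc j) (Suc n) 0 - formula (Suc j) n 1"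
      by (simp add: w n sign_values weight_values formula_vertex_eq V2)
    also have "\<dots> = (if j = 2 * m then of_real ((eps j)\<^sup>2) * transition_part j (Suc n) 0 + transition_part j n 1 else 0)"
      by (rule formula_relations(1)) (use j in simp)
    also have "\<dots> = point_source diamond_size ?\<nu> ?q w"
    proof (cases "j = 2 * m")
      case False
      then have "2 * int j + 1 \<noteq> 4 * int m + 1" by presburger
      then show ?thesis using False by (simp add: point_source_def w)
    next
      case True
      have C1: "transition_part j n 1 = (if n = Suc K \<and> r = 1 then 1 else 0)"
        unfolding True by (cases n) (use r in \<open>auto simp: transition_part_source transition_part_source_bottom\<close>)
      have C0: "transition_part j (Suc n) 0 = (if n = K \<and> r = 0 then 1 else 0)"
        unfolding True using transition_part_source[of 0 n] r by auto
      have edge: "(w, black_vertex diamond_size ?q) \<in> edges diamond_size \<longleftrightarrow> (r = 0 \<and> n = K \<or> r = 1 \<and> n = Suc K)"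
        unfolding edge_iff[OF True] n using r by auto presburger+
      consider "r = 0" "n = K" | "r = 1" "n = Suc K" | "\<not> (r = 0 \<and> n = K \<or> r = 1 \<and> n = Suc K)" by blast
      then show ?thesis
      proof cases
        case 1
        have "black_vertex diamond_size ?q = (2 * int j, 4 * int n + 1)" "w = (2 * int j + 1, 4 * int n)"
          unfolding bq using 1 True by (simp_all add: w n)
        then have "point_source diamond_size ?\<nu> ?q w = of_real ((eps j)\<^sup>2)"
          using 1 edge unfolding source[OF True] by (simp only: sign_values weight_values simp_thms if_True) simp
        then show ?thesis unfolding C0 C1 using 1 True by simp
      next
        case 2
        have "black_vertex diamond_size ?q = (2 * int j, 4 * int n - 1)" "w = (2 * int j + 1, 4 * int n)"
          unfolding bq using 2 True by (simp_all add: w n)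
        then have "point_source diamond_size ?\<nu> ?q w = 1"
          using 2 edge unfolding source[OF True] by (simp only: sign_values weight_values simp_thms if_True) simp
        then show ?thesis unfolding C0 C1 using 2 True by simp
      next
        case 3
        then have "point_source diamond_size ?\<nu> ?q w = 0"
          using edge unfolding source[OF True] by (simp only: simp_thms if_False)
        then show ?thesis unfolding C0 C1 using 3 True by auto
      qed
    qed
    finally show ?thesis .
  next
    case False
    then obtain n where n: "k = 2 * n + 1" by (elim oddE)
    have wn: "2 * int k = 4 * int n + 2" "2 * int k + 1 = 4 * int n + 3" "2 * int k - 1 = 4 * int n + 1" by (simp_all add: n)
    have V2: "formula_vertex (2 * int j + 2, 4 * int n + 1) = formula (Suc j) (Suc n) 0" "formula_vertex (2 * int j + 2, 4 * int n + 3) = formula (Suc j) (Suc n) 1"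
      using formula_vertex_eq[of "Suc j" n] by (simp_all add: algebra_simps)
    have "?g (2 * int j, 2 * int k + 1) + ?g (2 * int j, 2 * int k - 1)
      + ?g (2 * int j + 2, 2 * int k + 1) + ?g (2 * int j + 2, 2 * int k - 1)
      = formula j (Suc n) 0 + of_real (1 / (eps j)\<^sup>2) * formula j (Suc n) 1 - formula (Suc j) (Suc n) 0 + of_real (1 / (eps j)\<^sup>2) * formula (Suc j) (Suc n) 1"
      unfolding w wn(2,3) unfolding wn(1) sign_values formula_vertex_eq V2 weight_values(3,4)[OF disjI1[OF refl]]
        weight_values(3,4)[OF disjI2[OF refl]] by simp
    also have "\<dots> = (if j = 2 * m then transition_part j (Suc n) 0 + of_real (1 / (eps j)\<^sup>2) * transition_part j (Suc n) 1 else 0)"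
      by (rule formula_relations(2)) (use j in simp)
    also have "\<dots> = point_source diamond_size ?\<nu> ?q w"
    proof (cases "j = 2 * m")
      case False
      then have "2 * int j + 1 \<noteq> 4 * int m + 1" by presburger
      then show ?thesis using False by (simp add: point_source_def w)
    next
      case True
      have C1: "transition_part j (Suc n) i = (if n = K \<and> i = r then 1 else 0)" if "i < 2" for i
        unfolding True by (rule transition_part_source[OF that])
      have edge: "(w, black_vertex diamond_size ?q) \<in> edges diamond_size \<longleftrightarrow> n = K"
        unfolding edge_iff[OF True] n using r by auto
      consider "n = K" "r = 0" | "n = K" "r = 1" | "n \<noteq> K" using r by linarith
      then show ?thesis
      proof cases
        case 1
        have "black_vertex diamond_size ?q = (2 * int j, 4 * int n + 1)" "w = (2 * int j + 1, 4 * int n + 2)"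
          unfolding bq using 1 True by (simp_all add: w n)
        then have "point_source diamond_size ?\<nu> ?q w = 1"
          using 1 edge unfolding source[OF True] by (simp only: sign_values weight_values simp_thms if_True) simp
        then show ?thesis using 1 True C1[of 0] C1[of 1] by simp
      next
        case 2
        have "black_vertex diamond_size ?q = (2 * int j, 4 * int n + 3)" "w = (2 * int j + 1, 4 * int n + 2)"
          unfolding bq using 2 True by (simp_all add: w n)
        then have "point_source diamond_size ?\<nu> ?q w = of_real (1 / (eps j)\<^sup>2)"
          using 2 edge unfolding source[OF True] by (simp only: sign_values weight_values simp_thms if_True) simp
        then show ?thesis using 2 True C1[of 0] C1[of 1] by simp
      next
        case 3
        then have "point_source diamond_size ?\<nu> ?q w = 0"
          using edge unfolding source[OF True] by (simp only: simp_thms if_False)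
        then show ?thesis using 3 True C1[of 0] C1[of 1] by simp
      qed
    qed
    finally show ?thesis .
  qed
  finally show "(\<Sum>b\<in>black_vertices diamond_size. kasteleyn diamond_size ?\<nu> w b * formula_vertex b) = point_source diamond_size ?\<nu> ?q w" .
qed

lemma Phi_powi:
  assumes "z \<noteq> 0" "z \<noteq> 1" "\<epsilon> \<noteq> 0"
  shows "Phi \<epsilon> z ^\<^sub>m\<^sub>i k = to_mat (if 0 \<le> k then phi \<epsilon> z ^ nat k else phi_inv \<epsilon> z ^ nat (- k))"
  unfolding Phi_eq_to_mat[OF assms] by (rule mat_powi_to_mat) (rule phi_inverse; use assms in simp)+

lemma transition_eq:
  assumes z: "z \<noteq> 0" "z \<noteq> 1" and ab: "a \<le> b"
  shows "transition (int T) \<alpha> \<beta> (int a) (int b) z = to_mat (walk eps (2 * a) (2 * (b - a)) z)"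
proof -
  have nz: "\<alpha> \<noteq> 0" "\<beta> \<noteq> 0" using \<alpha> \<beta> by auto
  note pow = Phi_powi[OF z nz(1)] Phi_powi[OF z nz(2)]
  consider "b \<le> T" | "T < b" "a \<le> T" | "T < b" "T < a" by linarith
  then show ?thesis
  proof cases
    case 1
    then show ?thesis using ab by (simp add: transition_def pow walk_alpha nat_diff_distrib)
  next
    case 2
    have "walk eps (2 * a) (2 * (b - a)) z = walk eps (2 * a) (2 * (T - a)) z * walk eps (2 * T) (2 * (b - T)) z"
      using walk_add[of eps "2 * a" "2 * (T - a)" "2 * (b - T)" z] 2 by (simp add: algebra_simps)
    then show ?thesis using 2 by (simp add: transition_def pow walk_alpha walk_beta nat_diff_distrib to_mat_mult)
  next
    case 3
    then show ?thesis using ab by (simp add: transition_def pow walk_beta nat_diff_distrib)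
  qed
qed

lemma mat_contour_integral_carrier: "mat_contour_integral \<gamma> A \<in> carrier_mat 2 2"
  by (simp add: mat_contour_integral_def)

lemma contour_points:
  "w \<in> path_image \<gamma>1 \<Longrightarrow> w \<in> cut_domain - {1}" "w \<in> path_image \<gamma>1 \<Longrightarrow> w \<noteq> 0"
  "z \<in> path_image \<gamma>01 \<Longrightarrow> z \<noteq> 0" "z \<in> path_image \<gamma>01 \<Longrightarrow> z \<noteq> 1"
proof -
  show *: "w \<in> path_image \<gamma>1 \<Longrightarrow> w \<in> cut_domain - {1}" for w using \<gamma>1(4) unfolding cut_domain_eq by blast
  show "w \<in> path_image \<gamma>1 \<Longrightarrow> w \<noteq> 0"
    using *[of w] cutsD(1)[of w] not_in_branch_cuts(1)[of w \<alpha>] \<alpha> by auto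
  show "z \<in> path_image \<gamma>01 \<Longrightarrow> z \<noteq> 0" "z \<in> path_image \<gamma>01 \<Longrightarrow> z \<noteq> 1"
    using \<gamma>01(4)[of 0] \<gamma>01(4)[of 1] by auto
qed

lemma double_integral_index:
  assumes A: "admissible_factor A" and AA: "\<And>w. w \<in> path_image \<gamma>1 \<Longrightarrow> AA w = to_mat (A m w)"
    and i: "i < 2" and m': "m' \<le> 2 * h" and n: "n < 2 * h"
  shows "double_integral diamond_size (int T) \<alpha> \<beta> \<gamma>1 \<gamma>01 (int K - diamond_size) (int m') (int n - diamond_size) AA $$ (r, i)
    = double_part A (2 * m') (Suc n) i"
proof -
  have nz: "\<alpha> \<noteq> 0" "\<beta> \<noteq> 0" using \<alpha> \<beta> by auto
  have integrand: "((1 / (z * (z - w)) *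
        ((w powi (int K - diamond_size + diamond_size) * (z - 1) powi diamond_size) / (z powi (int n - diamond_size + diamond_size) * (w - 1) powi diamond_size))) \<cdot>\<^sub>m
       (AA w * Phi \<beta> z ^\<^sub>m\<^sub>i (int T - diamond_size div 2) * Phi \<alpha> z ^\<^sub>m\<^sub>i (- int T) * transition (int T) \<alpha> \<beta> 0 (int m') z)) $$ (r, i)
    = 1 / (z * (z - w)) * ((w ^ K * (z - 1) ^ (2 * h)) / (z ^ n * (w - 1) ^ (2 * h)))
      * ent (A m w * (walk_inv eps 0 (2 * h) z * walk eps 0 (2 * m') z)) r i"
    if w: "w \<in> path_image \<gamma>1" and z: "z \<in> path_image \<gamma>01" for w z
  proof -
    have "Phi \<beta> z ^\<^sub>m\<^sub>i (int T - diamond_size div 2) = to_mat (phi_inv \<beta> z ^ (h - T))"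
      using T by (simp add: Phi_powi[OF contour_points(3,4)[OF z] nz(2)] nat_diff_distrib)
    moreover have "Phi \<alpha> z ^\<^sub>m\<^sub>i (- int T) = to_mat (phi_inv \<alpha> z ^ T)"
      using T by (simp add: Phi_powi[OF contour_points(3,4)[OF z] nz(1)])
    moreover have "transition (int T) \<alpha> \<beta> 0 (int m') z = to_mat (walk eps 0 (2 * m') z)"
      using transition_eq[OF contour_points(3,4)[OF z], of 0 m'] by simp
    ultimately have M: "AA w * Phi \<beta> z ^\<^sub>m\<^sub>i (int T - diamond_size div 2) * Phi \<alpha> z ^\<^sub>m\<^sub>i (- int T) * transition (int T) \<alpha> \<beta> 0 (int m') z
      = to_mat (A m w * (walk_inv eps 0 (2 * h) z * walk eps 0 (2 * m') z))"
      by (simp only: AA[OF w] to_mat_mult walk_inv_full mult.assoc)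
    have p: "w powi (int K - diamond_size + diamond_size) = w ^ K" "z powi (int n - diamond_size + diamond_size) = z ^ n" "x powi diamond_size = x ^ (2 * h)" for x :: complex
      using power_int_of_nat[of w K] power_int_of_nat[of z n] power_int_of_nat[of x "2 * h"] by simp_all
    show ?thesis unfolding M p using r i by (simp add: to_mat_index)
  qed
  have "double_integral diamond_size (int T) \<alpha> \<beta> \<gamma>1 \<gamma>01 (int K - diamond_size) (int m') (int n - diamond_size) AA $$ (r, i)
    = 1 / (2 * of_real pi * \<i>) ^ 2 * contour_integral \<gamma>1 (\<lambda>w. contour_integral \<gamma>01 (\<lambda>z.
      ((1 / (z * (z - w)) *
        ((w powi (int K - diamond_size + diamond_size) * (z - 1) powi diamond_size) / (z powi (int n - diamond_size + diamond_size) * (w - 1) powi diamond_size))) \<cdot>\<^sub>m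
       (AA w * Phi \<beta> z ^\<^sub>m\<^sub>i (int T - diamond_size div 2) * Phi \<alpha> z ^\<^sub>m\<^sub>i (- int T) * transition (int T) \<alpha> \<beta> 0 (int m') z)) $$ (r, i)))"
    unfolding double_integral_def using r i mat_contour_integral_carrier
    by (subst index_smult_mat) (auto simp: mat_contour_integral_def)
  also have "\<dots> = 1 / (2 * of_real pi * \<i>) ^ 2 * contour_integral \<gamma>1 (\<lambda>w. contour_integral \<gamma>01 (\<lambda>z.
      1 / (z * (z - w)) * ((w ^ K * (z - 1) ^ (2 * h)) / (z ^ n * (w - 1) ^ (2 * h)))
      * ent (A m w * (walk_inv eps 0 (2 * h) z * walk eps 0 (2 * m') z)) r i))"
    by (intro arg_cong2[of _ _ _ _ "(*)"] refl contour_integral_eq integrand)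
  also have "\<dots> = double_part A (2 * m') (Suc n) i"
    using double_integral_eq_double_part[OF A, of "2 * m'" n i] m' by simp
  finally show ?thesis .
qed

lemma single_integral_index:
  assumes i: "i < 2" and m': "m < m'"
  shows "single_integral (int T) \<alpha> \<beta> \<gamma>01 (int m) (int K - diamond_size) (int m') (int n - diamond_size) $$ (r, i) = transition_part (2 * m') (Suc n) i"
proof -
  have "single_integral (int T) \<alpha> \<beta> \<gamma>01 (int m) (int K - diamond_size) (int m') (int n - diamond_size) $$ (r, i)
    = 1 / (2 * of_real pi * \<i>) * contour_integral \<gamma>01 (\<lambda>z.
      ((1 / z * z powi (int K - diamond_size - (int n - diamond_size))) \<cdot>\<^sub>m transition (int T) \<alpha> \<beta> (int m) (int m') z) $$ (r, i))"
    unfolding single_integral_def using r i by (simp add: mat_contour_integral_def)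
  also have "\<dots> = 1 / (2 * of_real pi * \<i>) * contour_integral \<gamma>01 (\<lambda>z. z ^ K / z ^ Suc n * ent (walk eps (2 * m) (2 * m' - 2 * m) z) r i)"
  proof (intro arg_cong2[of _ _ _ _ "(*)"] refl contour_integral_eq)
    fix z assume z: "z \<in> path_image \<gamma>01"
    note z01 = contour_points(3,4)[OF z]
    have "z powi (int K - diamond_size - (int n - diamond_size)) = z ^ K / z ^ n"
      using power_int_diff[of z "int K" "int n"] z01 by (simp add: power_int_of_nat)
    moreover have "transition (int T) \<alpha> \<beta> (int m) (int m') z = to_mat (walk eps (2 * m) (2 * m' - 2 * m) z)"
      using transition_eq[OF z01, of m m'] m' by (simp add: right_diff_distrib')
    ultimately show "((1 / z * z powi (int K - diamond_size - (int n - diamond_size))) \<cdot>\<^sub>m transition (int T) \<alpha> \<beta> (int m) (int m') z) $$ (r, i)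
      = z ^ K / z ^ Suc n * ent (walk eps (2 * m) (2 * m' - 2 * m) z) r i"
      using r i by (simp add: to_mat_index)
  qed
  finally show ?thesis by (simp add: transition_part_def)
qed

lemma kernel_block_eq_formula:
  assumes i: "i < 2" and m': "0 < m'" "m' < 2 * h" and n: "n < 2 * h"
  shows "kernel_block diamond_size (int T) \<alpha> \<beta> \<gamma>1 \<gamma>01 (int m) (int K - diamond_size) (int m') (int n - diamond_size) $$ (r, i)
    = formula (2 * m') (Suc n) i"
proof -
  have nz: "\<alpha> \<noteq> 0" "\<beta> \<noteq> 0" using \<alpha> \<beta> by auto
  note dbl = double_integral_index[OF _ _ i less_imp_le[OF m'(2)] n]
  have carr: "double_integral N' T' a b g g' x y z AA \<in> carrier_mat 2 2"
    "single_integral T' a b g' x y z t \<in> carrier_mat 2 2" for N' T' a b g g' x y z AA t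
    unfolding double_integral_def single_integral_def using mat_contour_integral_carrier by auto
  have phiB: "Phi \<beta> w ^\<^sub>m\<^sub>i (diamond_size div 2 - int T) = to_mat (phi \<beta> w ^ (h - T))" if w: "w \<in> path_image \<gamma>1" for w
    using T contour_points(1)[OF w] by (simp add: Phi_powi[OF contour_points(2)[OF w] _ nz(2)] nat_diff_distrib)
  define S where "S = (if int m' > int m then - single_integral (int T) \<alpha> \<beta> \<gamma>01 (int m) (int K - diamond_size) (int m') (int n - diamond_size) else 0\<^sub>m 2 2)"
  have S: "S \<in> carrier_mat 2 2" "S $$ (r, i) = - (if 2 * m < 2 * m' then transition_part (2 * m') (Suc n) i else 0)"
  proof -
    show "S \<in> carrier_mat 2 2" using carr(2) by (auto simp: S_def)
    show "S $$ (r, i) = - (if 2 * m < 2 * m' then transition_part (2 * m') (Suc n) i else 0)"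
      using single_integral_index[OF i, of m' n] carr(2)[of "int T" \<alpha> \<beta> \<gamma>01 "int m" "int K - diamond_size" "int m'" "int n - diamond_size"] r i
      by (auto simp: S_def)
  qed
  have add: "(S + (X + Y)) $$ (r, i) = S $$ (r, i) + (X $$ (r, i) + Y $$ (r, i))"
    if "X \<in> carrier_mat 2 2" "Y \<in> carrier_mat 2 2" for X Y
    using that S(1) r i by auto
  have inv_powi: "inverse x powi k = x powi (- k)" for x :: complex and k
    by (simp add: power_int_inverse power_int_minus)
  show ?thesis
  proof (cases "m \<le> T")
    case True
    have 1: "eig_r1 \<alpha> w powi (int T - int m) \<cdot>\<^sub>m proj_F1 \<alpha> w * Phi \<beta> w ^\<^sub>m\<^sub>i (diamond_size div 2 - int T) = to_mat (factor1 m w)"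
      if w: "w \<in> path_image \<gamma>1" for w
    proof -
      have w1: "w \<noteq> 1" using contour_points(1)[OF w] by simp
      have "eig_r1 \<alpha> w powi (int T - int m) = inverse (rho \<alpha> w) ^ (T - m)"
        using power_int_of_nat[of "inverse (rho \<alpha> w)" "T - m"] True eig_r_eq(1)[OF \<alpha>(1) w1] by (simp add: of_nat_diff)
      then show ?thesis
        using True by (simp only: phiB[OF w] proj_F_eq_to_mat to_mat_smult to_mat_mult factor1_def if_True)
    qed
    have 2: "(eig_r2 \<alpha> w powi (int T - int m) * c_fun \<alpha> \<beta> w) \<cdot>\<^sub>m (proj_F2 \<alpha> w * proj_F1 \<beta> w * proj_F1 \<alpha> w) *
        Phi \<beta> w ^\<^sub>m\<^sub>i (diamond_size div 2 - int T) = to_mat (factor2 m w)"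
      if w: "w \<in> path_image \<gamma>1" for w
    proof -
      have w1: "w \<noteq> 1" using contour_points(1)[OF w] by simp
      have "eig_r2 \<alpha> w powi (int T - int m) = rho \<alpha> w ^ (T - m)"
        using power_int_of_nat[of "rho \<alpha> w" "T - m"] True eig_r_eq(2)[OF \<alpha>(1) w1] by (simp add: of_nat_diff)
      then show ?thesis
        using True by (simp only: phiB[OF w] proj_F_eq_to_mat to_mat_smult to_mat_mult factor2_def if_True)
    qed
    have mT: "int m \<le> int T" using True by simp
    have "kernel_block diamond_size (int T) \<alpha> \<beta> \<gamma>1 \<gamma>01 (int m) (int K - diamond_size) (int m') (int n - diamond_size) $$ (r, i)
      = S $$ (r, i) + (double_part factor1 (2 * m') (Suc n) i + double_part factor2 (2 * m') (Suc n) i)"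
      unfolding kernel_block_def S_def[symmetric] if_P[OF mT] add[OF carr(1) carr(1)]
      by (simp only: dbl[OF admissible_factors(1) 1] dbl[OF admissible_factors(2) 2])
    then show ?thesis unfolding S formula_def by simp
  next
    case False
    have 1: "eig_r1 \<beta> w powi (diamond_size div 2 - int m) \<cdot>\<^sub>m proj_F1 \<beta> w = to_mat (factor1 m w)"
      if w: "w \<in> path_image \<gamma>1" for w
    proof -
      have w1: "w \<noteq> 1" using contour_points(1)[OF w] by simp
      have "eig_r1 \<beta> w powi (diamond_size div 2 - int m) = rho \<beta> w powi (int m - int h)"
        unfolding eig_r_eq(1)[OF \<beta>(1) w1] inv_powi by simp
      then show ?thesis
        using False by (simp only: proj_F_eq_to_mat to_mat_smult factor1_def if_False)
    qed
    have 2: "(eig_r1 \<beta> w powi (2 * int T - diamond_size div 2 - int m) * c_fun \<alpha> \<beta> w) \<cdot>\<^sub>m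
         (proj_F1 \<beta> w * proj_F1 \<alpha> w * proj_F2 \<beta> w) = to_mat (factor2 m w)"
      if w: "w \<in> path_image \<gamma>1" for w
    proof -
      have w1: "w \<noteq> 1" using contour_points(1)[OF w] by simp
      have "- (2 * int T - diamond_size div 2 - int m) = int h + int m - 2 * int T" by simp
      then have "eig_r1 \<beta> w powi (2 * int T - diamond_size div 2 - int m) = rho \<beta> w powi (int h + int m - 2 * int T)"
        unfolding eig_r_eq(1)[OF \<beta>(1) w1] inv_powi by (simp only:)
      then show ?thesis
        using False by (simp only: proj_F_eq_to_mat to_mat_smult to_mat_mult factor2_def if_False)
    qed
    have mT: "\<not> int m \<le> int T" using False by simp
    have "kernel_block diamond_size (int T) \<alpha> \<beta> \<gamma>1 \<gamma>01 (int m) (int K - diamond_size) (int m') (int n - diamond_size) $$ (r, i)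
      = S $$ (r, i) + (double_part factor1 (2 * m') (Suc n) i + double_part factor2 (2 * m') (Suc n) i)"
      unfolding kernel_block_def S_def[symmetric] if_not_P[OF mT] add[OF carr(1) carr(1)]
      by (simp only: dbl[OF admissible_factors(1) 1] dbl[OF admissible_factors(2) 2])
    then show ?thesis unfolding S formula_def by simp
  qed
qed

end

theorem theorem1:
  fixes \<alpha> \<beta> t :: real and N T :: int
  assumes "0 < \<alpha>" "\<alpha> < 1" "0 < \<beta>" "\<beta> < 1"
    and "0 < t" "t < 1 / 2"
    and "0 < N" "even N"
    and "t * of_int N = of_int T"
  shows "\<exists>K. correlation_kernel N T \<alpha> \<beta> K \<and>
    (\<forall>m m' \<xi> \<xi>' i j \<gamma>1 \<gamma>01.
      0 < m \<and> m < N \<and> 0 < m' \<and> m' < N \<and>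
      - N \<le> \<xi> \<and> \<xi> \<le> - 1 \<and> - N \<le> \<xi>' \<and> \<xi>' \<le> - 1 \<and>
      i \<in> {0, 1} \<and> j \<in> {0, 1} \<and> admissible_contours \<alpha> \<beta> \<gamma>1 \<gamma>01 \<longrightarrow>
      K (4 * m', 2 * \<xi>' + int j) (4 * m, 2 * \<xi> + int i)
        = kernel_block N T \<alpha> \<beta> \<gamma>1 \<gamma>01 m' \<xi>' m \<xi> $$ (j, i))"
proof -
  define h where "h = nat (N div 2)"
  define T' where "T' = nat T"
  have N_int: "N = 2 * int h" using assms(7,8) by (auto simp: h_def)
  have "0 < t * of_int N" using assms(5,7) by simp
  then have "0 < T" unfolding assms(9) by simp
  then have T_int: "T = int T'" "0 < T'" by (auto simp: T'_def)
  have "t * of_int N < 1 / 2 * of_int N" using assms(6,7) by (intro mult_strict_right_mono) auto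
  then have "of_int T < (of_int (int h) :: real)" unfolding assms(9) unfolding N_int by simp
  then have Th: "T' < h" using T_int by simp
  interpret split_model \<alpha> \<beta> T' h by unfold_locales (use assms T_int Th in auto)
  obtain K where K: "correlation_kernel N T \<alpha> \<beta> K"
    and Kv: "\<And>q v p. q \<in> points N \<Longrightarrow> p \<in> points N \<Longrightarrow>
      solves_kasteleyn N (real_weight T \<alpha> \<beta>) (point_source N (real_weight T \<alpha> \<beta>) q) v \<Longrightarrow>
      K q p = v (black_vertex N p)"
    using correlation_kernel_from_solutions[OF assms(7,1,3), of T] by blast
  have "K (4 * m', 2 * \<xi>' + int j) (4 * m, 2 * \<xi> + int i) = kernel_block N T \<alpha> \<beta> \<gamma>1 \<gamma>01 m' \<xi>' m \<xi> $$ (j, i)"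
    if m: "0 < m" "m < N" and m': "0 < m'" "m' < N" and x: "- N \<le> \<xi>" "\<xi> \<le> - 1" and x': "- N \<le> \<xi>'" "\<xi>' \<le> - 1"
      and ij: "i \<in> {0, 1}" "j \<in> {0, 1}" and adm: "admissible_contours \<alpha> \<beta> \<gamma>1 \<gamma>01"
    for m m' \<xi> \<xi>' i j \<gamma>1 \<gamma>01
  proof -
    define a where "a = nat m" define b where "b = nat m'"
    define n where "n = nat (\<xi> + N)" define k where "k = nat (\<xi>' + N)"
    have eqs: "m = int a" "m' = int b" "\<xi> = int n - 2 * int h" "\<xi>' = int k - 2 * int h"
      using m m' x x' N_int by (auto simp: a_def b_def n_def k_def)
    have bounds: "0 < a" "a < 2 * h" "0 < b" "b < 2 * h" "n < 2 * h" "k < 2 * h" "i < 2" "j < 2"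
      using m m' x x' N_int ij eqs by auto
    have q: "(4 * m', 2 * \<xi>' + int j) \<in> points N" and p: "(4 * m, 2 * \<xi> + int i) \<in> points N"
      unfolding points_def using m m' x x' ij by auto
    interpret kernel_setup \<alpha> \<beta> T' h \<gamma>1 \<gamma>01 b k j
      by unfold_locales (use adm bounds in auto)
    have "K (4 * m', 2 * \<xi>' + int j) (4 * m, 2 * \<xi> + int i) = formula_vertex (black_vertex N (4 * m, 2 * \<xi> + int i))"
      unfolding eqs N_int T_int(1) by (rule Kv[unfolded eqs N_int T_int(1), OF q[unfolded eqs N_int T_int(1)] p[unfolded eqs N_int T_int(1)] formula_solves_kasteleyn])
    also have "black_vertex N (4 * m, 2 * \<xi> + int i) = (2 * int (2 * a), 4 * int n + 2 * int i + 1)"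
      by (simp add: black_vertex_def eqs N_int)
    also have "formula_vertex \<dots> = formula (2 * a) (Suc n) i"
    proof (cases "i = 0")
      case True
      then show ?thesis using formula_vertex_eq(1)[of "2 * a" n] by simp
    next
      case False
      then have "i = 1" "4 * int n + 2 * int i + 1 = 4 * int n + 3" using ij(1) by auto
      then show ?thesis by (simp only: formula_vertex_eq(3))
    qed
    also have "\<dots> = kernel_block N T \<alpha> \<beta> \<gamma>1 \<gamma>01 m' \<xi>' m \<xi> $$ (j, i)"
      unfolding eqs N_int T_int(1) by (rule kernel_block_eq_formula[OF bounds(7,1,2,5), symmetric])
    finally show ?thesis .
  qed
  then show ?thesis using K by blast
qed

end
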